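(* Let $\Omega\subset Q^\pi_m$ be generic and $\Lambda=\{(t,x_t):t\in\mathbb{R}_+,x\in\Omega\}$. For all $\phi,\psi\in\mathcal{L}_b(\Lambda)$, the functional $\{\phi,\psi\}:\Lambda\to\mathbb{R}^m$ defined by $$\{\phi,\psi\}(t,x_t):=\Big(\psi\int_0^{\cdot}\phi\,dx+\phi\int_0^{\cdot}\psi\,dx\Big)(t,x_{t-})=\psi(t,x_{t-})\,\mathbf{I}_\phi(t,x_{t-})+\phi(t,x_{t-})\,\mathbf{I}_\psi(t,x_{t-})$$ belongs to $\mathcal{L}_b(\Lambda)$, and, as functionals on $\Lambda$, $$\Big(\int\phi\,dx\Big)\Big(\int\psi\,dx\Big)=\int\phi\psi'\,d[x]+\int\{\phi,\psi\}\,dx ,$$ i.e. for all $(t,x_t)\in\Lambda$, $\mathbf{I}_\phi(t,x_t)\,\mathbf{I}_\psi(t,x_t)=\sum_{i,j}\int_0^t\phi_i(s,x_{s-})\psi_j(s,x_{s-})\,d[x_i,x_j](s)+\mathbf{I}_{\{\phi,\psi\}}(t,x_t)$.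
   Context: Partitions: $\pi=(\pi_n)_{n\ge1}$ is a fixed sequence of partitions $\pi_n=(0=t^n_0<\dots<t^n_{k_n}<\infty)$ of $[0,\infty)$ with $t^n_{k_n}\to\infty$ and mesh vanishing on compacts; the superscript $n$ is dropped and sums involving $t_{i+1}$ run over $i<k_n$. Paths: $D_m$ is the space of càdlàg functions $[0,\infty)\to\mathbb{R}^m$, $x(0-):=x(0)$, $\Delta x(t):=x(t)-x(t-)$; $x_t(s):=x(s\wedge t)$, $x_{t-}(s):=x(s)1_{s<t}+x(t-)1_{s\ge t}$. $x^n:=\sum_{t_i\in\pi_n}x(t_{i+1})1_{[t_i,t_{i+1})}$, and $x^n_t,x^n_{t-}$ are the stopped versions of $x^n$. $Q^\pi_m$ is the set of $x\in D_m$ for which $q_n(t):=\sum_{\pi_n\ni t_i\le t}(x(t_{i+1})-x(t_i))(x(t_{i+1})-x(t_i))'$ converges in the Skorokhod $J_1$ topology; the limit is $[x]=([x_i,x_j])_{i,j}$, with entries of locally bounded variation. Generic sets: a nonempty $\Omega\subset D_m$ is generic if (i) for every $x\in\Omega$, $T>0$ there is $N=N_T(x)$ with $x^n_T\in\Omega$ for all $n\ge N$; (ii) for every $x\in\Omega$, $t\ge0$ there is a convex neighbourhood $\mathcal{U}$ of $0$ in $\mathbb{R}^m$ with $-\Delta x(t)\in\mathcal{U}$ and $x_t+e1_{[t,\infty)}\in\Omega$ for all $e\in\mathcal{U}$. Continuity of functionals $F$ on $\Lambda$: let $t'_n:=\max\{t_i<t:t_i\in\pi_n\}$ (and $0$ if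 there is no such $t_i$). $F$ is left-continuous if for all $(t,x_t)\in\Lambda$ ($x\in\Omega$): 1(a) $\lim_{s\uparrow t,\,s\le t}F(s,x_{s-})=F(t,x_{t-})$; 1(b) $\lim_{s\uparrow t,\,s<t}F(s,x_s)=F(t,x_{t-})$; 1(c) $t_n\to t$, $t_n\le t'_n$ implies $F(t_n,x^n_{t_n-})\to F(t,x_{t-})$; 1(d) $t_n\to t$, $t_n<t'_n$ implies $F(t_n,x^n_{t_n})\to F(t,x_{t-})$. $F$ is right-continuous if for all such $(t,x_t)$: 2(a) $\lim_{s\downarrow t,\,s\ge t}F(s,x_s)=F(t,x_t)$; 2(b) $\lim_{s\downarrow t,\,s>t}F(s,x_{s-})=F(t,x_t)$; 2(c) $t_n\to t$, $t_n\ge t'_n$ implies $F(t_n,x^n_{t_n})\to F(t,x_t)$; 2(d) $t_n\to t$, $t_n>t'_n$ implies $F(t_n,x^n_{t_n-})\to F(t,x_t)$. $F$ is continuous if it is both left- and right-continuous. Vector-valued functionals: componentwise. Derivatives: $\mathcal{D}F(t,x_t):=\lim_{h\downarrow0}\frac{F(t+h,x_t)-F(t,x_t)}{h}$; $\nabla_xF(t,x_t)$ is the gradient at $e=0$ of $e\mapsto F(t,x_t+e1_{[t,\infty)})$. $F$ is differentiable if both exist at every point of $\Lambda$. $F$ is strictly causal if $F(t,x_t)=F(t,x_{t-})$ on $\Lambda$. $F$ is locally bounded if for every $x\in\Omega$, $T\ge0$ there is $n_0\ge N_T(x)$ such that the family $(t\mapsto F(t,x^n_t))_{n\ge n_0}$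 is bounded on $[0,T]$ uniformly in $n\ge n_0$. $\mathcal{M}_b(\Lambda)$: continuous differentiable $F:\Lambda\to\mathbb{R}$ such that $\mathcal{D}F=0$ and $\nabla_xF$ is left-continuous, strictly causal and locally bounded. $\mathcal{L}_b(\Lambda):=\{\nabla_xF: F\in\mathcal{M}_b(\Lambda)\}$. Pathwise integral: for $\phi\in\mathcal{L}_b(\Lambda)$, $\int_0^t\phi\,dx=\mathbf{I}_\phi(t,x_t):=\lim_n\sum_{\pi_n\ni t_i\le t}\phi(t_i,x^n_{t_i-})\cdot(x(t_{i+1})-x(t_i))$; this limit exists for every $(t,x_t)\in\Lambda$. *)

theory Defs
  imports "HOL-Analysis.Analysis"
begin

(* Encoding of paths: a function x on [0,\<infinity>) is represented by the function on all of
   \<real> that is constant equal to x(0) on the negative half-line. Distinct paths have distinct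
   representatives, and the left limit at 0 is x(0), which is the convention x(0-) = x(0).
   Every construction of paths below respects this encoding; this is the purpose of the
   occurrences of max 0 s.

   Encoding of functionals: F is a total function of a time t and a path y; only its values at
   the points (t, x_t) of \<Lambda> (t \<ge> 0, x \<in> \<Omega>) are meaningful, and the notions below depend on
   these values only. *)

type_synonym ('m, 'b) functional = "real \<Rightarrow> (real \<Rightarrow> real ^ 'm) \<Rightarrow> 'b"

subsection \<open>Partitions\<close>

(* \<pi> n is the list of the partition points t_0 < ... < t_k, so k = length (\<pi> n) - 1 and the
   condition i < k reads Suc i < length (\<pi> n). *)
definition partition_seq :: "(nat \<Rightarrow> real list) \<Rightarrow> bool" where
  "partition_seq \<pi> \<longleftrightarrow>
     (\<forall>n. \<pi> n \<noteq> [] \<and> hd (\<pi> n) = 0 \<and> sorted_wrt (<) (\<pi> n)) \<and>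
     filterlim (\<lambda>n. last (\<pi> n)) at_top sequentially \<and>
     (\<forall>T. \<forall>\<epsilon>>0. \<forall>\<^sub>F n in sequentially.
        \<forall>i. Suc i < length (\<pi> n) \<and> \<pi> n ! i \<le> T \<longrightarrow> \<pi> n ! Suc i - \<pi> n ! i < \<epsilon>)"

definition last_before :: "(nat \<Rightarrow> real list) \<Rightarrow> nat \<Rightarrow> real \<Rightarrow> real" where
  "last_before \<pi> n t =
     (if \<exists>u\<in>set (\<pi> n). u < t then Max {u \<in> set (\<pi> n). u < t} else 0)"

subsection \<open>Paths\<close>

definition cadlag :: "(real \<Rightarrow> 'a::topological_space) \<Rightarrow> bool" where
  "cadlag x \<longleftrightarrow>
     (\<forall>s<0. x s = x 0) \<and>
     (\<forall>t\<ge>0. (x \<longlongrightarrow> x t) (at_right t) \<and> (\<exists>l. (x \<longlongrightarrow> l) (at_left t)))"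

definition left_lim :: "(real \<Rightarrow> 'a::t2_space) \<Rightarrow> real \<Rightarrow> 'a" where
  "left_lim x t = Lim (at_left t) x"

lemma left_lim_0:
  assumes "cadlag x"
  shows "left_lim x 0 = x 0"
proof -
  have "\<forall>\<^sub>F s in at_left (0::real). x s = x 0"
    using assms by (auto simp: cadlag_def eventually_at_filter)
  then show ?thesis
    unfolding left_lim_def by (intro tendsto_Lim tendsto_eventually) auto
qed

definition jump :: "(real \<Rightarrow> 'a::real_normed_vector) \<Rightarrow> real \<Rightarrow> 'a" where
  "jump x t = x t - left_lim x t"

definition stop :: "(real \<Rightarrow> 'a) \<Rightarrow> real \<Rightarrow> real \<Rightarrow> 'a" where
  "stop x t = (\<lambda>s. x (min s t))"

definition stop_left :: "(real \<Rightarrow> 'a::t2_space) \<Rightarrow> real \<Rightarrow> real \<Rightarrow> 'a" where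
  "stop_left x t = (\<lambda>s. if s < t then x s else left_lim x t)"

(* x + e 1_{[t,\<infinity>)} *)
definition bump :: "(real \<Rightarrow> 'a::real_vector) \<Rightarrow> real \<Rightarrow> 'a \<Rightarrow> real \<Rightarrow> 'a" where
  "bump x t e = (\<lambda>s. x s + (if t \<le> max 0 s then e else 0))"

(* The step path x^n; it vanishes after the last point of \<pi> n. *)
definition step_path ::
  "(nat \<Rightarrow> real list) \<Rightarrow> nat \<Rightarrow> (real \<Rightarrow> 'a::real_vector) \<Rightarrow> real \<Rightarrow> 'a" where
  "step_path \<pi> n x = (\<lambda>s. \<Sum>i | Suc i < length (\<pi> n).
     indicator {\<pi> n ! i ..< \<pi> n ! Suc i} (max 0 s) *\<^sub>R x (\<pi> n ! Suc i))"

subsection \<open>Quadratic variation\<close>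

(* Sequential convergence in the Skorokhod J1 topology of cadlag functions on [0,\<infinity>), by
   means of time changes: increasing homeomorphisms of [0,\<infinity>) tending uniformly to the
   identity, with convergence of the time-changed functions uniform on compacts. *)
definition J1_tendsto ::
  "(nat \<Rightarrow> real \<Rightarrow> 'a::metric_space) \<Rightarrow> (real \<Rightarrow> 'a) \<Rightarrow> bool" where
  "J1_tendsto f g \<longleftrightarrow>
     (\<exists>\<theta> :: nat \<Rightarrow> real \<Rightarrow> real.
        (\<forall>n. strict_mono_on {0..} (\<theta> n) \<and> continuous_on {0..} (\<theta> n) \<and> \<theta> n ` {0..} = {0..}) \<and>
        uniform_limit {0..} \<theta> (\<lambda>s. s) sequentially \<and>
        (\<forall>T. uniform_limit {0..T} (\<lambda>n s. f n (\<theta> n s)) g sequentially))"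

definition qv_sum ::
  "(nat \<Rightarrow> real list) \<Rightarrow> (real \<Rightarrow> real ^ 'm) \<Rightarrow> nat \<Rightarrow> real \<Rightarrow> real ^ 'm ^ 'm" where
  "qv_sum \<pi> x n t = (\<Sum>i | Suc i < length (\<pi> n) \<and> \<pi> n ! i \<le> max 0 t.
     (\<chi> j k. (x (\<pi> n ! Suc i) - x (\<pi> n ! i)) $ j * (x (\<pi> n ! Suc i) - x (\<pi> n ! i)) $ k))"

definition Q_paths :: "(nat \<Rightarrow> real list) \<Rightarrow> (real \<Rightarrow> real ^ 'm) set" where
  "Q_paths \<pi> = {x. cadlag x \<and> (\<exists>q. cadlag q \<and> J1_tendsto (qv_sum \<pi> x) q)}"

(* [x]; the entry [x_i, x_j](s) is quad_var \<pi> x s $ i $ j. *)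
definition quad_var ::
  "(nat \<Rightarrow> real list) \<Rightarrow> (real \<Rightarrow> real ^ 'm) \<Rightarrow> real \<Rightarrow> real ^ 'm ^ 'm" where
  "quad_var \<pi> x = (THE q. cadlag q \<and> J1_tendsto (qv_sum \<pi> x) q)"

(* Lebesgue-Stieltjes integral over (0,t] of f against a right-continuous A of locally bounded
   variation, by writing A as a difference of nondecreasing right-continuous functions; the
   value does not depend on the decomposition. *)
definition has_LS_integral ::
  "(real \<Rightarrow> real) \<Rightarrow> (real \<Rightarrow> real) \<Rightarrow> real \<Rightarrow> real \<Rightarrow> bool" where
  "has_LS_integral f A t I \<longleftrightarrow>
     (\<exists>g h. mono g \<and> mono h \<and>
        (\<forall>s. continuous (at_right s) g) \<and> (\<forall>s. continuous (at_right s) h) \<and>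
        (\<forall>s\<ge>0. A s = g s - h s) \<and>
        set_integrable (interval_measure g) {0<..t} f \<and>
        set_integrable (interval_measure h) {0<..t} f \<and>
        I = (LINT s:{0<..t}|interval_measure g. f s) - (LINT s:{0<..t}|interval_measure h. f s))"

definition LS_integral :: "(real \<Rightarrow> real) \<Rightarrow> (real \<Rightarrow> real) \<Rightarrow> real \<Rightarrow> real" where
  "LS_integral f A t = (THE I. has_LS_integral f A t I)"

subsection \<open>Generic sets of paths\<close>

definition generic :: "(nat \<Rightarrow> real list) \<Rightarrow> (real \<Rightarrow> real ^ 'm) set \<Rightarrow> bool" where
  "generic \<pi> \<Omega> \<longleftrightarrow>
     \<Omega> \<noteq> {} \<and> (\<forall>x\<in>\<Omega>. cadlag x) \<and>
     (\<forall>x\<in>\<Omega>. \<forall>T>0. \<exists>N. \<forall>n\<ge>N. stop (step_path \<pi> n x) T \<in> \<Omega>) \<and>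
     (\<forall>x\<in>\<Omega>. \<forall>t\<ge>0. \<exists>U. convex U \<and> 0 \<in> interior U \<and> - jump x t \<in> U \<and>
        (\<forall>e\<in>U. bump (stop x t) t e \<in> \<Omega>))"

subsection \<open>Continuity of functionals\<close>

(* In the sequential conditions the constraints on the times are imposed for all large n:
   last_before \<pi> n t may be 0 for small n, so that no time is strictly below it. *)
definition left_continuous ::
  "(nat \<Rightarrow> real list) \<Rightarrow> (real \<Rightarrow> real ^ 'm) set \<Rightarrow> ('m::finite, 'b::t2_space) functional \<Rightarrow> bool" where
  "left_continuous \<pi> \<Omega> F \<longleftrightarrow>
     (\<forall>x\<in>\<Omega>. \<forall>t\<ge>0.
        ((\<lambda>s. F s (stop_left x s)) \<longlongrightarrow> F t (stop_left x t)) (at t within {0..t}) \<and>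
        ((\<lambda>s. F s (stop x s)) \<longlongrightarrow> F t (stop_left x t)) (at t within {0..<t}) \<and>
        (\<forall>\<tau>. \<tau> \<longlonglongrightarrow> t \<and> (\<forall>\<^sub>F n in sequentially. 0 \<le> \<tau> n \<and> \<tau> n \<le> last_before \<pi> n t) \<longrightarrow>
           (\<lambda>n. F (\<tau> n) (stop_left (step_path \<pi> n x) (\<tau> n))) \<longlonglongrightarrow> F t (stop_left x t)) \<and>
        (\<forall>\<tau>. \<tau> \<longlonglongrightarrow> t \<and> (\<forall>\<^sub>F n in sequentially. 0 \<le> \<tau> n \<and> \<tau> n < last_before \<pi> n t) \<longrightarrow>
           (\<lambda>n. F (\<tau> n) (stop (step_path \<pi> n x) (\<tau> n))) \<longlonglongrightarrow> F t (stop_left x t)))"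

definition right_continuous ::
  "(nat \<Rightarrow> real list) \<Rightarrow> (real \<Rightarrow> real ^ 'm) set \<Rightarrow> ('m::finite, 'b::t2_space) functional \<Rightarrow> bool" where
  "right_continuous \<pi> \<Omega> F \<longleftrightarrow>
     (\<forall>x\<in>\<Omega>. \<forall>t\<ge>0.
        ((\<lambda>s. F s (stop x s)) \<longlongrightarrow> F t (stop x t)) (at t within {t..}) \<and>
        ((\<lambda>s. F s (stop_left x s)) \<longlongrightarrow> F t (stop x t)) (at t within {t<..}) \<and>
        (\<forall>\<tau>. \<tau> \<longlonglongrightarrow> t \<and> (\<forall>\<^sub>F n in sequentially. 0 \<le> \<tau> n \<and> \<tau> n \<ge> last_before \<pi> n t) \<longrightarrow>
           (\<lambda>n. F (\<tau> n) (stop (step_path \<pi> n x) (\<tau> n))) \<longlonglongrightarrow> F t (stop x t)) \<and>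
        (\<forall>\<tau>. \<tau> \<longlonglongrightarrow> t \<and> (\<forall>\<^sub>F n in sequentially. 0 \<le> \<tau> n \<and> \<tau> n > last_before \<pi> n t) \<longrightarrow>
           (\<lambda>n. F (\<tau> n) (stop_left (step_path \<pi> n x) (\<tau> n))) \<longlonglongrightarrow> F t (stop x t)))"

definition continuous_functional ::
  "(nat \<Rightarrow> real list) \<Rightarrow> (real \<Rightarrow> real ^ 'm) set \<Rightarrow> ('m::finite, 'b::t2_space) functional \<Rightarrow> bool" where
  "continuous_functional \<pi> \<Omega> F \<longleftrightarrow> left_continuous \<pi> \<Omega> F \<and> right_continuous \<pi> \<Omega> F"

subsection \<open>Derivatives and the classes of functionals\<close>

(* In the next four definitions y stands for a stopped path x_t. *)
definition has_time_deriv ::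
  "('m::finite, real) functional \<Rightarrow> real \<Rightarrow> (real \<Rightarrow> real ^ 'm) \<Rightarrow> real \<Rightarrow> bool" where
  "has_time_deriv F t y d \<longleftrightarrow> ((\<lambda>h. (F (t + h) y - F t y) / h) \<longlongrightarrow> d) (at_right 0)"

definition time_deriv :: "('m::finite, real) functional \<Rightarrow> ('m::finite, real) functional" where
  "time_deriv F t y = (THE d. has_time_deriv F t y d)"

definition has_space_grad ::
  "('m::finite, real) functional \<Rightarrow> real \<Rightarrow> (real \<Rightarrow> real ^ 'm) \<Rightarrow> real ^ 'm \<Rightarrow> bool" where
  "has_space_grad F t y D \<longleftrightarrow> GDERIV (\<lambda>e. F t (bump y t e)) 0 :> D"

definition space_grad :: "('m::finite, real) functional \<Rightarrow> ('m::finite, real ^ 'm) functional" where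
  "space_grad F t y = (THE D. has_space_grad F t y D)"

definition differentiable_functional ::
  "(real \<Rightarrow> real ^ 'm) set \<Rightarrow> ('m::finite, real) functional \<Rightarrow> bool" where
  "differentiable_functional \<Omega> F \<longleftrightarrow>
     (\<forall>x\<in>\<Omega>. \<forall>t\<ge>0. (\<exists>d. has_time_deriv F t (stop x t) d) \<and> (\<exists>D. has_space_grad F t (stop x t) D))"

definition strictly_causal :: "(real \<Rightarrow> real ^ 'm) set \<Rightarrow> ('m::finite, 'b) functional \<Rightarrow> bool" where
  "strictly_causal \<Omega> F \<longleftrightarrow> (\<forall>x\<in>\<Omega>. \<forall>t\<ge>0. F t (stop x t) = F t (stop_left x t))"

definition locally_bounded ::
  "(nat \<Rightarrow> real list) \<Rightarrow> (real \<Rightarrow> real ^ 'm) set \<Rightarrow> ('m::finite, 'b::real_normed_vector) functional \<Rightarrow> bool"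
  where
  "locally_bounded \<pi> \<Omega> F \<longleftrightarrow>
     (\<forall>x\<in>\<Omega>. \<forall>T\<ge>0. \<exists>n0.
        (\<forall>n\<ge>n0. stop (step_path \<pi> n x) T \<in> \<Omega>) \<and>
        (\<exists>C. \<forall>n\<ge>n0. \<forall>t\<in>{0..T}. norm (F t (stop (step_path \<pi> n x) t)) \<le> C))"

definition M_b ::
  "(nat \<Rightarrow> real list) \<Rightarrow> (real \<Rightarrow> real ^ 'm) set \<Rightarrow> ('m::finite, real) functional set" where
  "M_b \<pi> \<Omega> = {F.
     continuous_functional \<pi> \<Omega> F \<and> differentiable_functional \<Omega> F \<and>
     (\<forall>x\<in>\<Omega>. \<forall>t\<ge>0. time_deriv F t (stop x t) = 0) \<and>
     left_continuous \<pi> \<Omega> (space_grad F) \<and> strictly_causal \<Omega> (space_grad F) \<and>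
     locally_bounded \<pi> \<Omega> (space_grad F)}"

(* Functionals are identified when they agree on \<Lambda>. *)
definition L_b ::
  "(nat \<Rightarrow> real list) \<Rightarrow> (real \<Rightarrow> real ^ 'm) set \<Rightarrow> ('m::finite, real ^ 'm) functional set" where
  "L_b \<pi> \<Omega> = {\<phi>. \<exists>F\<in>M_b \<pi> \<Omega>. \<forall>x\<in>\<Omega>. \<forall>t\<ge>0. \<phi> t (stop x t) = space_grad F t (stop x t)}"

subsection \<open>Pathwise integral\<close>

(* I_\<phi>(t, x_t), computed from a path x; here t_{i+1} may exceed t, so the approximating sums
   (but not their limit) depend on x beyond t. *)
definition pathwise_integral ::
  "(nat \<Rightarrow> real list) \<Rightarrow> ('m::finite, real ^ 'm) functional \<Rightarrow> ('m::finite, real) functional" where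
  "pathwise_integral \<pi> \<phi> t x = lim (\<lambda>n. \<Sum>i | Suc i < length (\<pi> n) \<and> \<pi> n ! i \<le> t.
     \<phi> (\<pi> n ! i) (stop_left (step_path \<pi> n x) (\<pi> n ! i)) \<bullet> (x (\<pi> n ! Suc i) - x (\<pi> n ! i)))"

definition bracket ::
  "(nat \<Rightarrow> real list) \<Rightarrow> ('m::finite, real ^ 'm) functional \<Rightarrow> ('m::finite, real ^ 'm) functional \<Rightarrow>
     ('m::finite, real ^ 'm) functional" where
  "bracket \<pi> \<phi> \<psi> t y =
     pathwise_integral \<pi> \<phi> t (stop_left y t) *\<^sub>R \<psi> t (stop_left y t) +
     pathwise_integral \<pi> \<psi> t (stop_left y t) *\<^sub>R \<phi> t (stop_left y t)"

end

(* Let F, G be primitives of \<phi>, \<psi> in M_b, normalised to vanish at time 0. A functional with zero time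
   derivative is constant in time along a frozen path, and strict causality of its gradient makes it
   affine in the size of a bump; hence along step paths F is exactly the Riemann sum of \<phi>, and by
   continuity the integral of \<phi> along x is F itself. The sums of (\<phi> dx)(\<psi> dx) converge to the
   Stieltjes integral R of \<phi> \<psi>' against [x]: writing sums against a discrete measure as Lebesgue
   integrals of quantile functions turns the one-sided convergence of the integrands, together with the
   convergence of the discrete measures in the strong sense given by J1 convergence, into almost
   everywhere convergence. The functional K = F G - R is again constant along frozen paths; in the size
   of a bump the quadratic terms of F G and R cancel, so K is affine with slope {\<phi>, \<psi>}. Thus K is in
   M_b with gradient {\<phi>, \<psi>}, and the formula is the identity K = integral of {\<phi>, \<psi>} along x. *)

theory Submission
  imports Defs
begin

subsection \<open>Partitions\<close>


text \<open>The integrands are controlled only at times up to \<open>last_before \<pi> n t\<close>;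
  at later times near t nothing forces them towards a limit, so weak convergence of the discrete
  measures does not give convergence of the sums. Two facts repair this. The times t at which this
  matters are countable, so only atoms count; and under J1 convergence the jump of the sums is made
  exactly at \<open>last_before\<close>, the left end of the cell across which x jumps, so an atom
  is reached where the integrand is controlled. Mixed entries of [x] have no sign and are first
  expressed by quadratic variations of x_i + x_j. The limit is not identified through the quantiles:
  the same argument is run on [x] sampled along the partition, the two sums are compared, and the
  sampled sums are ordinary Stieltjes sums. The other obstacle, left continuity of R at a jump of x,
  is removed by passing to the path stopped just before t. Time 0 is exceptional: the step path
  starts at x(t_1), so the first Riemann term is not one of its jumps, and a bump at 0 moves the
  initial value.\<close>

locale partitions =
  fixes \<pi> :: "nat \<Rightarrow> real list"
  assumes partition: "partition_seq \<pi>"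
begin

abbreviation pt :: "nat \<Rightarrow> nat \<Rightarrow> real" where "pt n i \<equiv> \<pi> n ! i"

abbreviation idx :: "nat \<Rightarrow> real \<Rightarrow> nat set" where
  "idx n t \<equiv> {i. Suc i < length (\<pi> n) \<and> pt n i \<le> t}"

lemma length_pos: "0 < length (\<pi> n)"
  using partition by (auto simp: partition_seq_def)

lemma pt_0 [simp]: "pt n 0 = 0"
  using partition length_pos by (metis partition_seq_def hd_conv_nth)

lemma pt_less: "i < j \<Longrightarrow> j < length (\<pi> n) \<Longrightarrow> pt n i < pt n j"
  using partition by (auto simp: partition_seq_def intro: sorted_wrt_nth_less)

lemma pt_le: "i \<le> j \<Longrightarrow> j < length (\<pi> n) \<Longrightarrow> pt n i \<le> pt n j"
  using pt_less by (cases "i = j") (auto intro: less_imp_le)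

lemma pt_less_iff: "i < length (\<pi> n) \<Longrightarrow> j < length (\<pi> n) \<Longrightarrow> pt n i < pt n j \<longleftrightarrow> i < j"
  by (meson linorder_not_less pt_le pt_less)

lemma pt_nonneg: "i < length (\<pi> n) \<Longrightarrow> 0 \<le> pt n i"
  using pt_le[of 0 i n] by simp

lemma last_pt: "last (\<pi> n) = pt n (length (\<pi> n) - 1)"
  using length_pos by (simp add: last_conv_nth)

lemma pt_le_last: "i < length (\<pi> n) \<Longrightarrow> pt n i \<le> last (\<pi> n)"
  unfolding last_pt using length_pos[of n] by (intro pt_le) auto

lemma finite_idx [simp]: "finite (idx n t)"
  by (rule finite_subset[of _ "{..<length (\<pi> n)}"]) auto

lemma ex_cell:
  assumes "0 \<le> s" "s < last (\<pi> n)"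
  obtains j where "Suc j < length (\<pi> n)" "pt n j \<le> s" "s < pt n (Suc j)"
proof -
  let ?J = "idx n s"
  have ne: "?J \<noteq> {}"
  proof -
    have "length (\<pi> n) \<noteq> 1"
      using assms last_pt[of n] by (auto)
    then have "0 \<in> ?J"
      using assms length_pos[of n] by (simp add: less_Suc_eq) (metis Suc_lessI length_pos One_nat_def)
    then show ?thesis by blast
  qed
  define j where "j = Max ?J"
  have j: "j \<in> ?J"
    unfolding j_def using ne by (intro Max_in) auto
  have "s < pt n (Suc j)"
  proof (rule ccontr)
    assume "\<not> s < pt n (Suc j)"
    then have le: "pt n (Suc j) \<le> s" by simp
    have "Suc (Suc j) < length (\<pi> n)"
    proof (rule ccontr)
      assume "\<not> Suc (Suc j) < length (\<pi> n)"
      then have "length (\<pi> n) - 1 = Suc j" using j by auto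
      then show False using le assms last_pt[of n] by simp
    qed
    then have "Suc j \<in> ?J" using le by simp
    then have "Suc j \<le> j" unfolding j_def by (intro Max_ge) auto
    then show False by simp
  qed
  then show thesis using j that by blast
qed

text \<open>As the points increase, a sum over the points up to s runs over an initial segment
  ending at the cell of s; sums at different times are compared in this form.\<close>

lemma idx_eq:
  assumes "Suc j < length (\<pi> n)" "pt n j \<le> s" "s < pt n (Suc j)"
  shows "idx n s = {..j}"
proof (intro set_eqI iffI)
  fix i assume i: "i \<in> idx n s"
  then have "pt n i < pt n (Suc j)" using assms by auto
  then have "i < Suc j" using i assms by (subst (asm) pt_less_iff) auto
  then show "i \<in> {..j}" by simp
next
  fix i assume "i \<in> {..j}"
  then show "i \<in> idx n s"
    using pt_le[of i j n] assms by auto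
qed

lemma cell_unique:
  assumes "Suc j < length (\<pi> n)" "pt n j \<le> s" "s < pt n (Suc j)"
    and "Suc i < length (\<pi> n)" "pt n i \<le> s" "s < pt n (Suc i)"
  shows "i = j"
  using idx_eq[OF assms(1-3)] idx_eq[OF assms(4-6)] by (metis atMost_eq_iff)

section \<open>The last partition point before a time\<close>

lemma last_before_nonneg: "0 \<le> last_before \<pi> n t"
proof (cases "\<exists>u\<in>set (\<pi> n). u < t")
  case True
  then have "last_before \<pi> n t \<in> {u \<in> set (\<pi> n). u < t}"
    unfolding last_before_def by (subst if_P[OF True]) (intro Max_in, auto)
  then have "last_before \<pi> n t \<in> set (\<pi> n)" by blast
  then show ?thesis using pt_nonneg by (metis in_set_conv_nth)
qed (simp only: last_before_def if_False order_refl)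

text \<open>No partition point lies below 0, so the default value 0 applies. At t = 0 the conditions
  0 \<le> \<tau> n \<le> t'_n therefore leave only \<tau> n = 0.\<close>

lemma last_before_0 [simp]: "t \<le> 0 \<Longrightarrow> last_before \<pi> n t = 0"
proof -
  assume "t \<le> 0"
  then have "\<not> (\<exists>u\<in>set (\<pi> n). u < t)"
    using pt_nonneg by (metis in_set_conv_nth leD less_le_trans)
  then show ?thesis unfolding last_before_def by (rule if_not_P)
qed

lemma last_before_in:
  assumes "0 < t"
  shows "last_before \<pi> n t \<in> set (\<pi> n)" "last_before \<pi> n t < t"
proof -
  have *: "\<exists>u\<in>set (\<pi> n). u < t"
    using assms length_pos[of n] pt_0[of n] by (metis nth_mem)
  have "last_before \<pi> n t \<in> {u \<in> set (\<pi> n). u < t}"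
    unfolding last_before_def using * by (subst if_P[OF *]) (intro Max_in, auto)
  then show "last_before \<pi> n t \<in> set (\<pi> n)" "last_before \<pi> n t < t" by auto
qed

lemma last_before_le: "0 \<le> t \<Longrightarrow> last_before \<pi> n t \<le> t"
  using last_before_in[of t n] by (cases "t = 0") auto

lemma le_last_before:
  assumes "i < length (\<pi> n)" "pt n i < t"
  shows "pt n i \<le> last_before \<pi> n t"
proof -
  have "pt n i \<in> {u \<in> set (\<pi> n). u < t}" using assms by auto
  moreover have "\<exists>u\<in>set (\<pi> n). u < t" using assms by auto
  ultimately show ?thesis unfolding last_before_def by (auto intro!: Max_ge)
qed

text \<open>The cells are open on the left and closed on the right here, because
  \<open>last_before\<close> is strict; the step path uses the opposite convention. The cell that
  starts at \<open>last_before \<pi> n t\<close> is the one across which a jump of x at t shows up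
  as an increment.\<close>

lemma last_before_cell:
  assumes "Suc j < length (\<pi> n)" "pt n j < s" "s \<le> pt n (Suc j)"
  shows "last_before \<pi> n s = pt n j"
proof (rule antisym)
  have "0 < s" using assms pt_nonneg[of j n] by auto
  from last_before_in[OF this, of n] obtain i where i: "i < length (\<pi> n)" "pt n i = last_before \<pi> n s" "pt n i < s"
    by (metis in_set_conv_nth)
  then have "pt n i < pt n (Suc j)" using assms by linarith
  then have "i \<le> j" using i assms by (subst (asm) pt_less_iff) auto
  then show "last_before \<pi> n s \<le> pt n j" using i assms pt_le[of i j n] by auto
  show "pt n j \<le> last_before \<pi> n s" using assms by (intro le_last_before) auto
qed

lemma last_before_obtain:
  assumes "0 < s" "s \<le> last (\<pi> n)"
  obtains j where "Suc j < length (\<pi> n)" "pt n j = last_before \<pi> n s" "pt n j < s" "s \<le> pt n (Suc j)"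
proof -
  from last_before_in[OF assms(1), of n] obtain j where j: "j < length (\<pi> n)" "pt n j = last_before \<pi> n s" "pt n j < s"
    by (metis in_set_conv_nth)
  have "j \<noteq> length (\<pi> n) - 1"
    using j assms last_pt[of n] by auto
  then have S: "Suc j < length (\<pi> n)" using j by auto
  have "s \<le> pt n (Suc j)"
  proof (rule ccontr)
    assume "\<not> s \<le> pt n (Suc j)"
    then have "pt n (Suc j) \<le> last_before \<pi> n s" using S by (intro le_last_before) auto
    then show False using j S pt_less[of j "Suc j" n] by simp
  qed
  then show thesis using that j S by blast
qed

lemma last_ev: "\<forall>\<^sub>F n in sequentially. T < last (\<pi> n)"
  using partition unfolding partition_seq_def by (auto simp: filterlim_at_top_dense)

lemma mesh_ev:
  assumes "0 < \<epsilon>"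
  shows "\<forall>\<^sub>F n in sequentially. \<forall>i. Suc i < length (\<pi> n) \<and> pt n i \<le> T \<longrightarrow> pt n (Suc i) - pt n i < \<epsilon>"
  using partition assms unfolding partition_seq_def by blast

lemma last_before_tendsto:
  assumes "0 \<le> t"
  shows "(\<lambda>n. last_before \<pi> n t) \<longlonglongrightarrow> t"
proof (cases "t = 0")
  case False
  then have t: "0 < t" using assms by simp
  show ?thesis
  proof (rule LIMSEQ_I)
    fix r :: real assume "0 < r"
    from mesh_ev[OF this, of t] last_ev[of t]
    have "\<forall>\<^sub>F n in sequentially. norm (last_before \<pi> n t - t) < r"
    proof eventually_elim
      case (elim n)
      from last_before_obtain[OF t, of n] elim obtain j where
        "Suc j < length (\<pi> n)" "pt n j = last_before \<pi> n t" "pt n j < t" "t \<le> pt n (Suc j)" by auto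
      then show ?case using elim(1)[rule_format, of j] by auto
    qed
    then show "\<exists>no. \<forall>n\<ge>no. norm (last_before \<pi> n t - t) < r"
      by (simp add: eventually_sequentially)
  qed
qed simp

end

subsection \<open>Stopped paths\<close>

lemma cadlag_neg: "cadlag x \<Longrightarrow> s < 0 \<Longrightarrow> x s = x 0"
  by (auto simp: cadlag_def)

lemma cadlag_right: "cadlag x \<Longrightarrow> 0 \<le> t \<Longrightarrow> (x \<longlongrightarrow> x t) (at_right t)"
  by (auto simp: cadlag_def)

lemma left_lim_eqI:
  fixes x :: "real \<Rightarrow> 'a::t2_space"
  shows "(x \<longlongrightarrow> l) (at_left t) \<Longrightarrow> left_lim x t = l"
  unfolding left_lim_def by (intro tendsto_Lim) auto

lemma cadlag_left:
  fixes x :: "real \<Rightarrow> 'a::t2_space"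
  assumes "cadlag x" "0 \<le> t"
  shows "(x \<longlongrightarrow> left_lim x t) (at_left t)"
proof -
  obtain l where "(x \<longlongrightarrow> l) (at_left t)" using assms by (auto simp: cadlag_def)
  then show ?thesis using left_lim_eqI by blast
qed

text \<open>No existence of a limit is required: \<open>left_lim\<close> is a definite description,
  and paths that coincide just before t have the same predicate of being a left limit.\<close>

lemma left_lim_cong:
  fixes x y :: "real \<Rightarrow> 'a::t2_space"
  assumes "a < t" "\<And>s. a < s \<Longrightarrow> s < t \<Longrightarrow> x s = y s"
  shows "left_lim x t = left_lim y t"
proof -
  have ev: "\<forall>\<^sub>F s in at_left t. x s = y s"
    unfolding eventually_at_left_field using assms by (intro exI[of _ a]) auto
  have "(\<lambda>l. (x \<longlongrightarrow> l) (at_left t)) = (\<lambda>l. (y \<longlongrightarrow> l) (at_left t))"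
    using tendsto_cong[OF ev] by blast
  then show ?thesis unfolding left_lim_def Topological_Spaces.Lim_def by simp
qed

lemma left_lim_const:
  fixes x :: "real \<Rightarrow> 'a::t2_space"
  assumes "a < t" "\<And>s. a < s \<Longrightarrow> s < t \<Longrightarrow> x s = c"
  shows "left_lim x t = c"
proof -
  have "\<forall>\<^sub>F s in at_left t. x s = c"
    unfolding eventually_at_left_field using assms by (intro exI[of _ a]) auto
  then show ?thesis by (intro left_lim_eqI tendsto_eventually)
qed

lemma stop_stop [simp]: "stop (stop x a) b = stop x (min a b)"
  by (simp add: stop_def fun_eq_iff min.assoc min.commute[of a b])

lemma stop_stop_left [simp]: "stop (stop_left x t) t = stop_left x t"
  by (auto simp: stop_def stop_left_def fun_eq_iff min_def)

lemma stop_stop_left_less: "s < t \<Longrightarrow> stop (stop_left x t) s = stop x s"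
  by (auto simp: stop_def stop_left_def fun_eq_iff min_def)

lemma left_lim_stop: 
  fixes x :: "real \<Rightarrow> 'a::t2_space"
  shows "s \<le> t \<Longrightarrow> left_lim (stop x t) s = left_lim x s"
  by (rule left_lim_cong[of "s - 1"]) (auto simp: stop_def min_def)

lemma left_lim_stop_left: 
  fixes x :: "real \<Rightarrow> 'a::t2_space"
  shows "s \<le> t \<Longrightarrow> left_lim (stop_left x t) s = left_lim x s"
  by (rule left_lim_cong[of "s - 1"]) (auto simp: stop_left_def)

lemma stop_left_stop: 
  fixes x :: "real \<Rightarrow> 'a::t2_space"
  shows "s \<le> t \<Longrightarrow> stop_left (stop x t) s = stop_left x s"
  using left_lim_stop[of s t x] by (auto simp: stop_left_def fun_eq_iff stop_def)

lemma stop_left_stop_left: 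
  fixes x :: "real \<Rightarrow> 'a::t2_space"
  shows "s \<le> t \<Longrightarrow> stop_left (stop_left x t) s = stop_left x s"
  using left_lim_stop_left[of s t x] by (auto simp: stop_left_def fun_eq_iff)

lemma stop_left_stop_gt: 
  fixes x :: "real \<Rightarrow> 'a::t2_space"
  assumes "s < t"
  shows "stop_left (stop x s) t = stop x s"
proof -
  have "left_lim (stop x s) t = x s"
    using assms by (intro left_lim_const[of s]) (auto simp: stop_def)
  then show ?thesis using assms by (auto simp: stop_left_def stop_def fun_eq_iff)
qed

lemma stop_left_cong:
  fixes x y :: "real \<Rightarrow> 'a::t2_space"
  assumes "\<And>s. s < t \<Longrightarrow> x s = y s"
  shows "stop_left x t = stop_left y t"
proof -
  have "left_lim x t = left_lim y t"
    using assms by (intro left_lim_cong[of "t - 1"]) auto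
  then show ?thesis using assms by (auto simp: stop_left_def fun_eq_iff)
qed

lemma stop_0: "cadlag x \<Longrightarrow> stop x 0 = (\<lambda>s. x 0)"
  using cadlag_neg[of x] by (auto simp: stop_def fun_eq_iff min_def order_le_less)

lemma stop_left_0: "cadlag x \<Longrightarrow> stop_left x 0 = stop x 0"
  using cadlag_neg[of x] by (auto simp: stop_left_def stop_0 fun_eq_iff left_lim_0)

lemma stop_0_stop_left: "cadlag x \<Longrightarrow> 0 \<le> t \<Longrightarrow> stop (stop_left x t) 0 = stop x 0"
  by (cases "t = 0") (auto simp: stop_left_0 stop_stop_left_less)

lemma jump_stop: "s \<le> t \<Longrightarrow> jump (stop x t) s = jump x s"
  using left_lim_stop[of s t x] by (simp add: jump_def stop_def)

lemma jump_0: "cadlag x \<Longrightarrow> jump x 0 = 0"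
  by (simp add: jump_def left_lim_0)

lemma jump_stop_left: "jump (stop_left x t) t = 0"
  using left_lim_stop_left[of t t x] by (simp add: jump_def stop_left_def)

lemma bump_0 [simp]: "bump x t 0 = x"
  by (auto simp: bump_def)

lemma bump_bump [simp]: "bump (bump x t e) t h = bump x t (e + h)"
  by (auto simp: bump_def fun_eq_iff)

lemma stop_bump: "0 \<le> t \<Longrightarrow> stop (bump (stop x t) t e) t = bump (stop x t) t e"
  by (auto simp: stop_def bump_def fun_eq_iff min_def max_def)

text \<open>The reversed jump turns x_t into x_{t-}. At t = 0 a bump shifts the whole
  representative, negative half-line included, but there the jump is 0 by convention.\<close>

lemma bump_jump:
  assumes "cadlag x" "0 \<le> t"
  shows "bump (stop x t) t (- jump x t) = stop_left x t"
proof (cases "t = 0")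
  case True
  then show ?thesis using assms by (simp add: jump_0 stop_left_0)
next
  case False
  then show ?thesis using assms by (auto simp: bump_def stop_def stop_left_def jump_def fun_eq_iff)
qed

text \<open>This breaks down at t = 0, where a bump also shifts the negative half-line and with it
  the left limit. It is the reason for treating time 0 separately when a functional is shown to be
  affine in the bump.\<close>

lemma stop_left_bump:
  fixes x :: "real \<Rightarrow> 'a::real_normed_vector"
  assumes "0 < t"
  shows "stop_left (bump (stop x t) t e) t = stop_left x t"
  using assms by (intro stop_left_cong) (auto simp: bump_def stop_def)

section \<open>Step paths and their jumps\<close>

context partitions
begin

lemma step_path_eq:
  assumes "Suc j < length (\<pi> n)" "pt n j \<le> max 0 s" "max 0 s < pt n (Suc j)"
  shows "step_path \<pi> n x s = x (pt n (Suc j))"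
proof -
  have "step_path \<pi> n x s = (\<Sum>i | Suc i < length (\<pi> n). if i = j then x (pt n (Suc j)) else 0)"
    unfolding step_path_def
  proof (rule sum.cong[OF refl])
    fix i assume "i \<in> {i. Suc i < length (\<pi> n)}"
    then have i: "Suc i < length (\<pi> n)" by simp
    show "indicator {pt n i ..< pt n (Suc i)} (max 0 s) *\<^sub>R x (pt n (Suc i)) = (if i = j then x (pt n (Suc j)) else 0)"
    proof (cases "i = j")
      case False
      then have "max 0 s \<notin> {pt n i ..< pt n (Suc i)}"
        using cell_unique[OF assms i] by auto
      then show ?thesis using False by simp
    qed (use assms in auto)
  qed
  also have "\<dots> = x (pt n (Suc j))"
    using assms by (subst sum.delta) (auto intro: finite_subset[of _ "{..<length (\<pi> n)}"])
  finally show ?thesis .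
qed

lemma stop_step_path:
  assumes "Suc j < length (\<pi> n)" "pt n j \<le> s" "s < pt n (Suc j)"
  shows "stop (step_path \<pi> n x) s = stop (step_path \<pi> n x) (pt n j)"
proof
  fix u
  have 0: "0 \<le> pt n j" using assms pt_nonneg[of j n] by simp
  show "stop (step_path \<pi> n x) s u = stop (step_path \<pi> n x) (pt n j) u"
  proof (cases "u \<le> pt n j")
    case False
    then show ?thesis using assms 0
      by (auto simp: stop_def step_path_eq[OF assms(1)] min_def max_def)
  qed (use assms in \<open>auto simp: stop_def\<close>)
qed

lemma left_lim_step_path:
  assumes "Suc j < length (\<pi> n)" "pt n j < s" "s \<le> pt n (Suc j)"
  shows "left_lim (step_path \<pi> n x) s = x (pt n (Suc j))"
  using assms pt_nonneg[of j n]
  by (intro left_lim_const[of "pt n j"]) (auto intro!: step_path_eq)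

text \<open>On each cell the step path carries the value of x at the right end, so its jump at a
  partition point is the increment of x over the cell that starts there, which is the increment in
  the Riemann sum. The first increment has no such jump, since the step path starts at
  x(t_1).\<close>

lemma jump_step_path:
  assumes "Suc (Suc j) < length (\<pi> n)"
  shows "jump (step_path \<pi> n x) (pt n (Suc j)) = x (pt n (Suc (Suc j))) - x (pt n (Suc j))"
proof -
  have "left_lim (step_path \<pi> n x) (pt n (Suc j)) = x (pt n (Suc j))"
    using assms pt_less[of j "Suc j" n] by (intro left_lim_step_path) auto
  moreover have "step_path \<pi> n x (pt n (Suc j)) = x (pt n (Suc (Suc j)))"
    using assms pt_less[of "Suc j" "Suc (Suc j)" n] pt_nonneg[of "Suc j" n] by (intro step_path_eq) auto
  ultimately show ?thesis by (simp add: jump_def)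
qed

lemma jump_step_path_between:
  assumes "Suc j < length (\<pi> n)" "pt n j < s" "s < pt n (Suc j)"
  shows "jump (step_path \<pi> n x) s = 0"
proof -
  have "step_path \<pi> n x s = x (pt n (Suc j))"
    using assms pt_nonneg[of j n] by (intro step_path_eq) auto
  then show ?thesis using assms left_lim_step_path[of j n s x] by (simp add: jump_def)
qed

text \<open>Before t_j the step path uses x at right ends of cells only, that is at times up to t_j.
  The index j = 0 is excluded because in the encoding negative s belong to the first cell.\<close>

lemma step_path_cong:
  fixes x y :: "real \<Rightarrow> 'a::real_vector"
  assumes "Suc j < length (\<pi> n)" "0 < j" "\<And>s. 0 \<le> s \<Longrightarrow> s \<le> pt n j \<Longrightarrow> x s = y s" "s < pt n j"
  shows "step_path \<pi> n x s = step_path \<pi> n y s"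
proof -
  have "0 \<le> max 0 s" by simp
  have "0 < pt n j" using assms pt_less[of 0 j n] by simp
  have "max 0 s < last (\<pi> n)"
    using \<open>0 < pt n j\<close> assms pt_le_last[of j n] by auto
  from ex_cell[OF _ this] obtain i where i: "Suc i < length (\<pi> n)" "pt n i \<le> max 0 s" "max 0 s < pt n (Suc i)"
    by auto
  have "pt n i < pt n j" using i assms \<open>0 < pt n j\<close> by auto
  then have "i < j" using i assms by (subst (asm) pt_less_iff) auto
  then have "pt n (Suc i) \<le> pt n j" using assms by (intro pt_le) auto
  moreover have "0 \<le> pt n (Suc i)" using i by (intro pt_nonneg)
  ultimately show ?thesis
    using step_path_eq[OF i, of x] step_path_eq[OF i, of y] assms(3)[of "pt n (Suc i)"] by simp
qed

lemma stop_left_step_path_cong: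
  fixes x y :: "real \<Rightarrow> 'a::real_normed_vector"
  assumes "Suc j < length (\<pi> n)" "0 < j" "\<And>s. 0 \<le> s \<Longrightarrow> s \<le> pt n j \<Longrightarrow> x s = y s" "s \<le> pt n j"
  shows "stop_left (step_path \<pi> n x) s = stop_left (step_path \<pi> n y) s"
  by (rule stop_left_cong, rule step_path_cong[OF assms(1-3)]) (use assms in auto)

end

subsection \<open>Functionals with vanishing time derivative\<close>


text \<open>Only right derivatives are at hand, so the mean value theorem is replaced by a
  continuation argument: a bound with small slope e is pushed to the right up to b.\<close>

lemma const_if_right_deriv_zero:
  fixes g :: "real \<Rightarrow> real"
  assumes "a \<le> b" and cont: "continuous_on {a..b} g"
    and der: "\<And>t. a \<le> t \<Longrightarrow> t < b \<Longrightarrow> ((\<lambda>h. (g (t + h) - g t) / h) \<longlongrightarrow> 0) (at_right 0)"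
  shows "g b = g a"
proof (rule ccontr)
  assume ne: "g b \<noteq> g a"
  then have ab: "a < b" using assms(1) by (cases "a = b") auto
  \<comment> \<open>Half the average slope over [a, b]: a bound with slope e valid up to b makes the
    nonzero increment at most half of itself.\<close>
  define e where "e = \<bar>g b - g a\<bar> / 2 / (b - a)"
  have "b - a \<noteq> 0" using ab by simp
  from nonzero_eq_divide_eq[OF this] have eab: "e * (b - a) = \<bar>g b - g a\<bar> / 2"
    unfolding e_def by blast
  have e: "0 < e" using ne ab by (simp add: e_def)
  define S where "S = {t \<in> {a..b}. \<forall>s\<in>{a..t}. \<bar>g s - g a\<bar> \<le> e * (s - a)}"
  have aS: "a \<in> S" using ab by (auto simp: S_def)
  have bdd: "bdd_above S" by (rule bdd_aboveI[of _ b]) (auto simp: S_def)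
  define c where "c = Sup S"
  have ac: "a \<le> c" unfolding c_def by (rule cSup_upper[OF aS bdd])
  have cb: "c \<le> b" unfolding c_def by (rule cSup_least) (use aS in \<open>auto simp: S_def\<close>)
  have less: "\<bar>g s - g a\<bar> \<le> e * (s - a)" if "a \<le> s" "s < c" for s
  proof -
    have "S \<noteq> {}" using aS by blast
    from less_cSup_iff[OF this bdd, of s] that obtain t where "t \<in> S" "s < t"
      by (auto simp: c_def)
    then show ?thesis using that by (auto simp: S_def)
  qed
  have at_c: "\<bar>g c - g a\<bar> \<le> e * (c - a)"
  proof (cases "c = a")
    case False
    then have "a < c" using ac by simp
    have "(g \<longlongrightarrow> g c) (at c within {a..b})"
      using cont ac cb by (auto simp: continuous_on_def)
    then have "(g \<longlongrightarrow> g c) (at c within {a..<c})"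
      by (rule tendsto_within_subset) (use cb in auto)
    moreover have "at c within {a..<c} = at_left c"
      using \<open>a < c\<close> by (intro at_within_nhd[of c "{a<..}"]) auto
    ultimately have "(g \<longlongrightarrow> g c) (at_left c)" by simp
    then have "((\<lambda>s. \<bar>g s - g a\<bar>) \<longlongrightarrow> \<bar>g c - g a\<bar>) (at_left c)"
      by (intro tendsto_intros)
    moreover have "((\<lambda>s. e * (s - a)) \<longlongrightarrow> e * (c - a)) (at_left c)"
      by (intro tendsto_intros)
    moreover have "\<forall>\<^sub>F s in at_left c. \<bar>g s - g a\<bar> \<le> e * (s - a)"
      unfolding eventually_at_left_field using \<open>a < c\<close> less by (intro exI[of _ a]) auto
    ultimately show ?thesis by (intro tendsto_le[OF trivial_limit_at_left_real]) 
  qed simp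
  have "c \<noteq> b"
  proof
    assume "c = b"
    then have "\<bar>g b - g a\<bar> \<le> \<bar>g b - g a\<bar> / 2"
      using at_c eab by simp
    then show False using ne by simp
  qed
  then have "c < b" using cb by simp
  from der[OF ac this] e have "\<forall>\<^sub>F h in at_right 0. \<bar>(g (c + h) - g c) / h\<bar> < e"
    by (auto simp: tendsto_iff dist_real_def)
  then obtain d where d: "0 < d" "\<And>h. 0 < h \<Longrightarrow> h < d \<Longrightarrow> \<bar>(g (c + h) - g c) / h\<bar> < e"
    by (auto simp: eventually_at_right_field)
  \<comment> \<open>Halving d keeps the new point strictly in the range of the difference quotient
    bound; the minimum keeps it in [a, b].\<close>
  define t where "t = c + min (d / 2) (b - c)"
  have "t \<in> S"
    unfolding S_def
  proof (intro CollectI conjI ballI)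
    show "t \<in> {a..b}" using ac d \<open>c < b\<close> by (auto simp: t_def)
    fix s assume s: "s \<in> {a..t}"
    show "\<bar>g s - g a\<bar> \<le> e * (s - a)"
    proof (cases "s \<le> c")
      case True
      then show ?thesis using less[of s] at_c s by (cases "s = c") auto
    next
      case False
      have "\<bar>(g (c + (s - c)) - g c) / (s - c)\<bar> < e"
        using False s d by (intro d) (auto simp: t_def)
      then have "\<bar>g s - g c\<bar> \<le> e * (s - c)"
        using False by (simp add: abs_divide divide_less_eq)
      then have "\<bar>g s - g a\<bar> \<le> e * (s - c) + e * (c - a)" using at_c by linarith
      then show ?thesis by (simp add: algebra_simps)
    qed
  qed
  then have "t \<le> c" unfolding c_def by (intro cSup_upper bdd)
  then show False using d \<open>c < b\<close> by (auto simp: t_def)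
qed

lemma space_grad_eqI:
  assumes "has_space_grad F t y D"
  shows "space_grad F t y = D"
  unfolding space_grad_def
proof (rule the_equality, rule assms)
  fix D' assume "has_space_grad F t y D'"
  then have "(\<lambda>h. h \<bullet> D') = (\<lambda>h. h \<bullet> D)"
    using assms unfolding has_space_grad_def gderiv_def by (rule has_derivative_unique)
  then have "(D' - D) \<bullet> D' = (D' - D) \<bullet> D" by metis
  then show "D' = D" by (metis inner_diff_right inner_eq_zero_iff right_minus_eq)
qed

lemma time_deriv_eqI:
  assumes "has_time_deriv F t y d"
  shows "time_deriv F t y = d"
  unfolding time_deriv_def
  using assms by (intro the_equality) (auto simp: has_time_deriv_def intro: tendsto_unique[OF trivial_limit_at_right_real])

section \<open>Generic sets and functionals determined on \<Lambda>\<close>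

locale generic_paths = partitions \<pi> for \<pi> +
  fixes \<Omega> :: "(real \<Rightarrow> real ^ 'm::finite) set"
  assumes gen: "generic \<pi> \<Omega>"
begin

abbreviation step :: "nat \<Rightarrow> (real \<Rightarrow> real ^ 'm) \<Rightarrow> real \<Rightarrow> real ^ 'm" where
  "step n x \<equiv> step_path \<pi> n x"

lemma cadlag_mem: "x \<in> \<Omega> \<Longrightarrow> cadlag x"
  using gen by (auto simp: generic_def)

lemma ex_bump_nbhd:
  assumes "x \<in> \<Omega>" "0 \<le> t"
  obtains U where "convex U" "0 \<in> interior U" "- jump x t \<in> U" "\<And>e. e \<in> U \<Longrightarrow> bump (stop x t) t e \<in> \<Omega>"
  using gen assms by (metis generic_def)

lemma stop_mem: "x \<in> \<Omega> \<Longrightarrow> 0 \<le> t \<Longrightarrow> stop x t \<in> \<Omega>"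
  by (metis ex_bump_nbhd bump_0 interior_subset subsetD)

text \<open>For this the neighbourhood in the definition of generic sets is required to contain the
  reversed jump.\<close>

lemma stop_left_mem: "x \<in> \<Omega> \<Longrightarrow> 0 \<le> t \<Longrightarrow> stop_left x t \<in> \<Omega>"
  by (metis ex_bump_nbhd bump_jump cadlag_mem)

lemma ev_step_mem:
  assumes "x \<in> \<Omega>"
  shows "\<forall>\<^sub>F n in sequentially. stop (step n x) T \<in> \<Omega>"
proof -
  \<comment> \<open>Genericity speaks of positive horizons only; \<open>max T 1\<close> covers every
    T, and smaller horizons are reached by stopping once more.\<close>
  obtain N where "\<forall>n\<ge>N. stop (step n x) (max T 1) \<in> \<Omega>"
    using gen assms unfolding generic_def by (metis less_max_iff_disj zero_less_one)
  moreover have "stop (step n x) T \<in> \<Omega>" if "stop (step n x) (max T 1) \<in> \<Omega>" for n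
  proof (cases "0 \<le> T")
    case True
    with stop_mem[OF that, of T] show ?thesis by (simp add: min_def split: if_splits)
  next
    case False
    have *: "stop (step n x) T = stop (step n x) 0"
      using False by (auto simp: stop_def fun_eq_iff step_path_def min_def max_def)
    show ?thesis using stop_mem[OF that, of 0] unfolding * by simp
  qed
  ultimately show ?thesis by (auto simp: eventually_sequentially)
qed

lemma stop_step_mem: "stop (step n x) T \<in> \<Omega> \<Longrightarrow> 0 \<le> t \<Longrightarrow> t \<le> T \<Longrightarrow> stop (step n x) t \<in> \<Omega>"
  using stop_mem[of "stop (step n x) T" t] by (simp add: min_def split: if_splits)

lemma stop_left_step_mem: "stop (step n x) T \<in> \<Omega> \<Longrightarrow> 0 \<le> t \<Longrightarrow> t \<le> T \<Longrightarrow> stop_left (step n x) t \<in> \<Omega>"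
  using stop_left_mem[of "stop (step n x) T" t] by (simp add: stop_left_stop)

text \<open>\<open>L_b\<close> identifies functionals up to this relation, so the regularity of a
  gradient has to be carried over to every representative.\<close>

definition agree :: "('m, 'b) functional \<Rightarrow> ('m, 'b) functional \<Rightarrow> bool" where
  "agree F G \<longleftrightarrow> (\<forall>x\<in>\<Omega>. \<forall>t\<ge>0. F t (stop x t) = G t (stop x t))"

lemma agree_sym: "agree F G \<Longrightarrow> agree G F"
  by (auto simp: agree_def)

lemma agree_stop: "agree F G \<Longrightarrow> x \<in> \<Omega> \<Longrightarrow> 0 \<le> t \<Longrightarrow> F t (stop x t) = G t (stop x t)"
  by (auto simp: agree_def)

lemma agree_stop_left: "agree F G \<Longrightarrow> x \<in> \<Omega> \<Longrightarrow> 0 \<le> t \<Longrightarrow> F t (stop_left x t) = G t (stop_left x t)"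
  using stop_left_mem[of x t] by (metis agree_stop stop_stop_left)

text \<open>Step paths lie in \<Omega> only for large n and only when stopped at a fixed horizon; t
  + 1 serves as horizon for all late times \<tau> n.\<close>

lemma agree_step:
  assumes "agree F G" "x \<in> \<Omega>" "\<tau> \<longlonglongrightarrow> t" "\<forall>\<^sub>F n in sequentially. 0 \<le> \<tau> n"
  shows "\<forall>\<^sub>F n in sequentially. F (\<tau> n) (stop (step n x) (\<tau> n)) = G (\<tau> n) (stop (step n x) (\<tau> n))"
    and "\<forall>\<^sub>F n in sequentially. F (\<tau> n) (stop_left (step n x) (\<tau> n)) = G (\<tau> n) (stop_left (step n x) (\<tau> n))"
proof -
  have le: "\<forall>\<^sub>F n in sequentially. \<tau> n < t + 1"
    using assms(3) by (rule order_tendstoD) simp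
  show "\<forall>\<^sub>F n in sequentially. F (\<tau> n) (stop (step n x) (\<tau> n)) = G (\<tau> n) (stop (step n x) (\<tau> n))"
    using le assms(4) ev_step_mem[OF assms(2), of "t + 1"]
  proof eventually_elim
    case (elim n)
    then have "stop (step n x) (\<tau> n) \<in> \<Omega>" by (intro stop_step_mem[OF elim(3)]) auto
    from agree_stop[OF assms(1) this elim(2)] show ?case by simp
  qed
  show "\<forall>\<^sub>F n in sequentially. F (\<tau> n) (stop_left (step n x) (\<tau> n)) = G (\<tau> n) (stop_left (step n x) (\<tau> n))"
    using le assms(4) ev_step_mem[OF assms(2), of "t + 1"]
  proof eventually_elim
    case (elim n)
    then have "stop_left (step n x) (\<tau> n) \<in> \<Omega>" by (intro stop_left_step_mem[OF elim(3)]) auto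
    from agree_stop[OF assms(1) this elim(2)] show ?case by simp
  qed
qed

lemma left_continuous_cong:
  assumes "left_continuous \<pi> \<Omega> F" "agree F G"
  shows "left_continuous \<pi> \<Omega> G"
  unfolding left_continuous_def
proof (intro ballI allI impI conjI)
  fix x t assume x: "x \<in> \<Omega>" and t: "0 \<le> (t::real)"
  note F = assms(1)[unfolded left_continuous_def, rule_format, OF x t]
  note eq = agree_stop_left[OF assms(2) x t]
  have ev1: "\<forall>\<^sub>F s in at t within {0..t}. F s (stop_left x s) = G s (stop_left x s)"
    using agree_stop_left[OF assms(2) x] by (auto simp: eventually_at_filter)
  show "((\<lambda>s. G s (stop_left x s)) \<longlongrightarrow> G t (stop_left x t)) (at t within {0..t})"
    using tendsto_cong[OF ev1] F eq by simp
  have ev2: "\<forall>\<^sub>F s in at t within {0..<t}. F s (stop x s) = G s (stop x s)"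
    using agree_stop[OF assms(2) x] by (auto simp: eventually_at_filter)
  show "((\<lambda>s. G s (stop x s)) \<longlongrightarrow> G t (stop_left x t)) (at t within {0..<t})"
    using tendsto_cong[OF ev2] F eq by simp
next
  fix x t \<tau> assume x: "x \<in> \<Omega>" and t: "0 \<le> (t::real)"
    and \<tau>: "\<tau> \<longlonglongrightarrow> t \<and> (\<forall>\<^sub>F n in sequentially. 0 \<le> \<tau> n \<and> \<tau> n \<le> last_before \<pi> n t)"
  have ev: "\<forall>\<^sub>F n in sequentially. 0 \<le> \<tau> n" using \<tau> by (auto elim: eventually_mono)
  have "(\<lambda>n. F (\<tau> n) (stop_left (step n x) (\<tau> n))) \<longlonglongrightarrow> F t (stop_left x t)"
    using assms(1)[unfolded left_continuous_def, rule_format, OF x t] \<tau> by blast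
  then show "(\<lambda>n. G (\<tau> n) (stop_left (step n x) (\<tau> n))) \<longlonglongrightarrow> G t (stop_left x t)"
    using tendsto_cong[OF agree_step(2)[OF assms(2) x conjunct1[OF \<tau>] ev]]
      agree_stop_left[OF assms(2) x t] by simp
next
  fix x t \<tau> assume x: "x \<in> \<Omega>" and t: "0 \<le> (t::real)"
    and \<tau>: "\<tau> \<longlonglongrightarrow> t \<and> (\<forall>\<^sub>F n in sequentially. 0 \<le> \<tau> n \<and> \<tau> n < last_before \<pi> n t)"
  have ev: "\<forall>\<^sub>F n in sequentially. 0 \<le> \<tau> n" using \<tau> by (auto elim: eventually_mono)
  have "(\<lambda>n. F (\<tau> n) (stop (step n x) (\<tau> n))) \<longlonglongrightarrow> F t (stop_left x t)"
    using assms(1)[unfolded left_continuous_def, rule_format, OF x t] \<tau> by blast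
  then show "(\<lambda>n. G (\<tau> n) (stop (step n x) (\<tau> n))) \<longlonglongrightarrow> G t (stop_left x t)"
    using tendsto_cong[OF agree_step(1)[OF assms(2) x conjunct1[OF \<tau>] ev]]
      agree_stop_left[OF assms(2) x t] by simp
qed

lemma strictly_causal_cong: "strictly_causal \<Omega> F \<Longrightarrow> agree F G \<Longrightarrow> strictly_causal \<Omega> G"
  unfolding strictly_causal_def by (metis agree_stop agree_stop_left)

lemma locally_bounded_cong:
  assumes "locally_bounded \<pi> \<Omega> F" "agree F G"
  shows "locally_bounded \<pi> \<Omega> G"
  unfolding locally_bounded_def
proof (intro ballI allI impI)
  fix x T assume x: "x \<in> \<Omega>" and T: "0 \<le> (T::real)"
  obtain n0 C where n0: "\<And>n. n \<ge> n0 \<Longrightarrow> stop (step n x) T \<in> \<Omega>"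
    and C: "\<And>n t. n \<ge> n0 \<Longrightarrow> t \<in> {0..T} \<Longrightarrow> norm (F t (stop (step n x) t)) \<le> C"
    using assms(1)[unfolded locally_bounded_def, rule_format, OF x T] by metis
  have "norm (G t (stop (step n x) t)) \<le> C" if "n \<ge> n0" "t \<in> {0..T}" for n t
  proof -
    have "stop (step n x) t \<in> \<Omega>" using that by (intro stop_step_mem[OF n0]) auto
    from agree_stop[OF assms(2) this, of t] that C[OF that] show ?thesis by simp
  qed
  with n0 show "\<exists>n0. (\<forall>n\<ge>n0. stop (step n x) T \<in> \<Omega>) \<and>
        (\<exists>C. \<forall>n\<ge>n0. \<forall>t\<in>{0..T}. norm (G t (stop (step n x) t)) \<le> C)" by metis
qed

text \<open>What is kept of membership in \<open>L_b\<close> when the primitive is forgotten; the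
  covariation is built from these three properties alone.\<close>

definition integrand :: "('m, real ^ 'm) functional \<Rightarrow> bool" where
  "integrand \<phi> \<longleftrightarrow> left_continuous \<pi> \<Omega> \<phi> \<and> strictly_causal \<Omega> \<phi> \<and> locally_bounded \<pi> \<Omega> \<phi>"

lemma L_b_iff: "\<phi> \<in> L_b \<pi> \<Omega> \<longleftrightarrow> (\<exists>F\<in>M_b \<pi> \<Omega>. agree (space_grad F) \<phi>)"
  unfolding L_b_def agree_def by (auto intro!: bexI simp: eq_commute)

lemma integrand_space_grad: "F \<in> M_b \<pi> \<Omega> \<Longrightarrow> agree (space_grad F) \<phi> \<Longrightarrow> integrand \<phi>"
  unfolding integrand_def M_b_def
  by (auto intro: left_continuous_cong strictly_causal_cong locally_bounded_cong)

text \<open>The integrated form of a vanishing time derivative. The telescoping along step paths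
  uses it in this form, and the covariation satisfies it directly, without being
  differentiated.\<close>

definition flat :: "('m, real) functional \<Rightarrow> bool" where
  "flat F \<longleftrightarrow> (\<forall>x\<in>\<Omega>. \<forall>a\<ge>0. \<forall>b\<ge>a. F b (stop x a) = F a (stop x a))"

lemma flatD: "flat F \<Longrightarrow> x \<in> \<Omega> \<Longrightarrow> 0 \<le> a \<Longrightarrow> a \<le> b \<Longrightarrow> F b (stop x a) = F a (stop x a)"
  unfolding flat_def by blast

lemma M_b_flat:
  assumes F: "F \<in> M_b \<pi> \<Omega>"
  shows "flat F"
  unfolding flat_def
proof (intro ballI allI impI)
  fix x a b assume x: "x \<in> \<Omega>" and a: "0 \<le> (a::real)" and ab: "a \<le> b"
  have lc: "left_continuous \<pi> \<Omega> F" and rc: "right_continuous \<pi> \<Omega> F"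
    using F by (auto simp: M_b_def continuous_functional_def)
  define y where "y = stop x a"
  have y: "y \<in> \<Omega>" using stop_mem[OF x a] by (simp add: y_def)
  have ys: "stop y s = y" if "a \<le> s" for s using that by (simp add: y_def min_def)
  have yl: "stop_left y s = y" if "a < s" for s using that by (simp add: y_def stop_left_stop_gt)
  show "F b (stop x a) = F a (stop x a)"
    unfolding y_def[symmetric]
  proof (rule const_if_right_deriv_zero[OF ab])
    fix t assume t: "a \<le> t" "t < b"
    then have t0: "0 \<le> t" using a by simp
    have "\<exists>d. has_time_deriv F t (stop y t) d"
      using F y t0 by (auto simp: M_b_def differentiable_functional_def)
    then obtain d where d: "has_time_deriv F t (stop y t) d" by blast
    have "d = 0" using time_deriv_eqI[OF d] F y t0 by (simp add: M_b_def)
    then show "((\<lambda>h. (F (t + h) y - F t y) / h) \<longlongrightarrow> 0) (at_right 0)"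
      using d ys[OF t(1)] by (simp add: has_time_deriv_def)
  next
    show "continuous_on {a..b} (\<lambda>t. F t y)"
      unfolding continuous_on_def
    proof
      fix t assume "t \<in> {a..b}"
      then have t: "a \<le> t" "t \<le> b" "0 \<le> t" using a by auto
      have "((\<lambda>s. F s (stop y s)) \<longlongrightarrow> F t (stop y t)) (at t within {t..})"
        using rc y t(3) by (auto simp: right_continuous_def)
      moreover have "\<forall>\<^sub>F s in at t within {t..}. F s (stop y s) = F s y"
        using ys t by (auto simp: eventually_at_filter)
      ultimately have "((\<lambda>s. F s y) \<longlongrightarrow> F t (stop y t)) (at t within {t..})"
        by (rule Lim_transform_eventually)
      then have R: "((\<lambda>s. F s y) \<longlongrightarrow> F t y) (at t within {t..})"
        using ys[OF t(1)] by simp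
      have L: "((\<lambda>s. F s y) \<longlongrightarrow> F t y) (at t within {a..t})"
      proof (cases "t = a")
        case False
        then have "a < t" using t by simp
        have "((\<lambda>s. F s (stop_left y s)) \<longlongrightarrow> F t (stop_left y t)) (at t within {0..t})"
          using lc y t(3) by (auto simp: left_continuous_def)
        then have "((\<lambda>s. F s (stop_left y s)) \<longlongrightarrow> F t y) (at t within {a..t})"
          using yl[OF \<open>a < t\<close>] a by (simp add: tendsto_within_subset[where S = "{0..t}" and T = "{a..t}"])
        moreover have "\<forall>\<^sub>F s in at t within {a..t}. F s (stop_left y s) = F s y"
        proof -
          have "\<forall>\<^sub>F s in at t within {a..t}. a < s"
            using \<open>a < t\<close> by (intro order_tendstoD(1)[OF tendsto_ident_at])
          then show ?thesis by eventually_elim (simp add: yl)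
        qed
        ultimately show ?thesis by (rule Lim_transform_eventually)
      qed (simp add: tendsto_def eventually_at_filter)
      have "((\<lambda>s. F s y) \<longlongrightarrow> F t y) (at t within {a..t} \<union> {t..})"
        using L R by (simp add: Lim_Un)
      then show "((\<lambda>s. F s y) \<longlongrightarrow> F t y) (at t within {a..b})"
        by (rule tendsto_within_subset) auto
    qed
  qed
qed

text \<open>The gradient does not see the jump at \<open>t\<close>, so the functional is affine in its size.\<close>

lemma M_b_jump:
  assumes F: "F \<in> M_b \<pi> \<Omega>" and x: "x \<in> \<Omega>" and t: "0 < t"
  shows "F t (stop x t) = F t (stop_left x t) + space_grad F t (stop_left x t) \<bullet> jump x t"
proof -
  from t have t0: "0 \<le> t" by simp
  from ex_bump_nbhd[OF x t0] obtain U where U: "convex U" "0 \<in> interior U" "- jump x t \<in> U"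
    "\<And>e. e \<in> U \<Longrightarrow> bump (stop x t) t e \<in> \<Omega>" by metis
  have U0: "0 \<in> U" using U(2) interior_subset by blast
  define D where "D = space_grad F t (stop_left x t)"
  define f where "f e = F t (bump (stop x t) t e)" for e
  \<comment> \<open>Differentiability is applied at every bumped path z and not just at x_t. All
    these z have the same left-stopped path, so strict causality gives one and the same gradient D
    at every e in U.\<close>
  have gd: "(f has_derivative (\<lambda>h. h \<bullet> D)) (at e)" if e: "e \<in> U" for e
  proof -
    define z where "z = bump (stop x t) t e"
    have z: "z \<in> \<Omega>" using U(4)[OF e] by (simp add: z_def)
    have sz: "stop z t = z" using t0 by (simp add: z_def stop_bump)
    have slz: "stop_left z t = stop_left x t" using t by (simp add: z_def stop_left_bump)
    have "\<exists>D. has_space_grad F t (stop z t) D"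
      using F z t0 by (auto simp: M_b_def differentiable_functional_def)
    then obtain D' where D': "has_space_grad F t z D'" unfolding sz by blast
    have "D' = space_grad F t z" using space_grad_eqI[OF D'] by simp
    also have "\<dots> = space_grad F t (stop_left z t)"
    proof -
      have "strictly_causal \<Omega> (space_grad F)" using F by (simp add: M_b_def)
      from this[unfolded strictly_causal_def, rule_format, OF z t0] show ?thesis by (simp only: sz)
    qed
    finally have "D' = D" by (simp add: slz D_def)
    with D' have "((\<lambda>h. f (e + h)) has_derivative (\<lambda>h. h \<bullet> D)) (at 0)"
      by (simp add: has_space_grad_def gderiv_def z_def f_def)
    then have "((\<lambda>h. f (e + h)) \<circ> (\<lambda>y. y - e) has_derivative (\<lambda>h. h \<bullet> D) \<circ> (\<lambda>h. h)) (at e)"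
      by (intro diff_chain_at) (auto intro!: derivative_eq_intros)
    then show ?thesis by (simp add: o_def)
  qed
  \<comment> \<open>Convexity of U keeps the whole segment from 0 to the reversed jump, that is from
    x_t to x_{t-}, inside the neighbourhood; along it the derivative is constant.\<close>
  have der: "((\<lambda>u. f (u *\<^sub>R (- jump x t))) has_real_derivative (- jump x t) \<bullet> D) (at u)"
    if u: "0 \<le> u" "u \<le> 1" for u :: real
  proof -
    have "u *\<^sub>R (- jump x t) \<in> U"
      using convexD[OF U(1) U0 U(3), of "1 - u" u] u by simp
    from gd[OF this] have "(f \<circ> (\<lambda>u. u *\<^sub>R (- jump x t)) has_derivative (\<lambda>h. h \<bullet> D) \<circ> (\<lambda>h. h *\<^sub>R (- jump x t))) (at u)"
      by (intro diff_chain_at) (auto intro!: derivative_eq_intros)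
    moreover have "(\<lambda>h. h \<bullet> D) \<circ> (\<lambda>h. h *\<^sub>R (- jump x t)) = (*) ((- jump x t) \<bullet> D)"
      by (simp add: fun_eq_iff)
    ultimately show ?thesis
      unfolding has_field_derivative_def by (simp only: o_def)
  qed
  obtain z :: real where "f (1 *\<^sub>R (- jump x t)) - f (0 *\<^sub>R (- jump x t)) = (1 - 0) * ((- jump x t) \<bullet> D)"
    using MVT2[OF zero_less_one der] by blast
  then have "f (- jump x t) - f 0 = (- jump x t) \<bullet> D" by simp
  then have "F t (stop_left x t) - F t (stop x t) = - (jump x t \<bullet> D)"
    using bump_jump[OF cadlag_mem[OF x] t0] by (simp add: f_def)
  then show ?thesis by (simp add: D_def inner_commute)
qed

text \<open>A stopped step path is frozen between partition points, so a flat functional changes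
  only at the jumps. The jump response J is left open: it is linear in the increment for members of
  \<open>M_b\<close> and quadratic for the covariation. The sum starts at l = 1, since there is no
  jump at t_0 = 0.\<close>

lemma step_path_telescope:
  assumes flat: "flat F"
    and jmp: "\<And>y t. y \<in> \<Omega> \<Longrightarrow> 0 < t \<Longrightarrow> F t (stop y t) = F t (stop_left y t) + J t (stop_left y t) (jump y t)"
    and mem: "stop (step n x) T \<in> \<Omega>"
  shows "Suc j < length (\<pi> n) \<Longrightarrow> pt n j \<le> \<tau> \<Longrightarrow> \<tau> < pt n (Suc j) \<Longrightarrow> \<tau> \<le> T \<Longrightarrow>
    F \<tau> (stop (step n x) \<tau>) = F 0 (stop (step n x) 0) +
      (\<Sum>l=1..j. J (pt n l) (stop_left (step n x) (pt n l)) (x (pt n (Suc l)) - x (pt n l)))"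
proof (induction j arbitrary: \<tau>)
  case 0
  have T0: "0 \<le> T" using 0 by simp
  have m: "stop (step n x) 0 \<in> \<Omega>" using stop_step_mem[OF mem, of 0] T0 by simp
  have "stop (step n x) \<tau> = stop (step n x) 0"
    using stop_step_path[of 0 n \<tau>] 0 by simp
  moreover have "F \<tau> (stop (stop (step n x) 0) 0) = F 0 (stop (stop (step n x) 0) 0)"
    by (rule flatD[OF flat m]) (use 0 in auto)
  ultimately show ?case by simp
next
  case (Suc j)
  define s where "s = pt n (Suc j)"
  have s0: "pt n j < s" unfolding s_def using Suc.prems by (intro pt_less) auto
  have j0: "0 \<le> pt n j" using Suc.prems by (intro pt_nonneg) auto
  have sT: "s \<le> T" "s \<le> \<tau>" using Suc.prems by (auto simp: s_def)
  have s_pos: "0 < s" using s0 j0 by simp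
  have m: "stop (step n x) s \<in> \<Omega>" using stop_step_mem[OF mem, of s] s_pos sT by simp
  have mj: "stop (step n x) (pt n j) \<in> \<Omega>" using stop_step_mem[OF mem, of "pt n j"] j0 s0 sT by simp
  have eq1: "stop (step n x) \<tau> = stop (step n x) s"
    unfolding s_def using Suc.prems by (intro stop_step_path) auto
  have "F \<tau> (stop (stop (step n x) s) s) = F s (stop (stop (step n x) s) s)"
    by (rule flatD[OF flat m]) (use s_pos sT in auto)
  then have 1: "F \<tau> (stop (step n x) \<tau>) = F s (stop (step n x) s)" by (simp add: eq1)
  have 2: "F s (stop (step n x) s) = F s (stop_left (step n x) s) + J s (stop_left (step n x) s) (x (pt n (Suc (Suc j))) - x s)"
    using jmp[OF m s_pos] jump_step_path[of j n x] Suc.prems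
    by (simp add: stop_left_stop jump_stop s_def)
  \<comment> \<open>The step path is constant on the cell before s, so stopping it just before s is
    the same as freezing it at t_j; flatness then moves the time from s back to t_j.\<close>
  have eq3: "stop_left (step n x) s = stop (step n x) (pt n j)"
  proof -
    have "stop_left (step n x) s = stop_left (stop (step n x) (pt n j)) s"
    proof (rule stop_left_cong)
      fix u assume "u < s"
      show "step n x u = stop (step n x) (pt n j) u"
      proof (cases "u \<le> pt n j")
        case False
        then have "stop (step n x) u = stop (step n x) (pt n j)"
          using Suc.prems \<open>u < s\<close> by (intro stop_step_path) (auto simp: s_def)
        then have "stop (step n x) u u = stop (step n x) (pt n j) u" by simp
        then show ?thesis by (simp add: stop_def)
      qed (simp add: stop_def)
    qed
    then show ?thesis using stop_left_stop_gt[OF s0] by simp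
  qed
  have "F s (stop (stop (step n x) (pt n j)) (pt n j)) = F (pt n j) (stop (stop (step n x) (pt n j)) (pt n j))"
    by (rule flatD[OF flat mj]) (use j0 s0 in auto)
  then have 3: "F s (stop_left (step n x) s) = F (pt n j) (stop (step n x) (pt n j))" by (simp add: eq3)
  have "F (pt n j) (stop (step n x) (pt n j)) = F 0 (stop (step n x) 0) +
      (\<Sum>l=1..j. J (pt n l) (stop_left (step n x) (pt n l)) (x (pt n (Suc l)) - x (pt n l)))"
    using Suc.prems s0 sT by (intro Suc.IH) (auto simp: s_def)
  with 1 2 3 show ?case by (simp add: s_def)
qed

section \<open>Riemann sums and the pathwise integral\<close>

definition integral_sum :: "('m, real ^ 'm) functional \<Rightarrow> nat \<Rightarrow> real \<Rightarrow> (real \<Rightarrow> real ^ 'm) \<Rightarrow> real" where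
  "integral_sum \<phi> n t x = (\<Sum>i\<in>idx n t. \<phi> (pt n i) (stop_left (step n x) (pt n i)) \<bullet> (x (pt n (Suc i)) - x (pt n i)))"

lemma pt_1_tendsto:
  "(\<lambda>n. pt n (Suc 0)) \<longlonglongrightarrow> 0" "\<forall>\<^sub>F n in sequentially. Suc 0 < length (\<pi> n)"
proof -
  show ev: "\<forall>\<^sub>F n in sequentially. Suc 0 < length (\<pi> n)"
    using last_ev[of 0]
  proof eventually_elim
    case (elim n)
    have "length (\<pi> n) \<noteq> Suc 0" using elim last_pt[of n] by auto
    then show ?case using length_pos[of n] by linarith
  qed
  show "(\<lambda>n. pt n (Suc 0)) \<longlonglongrightarrow> 0"
  proof (rule LIMSEQ_I)
    fix r :: real assume "0 < r"
    from mesh_ev[OF this, of 0] ev have "\<forall>\<^sub>F n in sequentially. norm (pt n (Suc 0) - 0) < r"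
    proof eventually_elim
      case (elim n)
      from elim(1)[rule_format, of 0] elim(2) pt_nonneg[of "Suc 0" n] show ?case by simp
    qed
    then show "\<exists>no. \<forall>n\<ge>no. norm (pt n (Suc 0) - 0) < r"
      by (simp add: eventually_sequentially)
  qed
qed

text \<open>The first cell shrinks to 0 from the right, where x is right-continuous. This disposes
  of the term l = 0, which the Riemann sum contains and the telescoped sum along the step path does
  not.\<close>

lemma first_increment_tendsto:
  fixes x :: "real \<Rightarrow> 'a::real_normed_vector"
  assumes "cadlag x"
  shows "(\<lambda>n. x (pt n (Suc 0)) - x 0) \<longlonglongrightarrow> 0"
proof -
  have "filterlim (\<lambda>n. pt n (Suc 0)) (at_right 0) sequentially"
    unfolding filterlim_at
  proof (intro conjI pt_1_tendsto(1))
    show "\<forall>\<^sub>F n in sequentially. pt n (Suc 0) \<in> {0<..} \<and> pt n (Suc 0) \<noteq> 0"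
      using pt_1_tendsto(2)
    proof eventually_elim
      case (elim n)
      then show ?case using pt_less[of 0 "Suc 0" n] by simp
    qed
  qed
  from filterlim_compose[OF cadlag_right[OF assms order_refl] this]
  show ?thesis by (simp add: LIM_zero)
qed

lemma integrand_0_tendsto:
  assumes "integrand \<phi>" "x \<in> \<Omega>"
  shows "(\<lambda>n. \<phi> 0 (stop_left (step n x) 0)) \<longlonglongrightarrow> \<phi> 0 (stop_left x 0)"
proof -
  have "\<forall>\<tau>. \<tau> \<longlonglongrightarrow> 0 \<and> (\<forall>\<^sub>F n in sequentially. 0 \<le> \<tau> n \<and> \<tau> n \<le> last_before \<pi> n 0) \<longrightarrow>
           (\<lambda>n. \<phi> (\<tau> n) (stop_left (step n x) (\<tau> n))) \<longlonglongrightarrow> \<phi> 0 (stop_left x 0)"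
    using assms unfolding integrand_def left_continuous_def by auto
  from this[rule_format, of "\<lambda>_. 0"] show ?thesis by simp
qed

lemma right_continuous_step_tendsto:
  assumes "right_continuous \<pi> \<Omega> F" "x \<in> \<Omega>" "0 \<le> t"
  shows "(\<lambda>n. F t (stop (step n x) t)) \<longlonglongrightarrow> F t (stop x t)"
proof -
  have "\<forall>\<tau>. \<tau> \<longlonglongrightarrow> t \<and> (\<forall>\<^sub>F n in sequentially. 0 \<le> \<tau> n \<and> \<tau> n \<ge> last_before \<pi> n t) \<longrightarrow>
           (\<lambda>n. F (\<tau> n) (stop (step n x) (\<tau> n))) \<longlonglongrightarrow> F t (stop x t)"
    using assms unfolding right_continuous_def by auto
  from this[rule_format, of "\<lambda>_. t"] show ?thesis using last_before_le[OF assms(3)] assms(3) by simp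
qed

text \<open>Up to the vanishing first term the Riemann sum is the increment of F along the step
  path, and 2(c) with the constant times t and 0 carries this increment over to x.\<close>

theorem integral_sum_tendsto:
  assumes F: "F \<in> M_b \<pi> \<Omega>" and \<phi>: "agree (space_grad F) \<phi>" and x: "x \<in> \<Omega>" and t: "0 \<le> t"
  shows "(\<lambda>n. integral_sum \<phi> n t x) \<longlonglongrightarrow> F t (stop x t) - F 0 (stop x 0)"
proof -
  have int: "integrand \<phi>" using integrand_space_grad[OF F \<phi>] .
  have rc: "right_continuous \<pi> \<Omega> F" using F by (auto simp: M_b_def continuous_functional_def)
  have lim0: "(\<lambda>n. \<phi> 0 (stop_left (step n x) 0) \<bullet> (x (pt n (Suc 0)) - x 0)) \<longlonglongrightarrow> \<phi> 0 (stop_left x 0) \<bullet> 0"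
    by (intro tendsto_inner integrand_0_tendsto[OF int x] first_increment_tendsto cadlag_mem x)
  have "(\<lambda>n. \<phi> 0 (stop_left (step n x) 0) \<bullet> (x (pt n (Suc 0)) - x 0) + (F t (stop (step n x) t) - F 0 (stop (step n x) 0)))
    \<longlonglongrightarrow> \<phi> 0 (stop_left x 0) \<bullet> 0 + (F t (stop x t) - F 0 (stop x 0))"
    by (intro tendsto_intros lim0 right_continuous_step_tendsto rc x t order_refl)
  moreover have "\<forall>\<^sub>F n in sequentially. \<phi> 0 (stop_left (step n x) 0) \<bullet> (x (pt n (Suc 0)) - x 0) + (F t (stop (step n x) t) - F 0 (stop (step n x) 0)) = integral_sum \<phi> n t x"
    using ev_step_mem[OF x, of t] last_ev[of t]
  proof eventually_elim
    case (elim n)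
    obtain j where j: "Suc j < length (\<pi> n)" "pt n j \<le> t" "t < pt n (Suc j)"
      using ex_cell[OF t elim(2)] by metis
    have jf: "F t (stop y t) = F t (stop_left y t) + \<phi> t (stop_left y t) \<bullet> jump y t" if "y \<in> \<Omega>" "0 < t" for y t
      using M_b_jump[OF F that] agree_stop_left[OF \<phi> that(1)] that(2) by simp
    have "F t (stop (step n x) t) = F 0 (stop (step n x) 0) +
      (\<Sum>l=1..j. \<phi> (pt n l) (stop_left (step n x) (pt n l)) \<bullet> (x (pt n (Suc l)) - x (pt n l)))"
      by (rule step_path_telescope[where J = "\<lambda>t y e. \<phi> t y \<bullet> e", OF M_b_flat[OF F] jf elim(1) j]) auto
    moreover have "{..j} = insert 0 {1..j}" by auto
    ultimately show ?case
      unfolding integral_sum_def idx_eq[OF j] by simp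
  qed
  ultimately have "(\<lambda>n. integral_sum \<phi> n t x) \<longlonglongrightarrow> \<phi> 0 (stop_left x 0) \<bullet> 0 + (F t (stop x t) - F 0 (stop x 0))"
    by (rule Lim_transform_eventually)
  then show ?thesis by simp
qed

corollary pathwise_integral_eq:
  assumes "F \<in> M_b \<pi> \<Omega>" "agree (space_grad F) \<phi>" "x \<in> \<Omega>" "0 \<le> t"
  shows "pathwise_integral \<pi> \<phi> t x = F t (stop x t) - F 0 (stop x 0)"
  using limI[OF integral_sum_tendsto[OF assms]] by (simp add: pathwise_integral_def integral_sum_def)

end

subsection \<open>Riemann sums with varying weights and integrands\<close>


text \<open>If uniformity failed, counterexamples with strictly increasing n and times approaching t
  could be selected, contradicting the sequential limit. The sequence \<sigma> witnesses that
  admissible times near t exist for all large n.\<close>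

lemma seq_limit_uniform:
  fixes X :: "nat \<Rightarrow> real \<Rightarrow> 'a::metric_space"
  assumes seq: "\<And>\<tau>. \<tau> \<longlonglongrightarrow> t \<Longrightarrow> \<forall>\<^sub>F n in sequentially. P n (\<tau> n) \<Longrightarrow> (\<lambda>n. X n (\<tau> n)) \<longlonglongrightarrow> L"
    and fill: "\<sigma> \<longlonglongrightarrow> t" "\<forall>\<^sub>F n in sequentially. P n (\<sigma> n)" and e: "0 < e"
  shows "\<exists>d>0. \<exists>N. \<forall>n\<ge>N. \<forall>r. P n r \<longrightarrow> \<bar>r - t\<bar> < d \<longrightarrow> dist (X n r) L < e"
proof (rule ccontr)
  assume no: "\<not> ?thesis"
  have neg: "\<exists>n\<ge>N. \<exists>r. P n r \<and> \<bar>r - t\<bar> < d \<and> \<not> dist (X n r) L < e" if "0 < d" for N d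
    using no \<open>0 < d\<close> by blast
  define good where "good j p \<longleftrightarrow> P (fst p) (snd p) \<and> \<bar>snd p - t\<bar> < inverse (real (Suc j)) \<and> \<not> dist (X (fst p) (snd p)) L < e"
    for j and p :: "nat \<times> real"
  have ex: "\<exists>p. good j p \<and> N \<le> fst p" for j N
    using neg[of "inverse (real (Suc j))" N] by (auto simp: good_def)
  have "\<exists>f. \<forall>j. good j (f j) \<and> fst (f j) < fst (f (Suc j))"
  proof (rule dependent_nat_choice)
    show "\<exists>p. good 0 p" using ex by blast
    fix p :: "nat \<times> real" and j
    show "\<exists>q. good (Suc j) q \<and> fst p < fst q" using ex[of "Suc j" "Suc (fst p)"] by (auto simp: Suc_le_eq)
  qed
  then obtain f where f: "\<And>j. good j (f j)" "\<And>j. fst (f j) < fst (f (Suc j))" by blast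
  define k where "k j = fst (f j)" for j
  have k: "strict_mono k" unfolding strict_mono_Suc_iff k_def using f(2) by blast
  \<comment> \<open>Off the selected subsequence the times of \<sigma> are inserted, since the
    hypothesis speaks of sequences indexed by all n.\<close>
  define \<tau> where "\<tau> n = (if n \<in> range k then snd (f (inv k n)) else \<sigma> n)" for n
  have \<tau>k: "\<tau> (k j) = snd (f j)" for j
    using strict_mono_imp_inj_on[OF k] by (simp add: \<tau>_def)
  have "\<tau> \<longlonglongrightarrow> t"
  proof (rule LIMSEQ_I)
    fix r :: real assume r: "0 < r"
    obtain J where J: "inverse (real (Suc J)) < r" using reals_Archimedean[OF r] by blast
    obtain N where N: "\<And>n. N \<le> n \<Longrightarrow> norm (\<sigma> n - t) < r" using LIMSEQ_D[OF fill(1) r] by blast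
    have "norm (\<tau> n - t) < r" if n: "max N (k J) \<le> n" for n
    proof (cases "n \<in> range k")
      case True
      then obtain j where j: "n = k j" by blast
      then have "J \<le> j" using n strict_mono_less_eq[OF k] by simp
      then have "inverse (real (Suc j)) \<le> inverse (real (Suc J))" by (simp add: le_imp_inverse_le)
      moreover have "\<bar>snd (f j) - t\<bar> < inverse (real (Suc j))" using f(1)[of j] unfolding good_def by blast
      ultimately show ?thesis using J unfolding j \<tau>k real_norm_def by linarith
    next
      case False
      then show ?thesis using N[of n] n by (simp add: \<tau>_def)
    qed
    then show "\<exists>no. \<forall>n\<ge>no. norm (\<tau> n - t) < r" by blast
  qed
  moreover have "\<forall>\<^sub>F n in sequentially. P n (\<tau> n)"
    using fill(2)
  proof eventually_elim
    case (elim n)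
    then show ?case
    proof (cases "n \<in> range k")
      case True
      then obtain j where j: "n = k j" by blast
      have "P (k j) (snd (f j))" using f(1)[of j] unfolding good_def k_def by blast
      then show ?thesis unfolding j \<tau>k .
    qed (simp add: \<tau>_def)
  qed
  ultimately have "(\<lambda>n. X n (\<tau> n)) \<longlonglongrightarrow> L" by (rule seq)
  then have "(\<lambda>j. X (k j) (\<tau> (k j))) \<longlonglongrightarrow> L"
    using LIMSEQ_subseq_LIMSEQ[OF _ k, of "\<lambda>n. X n (\<tau> n)" L] by (simp add: o_def)
  then have "\<forall>\<^sub>F j in sequentially. dist (X (k j) (\<tau> (k j))) L < e"
    using e by (rule tendstoD)
  then obtain j where "dist (X (k j) (\<tau> (k j))) L < e"
    by (auto simp: eventually_sequentially)
  then show False using f(1)[of j] unfolding good_def \<tau>k unfolding k_def by blast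
qed

text \<open>A rational number chosen in the gap to the left of each point separates it from all
  smaller points, so the choice is injective.\<close>

lemma countable_left_isolated:
  fixes E :: "real set"
  assumes "\<And>t. t \<in> E \<Longrightarrow> \<exists>d>0. {t - d<..<t} \<inter> E = {}"
  shows "countable E"
proof -
  obtain d where d: "\<And>t. t \<in> E \<Longrightarrow> 0 < d t" "\<And>t. t \<in> E \<Longrightarrow> {t - d t<..<t} \<inter> E = {}"
    using assms by metis
  have "\<exists>q\<in>\<rat>. t - d t < q \<and> q < t" if "t \<in> E" for t
    using Rats_dense_in_real[of "t - d t" t] d(1)[OF that] by simp
  then obtain q where q: "\<And>t. t \<in> E \<Longrightarrow> q t \<in> \<rat>" "\<And>t. t \<in> E \<Longrightarrow> t - d t < q t" "\<And>t. t \<in> E \<Longrightarrow> q t < t"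
    by metis
  have less: "q t < q t'" if "t \<in> E" "t' \<in> E" "t < t'" for t t'
  proof -
    have "t \<notin> {t' - d t'<..<t'}" using d(2)[OF that(2)] that(1) by blast
    then have "t \<le> t' - d t'" using that(3) by auto
    then show ?thesis using q(3)[OF that(1)] q(2)[OF that(2)] by linarith
  qed
  have "inj_on q E"
    by (rule inj_onI) (metis less less_irrefl linorder_less_linear)
  moreover have "countable (q ` E)"
    by (rule countable_subset[OF _ countable_rat]) (use q(1) in blast)
  ultimately show ?thesis by (metis countable_image_inj_on)
qed

section \<open>Exceptional times and quantile functions of discrete measures\<close>

context partitions
begin

text \<open>Every time has a left neighbourhood in which the two-sided oscillation stays below any given level;
  so for each level the exceptional times are left-isolated.\<close>

lemma countable_exceptional_times:
  fixes f :: "nat \<Rightarrow> real \<Rightarrow> real"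
  assumes flim: "\<And>t \<tau>. 0 \<le> t \<Longrightarrow> \<tau> \<longlonglongrightarrow> t \<Longrightarrow>
      \<forall>\<^sub>F n in sequentially. 0 \<le> \<tau> n \<and> \<tau> n \<le> last_before \<pi> n t \<Longrightarrow> (\<lambda>n. f n (\<tau> n)) \<longlonglongrightarrow> g t"
  shows "\<exists>D. countable D \<and> (\<forall>t \<tau>. 0 \<le> t \<longrightarrow> t \<notin> D \<longrightarrow> \<tau> \<longlonglongrightarrow> t \<longrightarrow>
      (\<forall>\<^sub>F n in sequentially. 0 \<le> \<tau> n) \<longrightarrow> (\<lambda>n. f n (\<tau> n)) \<longlonglongrightarrow> g t)"
proof -
  define E where "E k = {t. 0 \<le> t \<and> \<not> (\<exists>N. \<exists>d>0. \<forall>n\<ge>N. \<forall>r\<ge>0. \<bar>r - t\<bar> < d \<longrightarrow> \<bar>f n r - g t\<bar> < inverse (real (Suc k)))}" for k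
  have lb0: "\<forall>\<^sub>F n in sequentially. 0 \<le> last_before \<pi> n t \<and> last_before \<pi> n t \<le> last_before \<pi> n t" for t
    by (simp add: last_before_nonneg)
  have "countable (E k)" for k
  proof (rule countable_left_isolated)
    fix t assume "t \<in> E k"
    then have t0: "0 \<le> t" by (simp add: E_def)
    \<comment> \<open>Halved because f n r and g u are both compared with g t.\<close>
    define e where "e = inverse (real (Suc k)) / 2"
    have e: "0 < e" by (simp add: e_def)
    have "\<exists>d>0. \<exists>N. \<forall>n\<ge>N. \<forall>r. 0 \<le> r \<and> r \<le> last_before \<pi> n t \<longrightarrow> \<bar>r - t\<bar> < d \<longrightarrow> dist (f n r) (g t) < e"
      by (rule seq_limit_uniform[where P = "\<lambda>n r. 0 \<le> r \<and> r \<le> last_before \<pi> n t", OF _ last_before_tendsto[OF t0] lb0 e])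
        (rule flim[OF t0])
    then obtain N d where d: "0 < d" and
      N: "\<And>n r. N \<le> n \<Longrightarrow> 0 \<le> r \<and> r \<le> last_before \<pi> n t \<Longrightarrow> \<bar>r - t\<bar> < d \<Longrightarrow> dist (f n r) (g t) < e"
      by blast
    have no: "u \<notin> E k" if u: "t - d < u" "u < t" "0 \<le> u" for u
    proof -
      \<comment> \<open>Times near u lie below v, and v lies below
        \<open>last_before \<pi> n t\<close> for large n. The one-sided control at t thus covers a
        two-sided neighbourhood of u.\<close>
      define v where "v = (u + t) / 2"
      have v: "u < v" "v < t" using u by (auto simp: v_def)
      have "\<forall>\<^sub>F n in sequentially. v < last_before \<pi> n t"
        using last_before_tendsto[OF t0] v(2) by (rule order_tendstoD)
      then obtain N' where N': "\<And>n. N' \<le> n \<Longrightarrow> v < last_before \<pi> n t" by (auto simp: eventually_sequentially)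
      define \<delta> where "\<delta> = min (v - u) (u - (t - d))"
      have \<delta>: "0 < \<delta>" using u v by (auto simp: \<delta>_def)
      have near: "\<bar>f n r - g t\<bar> < e" if "max N N' \<le> n" "0 \<le> r" "\<bar>r - u\<bar> < \<delta>" for n r
        using N[of n r] N'[of n] that u v by (auto simp: \<delta>_def dist_real_def abs_if split: if_splits)
      have "(\<lambda>n. f n (last_before \<pi> n u)) \<longlonglongrightarrow> g u"
        using flim[OF u(3) last_before_tendsto[OF u(3)] lb0] .
      then have "(\<lambda>n. \<bar>f n (last_before \<pi> n u) - g t\<bar>) \<longlonglongrightarrow> \<bar>g u - g t\<bar>"
        by (intro tendsto_intros)
      moreover have "\<forall>\<^sub>F n in sequentially. \<bar>f n (last_before \<pi> n u) - g t\<bar> \<le> e"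
      proof -
        have "\<forall>\<^sub>F n in sequentially. dist (last_before \<pi> n u) u < \<delta>"
          using last_before_tendsto[OF u(3)] \<delta> by (rule tendstoD)
        then show ?thesis using eventually_ge_at_top[of "max N N'"]
        proof eventually_elim
          case (elim n)
          from near[OF elim(2) last_before_nonneg[of n u]] elim(1) show ?case
            by (simp add: dist_real_def)
        qed
      qed
      ultimately have gu: "\<bar>g u - g t\<bar> \<le> e"
        by (rule tendsto_upperbound) simp
      have "\<bar>f n r - g u\<bar> < inverse (real (Suc k))" if "max N N' \<le> n" "0 \<le> r" "\<bar>r - u\<bar> < \<delta>" for n r
        using near[OF that] gu by (auto simp: e_def abs_if split: if_splits)
      then show ?thesis using \<delta> unfolding E_def by blast
    qed
    have "{t - d<..<t} \<inter> E k = {}"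
    proof (rule equals0I)
      fix u assume u: "u \<in> {t - d<..<t} \<inter> E k"
      then have "0 \<le> u" by (simp add: E_def)
      with no[of u] u show False by simp
    qed
    with d show "\<exists>d>0. {t - d<..<t} \<inter> E k = {}" by blast
  qed
  then have "countable (\<Union>k. E k)" by simp
  then show ?thesis
  proof (intro exI[of _ "\<Union>k. E k"] conjI allI impI)
    fix t \<tau> assume t: "0 \<le> t" "t \<notin> (\<Union>k. E k)" and \<tau>: "\<tau> \<longlonglongrightarrow> t" and nn: "\<forall>\<^sub>F n in sequentially. 0 \<le> \<tau> n"
    show "(\<lambda>n. f n (\<tau> n)) \<longlonglongrightarrow> g t"
    proof (rule tendstoI)
      fix e :: real assume "0 < e"
      then obtain k where k: "inverse (real (Suc k)) < e" using reals_Archimedean by blast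
      have "t \<notin> E k" using t(2) by blast
      then obtain N d where d: "0 < d"
        and N: "\<And>n r. N \<le> n \<Longrightarrow> 0 \<le> r \<Longrightarrow> \<bar>r - t\<bar> < d \<Longrightarrow> \<bar>f n r - g t\<bar> < inverse (real (Suc k))"
        using t(1) unfolding E_def by blast
      show "\<forall>\<^sub>F n in sequentially. dist (f n (\<tau> n)) (g t) < e"
        using eventually_ge_at_top[of N] tendstoD[OF \<tau> d] nn
      proof eventually_elim
        case (elim n)
        from N[OF elim(1) elim(3)] elim(2) k show ?case by (simp add: dist_real_def)
      qed
    qed
  qed
qed

text \<open>The discrete measure with mass a n l at t_l is spread over Lebesgue measure by giving
  t_l an interval of length a n l; the result is f n composed with the quantile function of that
  measure, cut off at T.\<close>

definition quantile_fun :: "(nat \<Rightarrow> nat \<Rightarrow> real) \<Rightarrow> (nat \<Rightarrow> real \<Rightarrow> real) \<Rightarrow> real \<Rightarrow> nat \<Rightarrow> real \<Rightarrow> real" where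
  "quantile_fun a f T n u =
     (\<Sum>l\<in>idx n T. f n (pt n l) * indicator {(\<Sum>i<l. a n i)<..(\<Sum>i<Suc l. a n i)} u)"

lemma quantile_fun_integral:
  assumes "\<And>l. 0 \<le> a n l"
  shows "integrable lborel (quantile_fun a f T n)"
    and "(LINT u|lborel. quantile_fun a f T n u) = (\<Sum>l\<in>idx n T. f n (pt n l) * a n l)"
proof -
  have 1: "integrable lborel (\<lambda>u. f n (pt n l) * indicator {(\<Sum>i<l. a n i)<..(\<Sum>i<Suc l. a n i)} u)" for l
    using assms by (intro integrable_mult_right integrable_real_indicator) auto
  then show "integrable lborel (quantile_fun a f T n)"
    unfolding quantile_fun_def by (intro Bochner_Integration.integrable_sum)
  have "(LINT u|lborel. quantile_fun a f T n u) =
      (\<Sum>l\<in>idx n T. LINT u|lborel. f n (pt n l) * indicator {(\<Sum>i<l. a n i)<..(\<Sum>i<Suc l. a n i)} u)"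
    unfolding quantile_fun_def by (intro Bochner_Integration.integral_sum 1)
  also have "\<dots> = (\<Sum>l\<in>idx n T. f n (pt n l) * a n l)"
    using assms by (intro sum.cong refl) simp
  finally show "(LINT u|lborel. quantile_fun a f T n u) = (\<Sum>l\<in>idx n T. f n (pt n l) * a n l)" .
qed

lemma quantile_fun_eq:
  assumes a: "\<And>l. 0 \<le> a n l" and l: "l \<in> idx n T" and u: "(\<Sum>i<l. a n i) < u" "u \<le> (\<Sum>i<Suc l. a n i)"
  shows "quantile_fun a f T n u = f n (pt n l)"
proof -
  have mono: "(\<Sum>i<p. a n i) \<le> (\<Sum>i<q. a n i)" if "p \<le> q" for p q
    by (rule sum_mono2) (use that a in auto)
  have "quantile_fun a f T n u = (\<Sum>k\<in>idx n T. if k = l then f n (pt n l) else 0)"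
    unfolding quantile_fun_def
  proof (rule sum.cong[OF refl])
    fix k assume "k \<in> idx n T"
    have "u \<notin> {(\<Sum>i<k. a n i)<..(\<Sum>i<Suc k. a n i)}" if "k \<noteq> l"
    proof (cases "k < l")
      case True
      then show ?thesis using mono[of "Suc k" l] u by auto
    next
      case False
      then have "Suc l \<le> k" using that by simp
      from mono[OF this] u show ?thesis by auto
    qed
    then show "f n (pt n k) * indicator {(\<Sum>i<k. a n i)<..(\<Sum>i<Suc k. a n i)} u = (if k = l then f n (pt n l) else 0)"
      using u by auto
  qed
  also have "\<dots> = f n (pt n l)" using l by (subst sum.delta) auto
  finally show ?thesis .
qed

lemma quantile_fun_zero:
  assumes a: "\<And>l. 0 \<le> a n l" and u: "u \<le> 0 \<or> (\<Sum>l\<in>idx n T. a n l) < u" and T: "0 \<le> T" "T < last (\<pi> n)"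
  shows "quantile_fun a f T n u = 0"
  unfolding quantile_fun_def
proof (rule sum.neutral, rule ballI)
  fix l assume l: "l \<in> idx n T"
  obtain j where j: "Suc j < length (\<pi> n)" "pt n j \<le> T" "T < pt n (Suc j)" using ex_cell[OF T] by metis
  have "l \<le> j" using l unfolding idx_eq[OF j] by simp
  then have "(\<Sum>i<Suc l. a n i) \<le> (\<Sum>i\<in>{..j}. a n i)" by (intro sum_mono2) (auto simp: a)
  then have "(\<Sum>i<Suc l. a n i) \<le> (\<Sum>i\<in>idx n T. a n i)" unfolding idx_eq[OF j] .
  moreover have "0 \<le> (\<Sum>i<l. a n i)" by (intro sum_nonneg a)
  ultimately have "u \<notin> {(\<Sum>i<l. a n i)<..(\<Sum>i<Suc l. a n i)}" using u by auto
  then show "f n (pt n l) * indicator {(\<Sum>i<l. a n i)<..(\<Sum>i<Suc l. a n i)} u = 0" by simp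
qed

text \<open>The index l is the first at which the accumulated mass reaches u. The last clause is the
  Galois connection between quantile and distribution function, which turns convergence of masses
  into convergence of quantiles.\<close>

lemma quantile_cell:
  fixes a :: "nat \<Rightarrow> nat \<Rightarrow> real"
  assumes a: "\<And>l. 0 \<le> a n l" and u: "0 < u" "u \<le> (\<Sum>l\<in>idx n T. a n l)" and T: "0 \<le> T" "T < last (\<pi> n)"
  shows "\<exists>l\<in>idx n T. (\<Sum>i<l. a n i) < u \<and> u \<le> (\<Sum>i<Suc l. a n i) \<and>
    (\<forall>r. 0 \<le> r \<longrightarrow> r < last (\<pi> n) \<longrightarrow> (u \<le> (\<Sum>i\<in>idx n r. a n i) \<longleftrightarrow> pt n l \<le> r))"
proof -
  obtain j where j: "Suc j < length (\<pi> n)" "pt n j \<le> T" "T < pt n (Suc j)" using ex_cell[OF T] by metis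
  define Q where "Q l \<longleftrightarrow> u \<le> (\<Sum>i<Suc l. a n i)" for l
  define l where "l = (LEAST l. Q l)"
  have Qj: "Q j" using u(2) unfolding idx_eq[OF j] Q_def lessThan_Suc_atMost .
  have Ql: "Q l" unfolding l_def using Qj by (rule LeastI)
  have lj: "l \<le> j" unfolding l_def using Qj by (rule Least_le)
  have min: "\<not> Q k" if "k < l" for k using that unfolding l_def by (rule not_less_Least)
  have mono: "(\<Sum>i<p. a n i) \<le> (\<Sum>i<q. a n i)" if "p \<le> q" for p q
    by (rule sum_mono2) (use that a in auto)
  show ?thesis
  proof (intro bexI[of _ l] conjI allI impI)
    show "l \<in> idx n T" using lj unfolding idx_eq[OF j] by simp
    show "u \<le> (\<Sum>i<Suc l. a n i)" using Ql unfolding Q_def .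
    show "(\<Sum>i<l. a n i) < u"
    proof (cases l)
      case 0
      then show ?thesis using u by simp
    next
      case (Suc k)
      then show ?thesis using min[of k] by (simp add: Q_def)
    qed
    fix r assume r: "0 \<le> r" "r < last (\<pi> n)"
    obtain i where i: "Suc i < length (\<pi> n)" "pt n i \<le> r" "r < pt n (Suc i)" using ex_cell[OF r] by metis
    have "u \<le> (\<Sum>i\<in>idx n r. a n i) \<longleftrightarrow> Q i" unfolding idx_eq[OF i] Q_def lessThan_Suc_atMost ..
    also have "\<dots> \<longleftrightarrow> l \<le> i"
    proof
      assume "Q i" then show "l \<le> i" unfolding l_def by (rule Least_le)
    next
      assume "l \<le> i"
      then show "Q i" using Ql mono[of "Suc l" "Suc i"] unfolding Q_def by simp
    qed
    also have "\<dots> \<longleftrightarrow> l \<in> idx n r" unfolding idx_eq[OF i] by simp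
    also have "\<dots> \<longleftrightarrow> pt n l \<le> r" using lj j by simp
    finally show "u \<le> (\<Sum>i\<in>idx n r. a n i) \<longleftrightarrow> pt n l \<le> r" .
  qed
qed

text \<open>Two convergences of mass are demanded. Together they say that the points in (t'_n, s]
  carry vanishing mass: an atom of A at s is built up at points not after t'_n, which is where the
  integrands f n are required to converge.\<close>

definition weighted_approx ::
    "real \<Rightarrow> (real \<Rightarrow> real) \<Rightarrow> (real \<Rightarrow> real) \<Rightarrow> (nat \<Rightarrow> nat \<Rightarrow> real) \<Rightarrow> (nat \<Rightarrow> real \<Rightarrow> real) \<Rightarrow> bool" where
  "weighted_approx T A g a f \<longleftrightarrow>
     (\<forall>n l. 0 \<le> a n l) \<and>
     (\<forall>r\<ge>0. (\<lambda>n. \<Sum>l\<in>idx n r. a n l) \<longlonglongrightarrow> A r) \<and>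
     (\<forall>s\<ge>0. (\<lambda>n. \<Sum>l\<in>idx n (last_before \<pi> n s). a n l) \<longlonglongrightarrow> A s) \<and>
     (\<exists>C. \<forall>\<^sub>F n in sequentially. \<forall>r\<in>{0..T}. \<bar>f n r\<bar> \<le> C) \<and>
     (\<forall>t\<ge>0. \<forall>\<tau>. \<tau> \<longlonglongrightarrow> t \<longrightarrow> (\<forall>\<^sub>F n in sequentially. 0 \<le> \<tau> n \<and> \<tau> n \<le> last_before \<pi> n t) \<longrightarrow>
        (\<lambda>n. f n (\<tau> n)) \<longlonglongrightarrow> g t)"

text \<open>At an atom of \<open>A\<close> the quantiles approach from the left by the convergence of the mass up to
  \<^term>\<open>last_before \<pi> n s\<close>; the levels \<open>u\<close> belonging to other exceptional times are countably many.\<close>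

lemma quantile_fun_tendsto:
  assumes w: "weighted_approx T A g a f" and T: "0 \<le> T"
    and rc: "\<forall>s\<ge>0. (A \<longlongrightarrow> A s) (at_right s)"
  shows "AE u in lborel. (\<lambda>n. quantile_fun a f T n u) \<longlonglongrightarrow>
     (if 0 < u \<and> u < A T then g (Inf {s. 0 \<le> s \<and> u \<le> A s}) else 0)"
proof -
  have a: "0 \<le> a n l" for n l using w by (simp add: weighted_approx_def)
  have lim: "(\<lambda>n. \<Sum>l\<in>idx n r. a n l) \<longlonglongrightarrow> A r" if "0 \<le> r" for r
    using w that by (simp add: weighted_approx_def)
  have limL: "(\<lambda>n. \<Sum>l\<in>idx n (last_before \<pi> n s). a n l) \<longlonglongrightarrow> A s" if "0 \<le> s" for s
    using w that by (simp add: weighted_approx_def)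
  have flim: "(\<lambda>n. f n (\<tau> n)) \<longlonglongrightarrow> g t" if "0 \<le> t" "\<tau> \<longlonglongrightarrow> t"
      "\<forall>\<^sub>F n in sequentially. 0 \<le> \<tau> n \<and> \<tau> n \<le> last_before \<pi> n t" for t \<tau>
    using w that unfolding weighted_approx_def by blast
  have "\<exists>D. countable D \<and> (\<forall>t \<tau>. 0 \<le> t \<longrightarrow> t \<notin> D \<longrightarrow> \<tau> \<longlonglongrightarrow> t \<longrightarrow>
      (\<forall>\<^sub>F n in sequentially. 0 \<le> \<tau> n) \<longrightarrow> (\<lambda>n. f n (\<tau> n)) \<longlonglongrightarrow> g t)"
    by (rule countable_exceptional_times) (rule flim)
  then obtain D where D: "countable D" and
    flimD: "\<And>t \<tau>. 0 \<le> t \<Longrightarrow> t \<notin> D \<Longrightarrow> \<tau> \<longlonglongrightarrow> t \<Longrightarrow> \<forall>\<^sub>F n in sequentially. 0 \<le> \<tau> n \<Longrightarrow> (\<lambda>n. f n (\<tau> n)) \<longlonglongrightarrow> g t"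
    by blast
  have A_mono: "A r \<le> A s" if "0 \<le> r" "r \<le> s" for r s
  proof (rule tendsto_le[OF _ lim lim])
    show "\<forall>\<^sub>F n in sequentially. (\<Sum>l\<in>idx n r. a n l) \<le> (\<Sum>l\<in>idx n s. a n l)"
      by (intro always_eventually allI sum_mono2) (use that a in auto)
  qed (use that in auto)
  \<comment> \<open>Discarding values of A at rationals makes the inequality u < A r strict at
    rational r beyond the quantile; discarding those on D forces the quantile at an exceptional time
    to lie strictly inside an atom; A T is the edge of the cut-off.\<close>
  define E where "E = A ` \<rat> \<union> A ` D \<union> {A T}"
  have "countable E" unfolding E_def by (intro countable_Un countable_image countable_rat D) simp
  have main: "(\<lambda>n. quantile_fun a f T n u) \<longlonglongrightarrow>
     (if 0 < u \<and> u < A T then g (Inf {s. 0 \<le> s \<and> u \<le> A s}) else 0)" if uE: "u \<notin> E" for u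
  proof -
    have uT: "u \<noteq> A T" using uE by (auto simp: E_def)
    show ?thesis
    proof (cases "0 < u \<and> u < A T")
      case False
      have "\<forall>\<^sub>F n in sequentially. u \<le> 0 \<or> (\<Sum>l\<in>idx n T. a n l) < u"
      proof (cases "u \<le> 0")
        case u0: False
        then have "A T < u" using False uT by linarith
        from order_tendstoD(2)[OF lim[OF T] this] show ?thesis by (auto elim: eventually_mono)
      qed simp
      then have "\<forall>\<^sub>F n in sequentially. quantile_fun a f T n u = 0"
        using last_ev[of T]
      proof eventually_elim
        case (elim n)
        show ?case by (rule quantile_fun_zero[where a = a and n = n, OF a elim(1) T elim(2)])
      qed
      then show ?thesis unfolding if_not_P[OF False] by (rule tendsto_eventually)
    next
      case True
      define S where "S = {s. 0 \<le> s \<and> u \<le> A s}"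
      define s where "s = Inf S"
      have TS: "T \<in> S" using True T by (simp add: S_def)
      have bdd: "bdd_below S" by (rule bdd_belowI[of _ 0]) (simp add: S_def)
      have s0: "0 \<le> s" unfolding s_def by (rule cInf_greatest) (use TS in \<open>auto simp: S_def\<close>)
      have sT: "s \<le> T" unfolding s_def by (rule cInf_lower[OF TS bdd])
      have below: "A r < u" if "0 \<le> r" "r < s" for r
      proof (rule ccontr)
        assume "\<not> A r < u"
        then have "r \<in> S" using that by (simp add: S_def)
        then have "s \<le> r" unfolding s_def by (rule cInf_lower[OF _ bdd])
        then show False using that by simp
      qed
      have ge: "u \<le> A r" if "s < r" for r
      proof -
        have "S \<noteq> {}" using TS by blast
        from cInf_less_iff[OF this bdd, of r] that obtain v where v: "v \<in> S" "v < r"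
          by (auto simp: s_def)
        then show ?thesis using A_mono[of v r] by (auto simp: S_def)
      qed
      have above: "u < A r" if "s < r" "r \<in> \<rat>" for r
        using ge[OF that(1)] uE that(2) by (auto simp: E_def order_le_less)
      have "\<forall>\<^sub>F n in sequentially. u < (\<Sum>l\<in>idx n T. a n l)"
        using order_tendstoD(1)[OF lim[OF T]] True by blast
      then have "\<forall>\<^sub>F n in sequentially. \<exists>l\<in>idx n T. (\<Sum>i<l. a n i) < u \<and> u \<le> (\<Sum>i<Suc l. a n i) \<and>
        (\<forall>r. 0 \<le> r \<longrightarrow> r < last (\<pi> n) \<longrightarrow> (u \<le> (\<Sum>i\<in>idx n r. a n i) \<longleftrightarrow> pt n l \<le> r))"
        using last_ev[of T]
      proof eventually_elim
        case (elim n)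
        have "u \<le> (\<Sum>l\<in>idx n T. a n l)" using elim by simp
        from quantile_cell[where a = a and n = n, OF a _ this T elim(2)] True show ?case by blast
      qed
      then have "\<forall>\<^sub>F n in sequentially. \<exists>l. l \<in> idx n T \<and> quantile_fun a f T n u = f n (pt n l) \<and>
        (\<forall>r. 0 \<le> r \<longrightarrow> r < last (\<pi> n) \<longrightarrow> (u \<le> (\<Sum>i\<in>idx n r. a n i) \<longleftrightarrow> pt n l \<le> r))"
      proof eventually_elim
        case (elim n)
        then obtain l where l: "l \<in> idx n T" "(\<Sum>i<l. a n i) < u" "u \<le> (\<Sum>i<Suc l. a n i)"
          and "\<forall>r. 0 \<le> r \<longrightarrow> r < last (\<pi> n) \<longrightarrow> (u \<le> (\<Sum>i\<in>idx n r. a n i) \<longleftrightarrow> pt n l \<le> r)" by blast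
        with quantile_fun_eq[where a = a and n = n, OF a l] show ?case by blast
      qed
      then have "\<exists>L. \<forall>\<^sub>F n in sequentially. L n \<in> idx n T \<and> quantile_fun a f T n u = f n (pt n (L n)) \<and>
        (\<forall>r. 0 \<le> r \<longrightarrow> r < last (\<pi> n) \<longrightarrow> (u \<le> (\<Sum>i\<in>idx n r. a n i) \<longleftrightarrow> pt n (L n) \<le> r))"
        by (rule eventually_ex[THEN iffD1])
      then obtain L where L: "\<forall>\<^sub>F n in sequentially. L n \<in> idx n T \<and> quantile_fun a f T n u = f n (pt n (L n)) \<and>
        (\<forall>r. 0 \<le> r \<longrightarrow> r < last (\<pi> n) \<longrightarrow> (u \<le> (\<Sum>i\<in>idx n r. a n i) \<longleftrightarrow> pt n (L n) \<le> r))"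
        by blast
      define \<tau> where "\<tau> n = pt n (L n)" for n
      have \<tau>0: "\<forall>\<^sub>F n in sequentially. 0 \<le> \<tau> n"
        using L by eventually_elim (auto simp: \<tau>_def intro: pt_nonneg)
      have iff: "\<forall>\<^sub>F n in sequentially. u \<le> (\<Sum>i\<in>idx n (\<rho> n). a n i) \<longleftrightarrow> \<tau> n \<le> \<rho> n"
        if "\<And>n. 0 \<le> \<rho> n" "\<And>n. \<rho> n \<le> R" for \<rho> R
        using L last_ev[of R]
      proof eventually_elim
        case (elim n)
        have "\<rho> n < last (\<pi> n)" using that(2)[of n] elim(2) by simp
        with elim(1) that(1)[of n] show ?case unfolding \<tau>_def by blast
      qed
      have "\<tau> \<longlonglongrightarrow> s"
      proof (rule order_tendstoI)
        fix v assume v: "v < s"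
        show "\<forall>\<^sub>F n in sequentially. v < \<tau> n"
        proof (cases "v < 0")
          case True
          show ?thesis using \<tau>0 by eventually_elim (use True in simp)
        next
          case False
          have "\<forall>\<^sub>F n in sequentially. (\<Sum>i\<in>idx n v. a n i) < u"
            using order_tendstoD(2)[OF lim below[OF _ v]] False by simp
          then show ?thesis using iff[of "\<lambda>_. v" v] False
            by (auto elim: eventually_elim2)
        qed
      next
        fix v assume "s < v"
        then obtain r where r: "r \<in> \<rat>" "s < r" "r < v" using Rats_dense_in_real by blast
        have "\<forall>\<^sub>F n in sequentially. u < (\<Sum>i\<in>idx n r. a n i)"
          using order_tendstoD(1)[OF lim above[OF r(2,1)]] r s0 by simp
        moreover have "\<forall>\<^sub>F n in sequentially. u \<le> (\<Sum>i\<in>idx n r. a n i) \<longleftrightarrow> \<tau> n \<le> r"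
          using iff[of "\<lambda>_. r" r] r s0 by simp
        ultimately show "\<forall>\<^sub>F n in sequentially. \<tau> n < v"
          by eventually_elim (use r in auto)
      qed
      have "(\<lambda>n. f n (\<tau> n)) \<longlonglongrightarrow> g s"
      proof (cases "s \<in> D")
        case False
        then show ?thesis using flimD[OF s0 _ \<open>\<tau> \<longlonglongrightarrow> s\<close> \<tau>0] by blast
      next
        case sD: True
        have "u \<le> A s"
        proof (rule tendsto_lowerbound[OF rc[rule_format, OF s0]])
          show "\<forall>\<^sub>F r in at_right s. u \<le> A r"
            unfolding eventually_at_right_field using ge by (intro exI[of _ "s + 1"]) auto
        qed simp
        \<comment> \<open>Equality is ruled out by E. With strict inequality the mass up to
          \<open>last_before \<pi> n s\<close> eventually exceeds u, so the approximating quantile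
          is at most \<open>last_before \<pi> n s\<close> and the one-sided limit applies.\<close>
        then have "u < A s" using uE sD by (auto simp: E_def order_le_less)
        then have "\<forall>\<^sub>F n in sequentially. u < (\<Sum>i\<in>idx n (last_before \<pi> n s). a n i)"
          using order_tendstoD(1)[OF limL[OF s0]] by blast
        moreover have "\<forall>\<^sub>F n in sequentially. u \<le> (\<Sum>i\<in>idx n (last_before \<pi> n s). a n i) \<longleftrightarrow> \<tau> n \<le> last_before \<pi> n s"
          by (rule iff[of _ s]) (simp_all add: last_before_nonneg last_before_le s0)
        ultimately have "\<forall>\<^sub>F n in sequentially. 0 \<le> \<tau> n \<and> \<tau> n \<le> last_before \<pi> n s"
          using \<tau>0 by eventually_elim auto
        from flim[OF s0 \<open>\<tau> \<longlonglongrightarrow> s\<close> this] show ?thesis .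
      qed
      moreover have "\<forall>\<^sub>F n in sequentially. f n (\<tau> n) = quantile_fun a f T n u"
        using L by eventually_elim (simp add: \<tau>_def)
      ultimately have "(\<lambda>n. quantile_fun a f T n u) \<longlonglongrightarrow> g s"
        by (rule Lim_transform_eventually)
      then show ?thesis using True by (simp add: s_def S_def)
    qed
  qed
  show ?thesis
  proof (rule AE_I')
    show "E \<in> null_sets lborel" using \<open>countable E\<close> by (rule countable_imp_null_set_lborel)
    show "{u \<in> space lborel. \<not> (\<lambda>n. quantile_fun a f T n u) \<longlonglongrightarrow>
     (if 0 < u \<and> u < A T then g (Inf {s. 0 \<le> s \<and> u \<le> A s}) else 0)} \<subseteq> E" using main by blast
  qed
qed

lemma quantile_fun_bound:
  assumes w: "weighted_approx T A g a f" and T: "0 \<le> T"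
  obtains C where "0 \<le> C" "\<forall>\<^sub>F n in sequentially. \<forall>u. \<bar>quantile_fun a f T n u\<bar> \<le> C * indicator {0..A T + 1} u"
proof -
  have a: "0 \<le> a n l" for n l using w by (simp add: weighted_approx_def)
  have lim: "(\<lambda>n. \<Sum>l\<in>idx n T. a n l) \<longlonglongrightarrow> A T"
    using w T by (simp add: weighted_approx_def)
  obtain C where C: "\<forall>\<^sub>F n in sequentially. \<forall>r\<in>{0..T}. \<bar>f n r\<bar> \<le> C"
    using w unfolding weighted_approx_def by blast
  then obtain n where "\<forall>r\<in>{0..T}. \<bar>f n r\<bar> \<le> C" by (auto simp: eventually_sequentially)
  then have "\<bar>f n 0\<bar> \<le> C" using T by simp
  then have C0: "0 \<le> C" by linarith
  have "\<forall>\<^sub>F n in sequentially. (\<Sum>l\<in>idx n T. a n l) < A T + 1"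
    using lim by (rule order_tendstoD) simp
  then have "\<forall>\<^sub>F n in sequentially. \<forall>u. \<bar>quantile_fun a f T n u\<bar> \<le> C * indicator {0..A T + 1} u"
    using C last_ev[of T]
  proof eventually_elim
    case (elim n)
    show ?case
    proof
      fix u
      show "\<bar>quantile_fun a f T n u\<bar> \<le> C * indicator {0..A T + 1} u"
      proof (cases "u \<le> 0 \<or> (\<Sum>l\<in>idx n T. a n l) < u")
        case True
        then show ?thesis using quantile_fun_zero[where a = a and n = n, OF a True T elim(3)] C0 by simp
      next
        case False
        then have u: "0 < u" "u \<le> (\<Sum>l\<in>idx n T. a n l)" by auto
        from quantile_cell[where a = a and n = n, OF a u T elim(3)] obtain l where
          l: "l \<in> idx n T" "(\<Sum>i<l. a n i) < u" "u \<le> (\<Sum>i<Suc l. a n i)" by blast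
        have "\<bar>f n (pt n l)\<bar> \<le> C" using elim(2) l(1) pt_nonneg[of l n] by auto
        then show ?thesis using quantile_fun_eq[where a = a and n = n, OF a l] u elim(1) by simp
      qed
    qed
  qed
  with C0 show thesis by (rule that)
qed

text \<open>The almost everywhere limit of the quantile functions depends on A and g only, so two
  approximating systems with the same A and g have the same limit, and dominated convergence makes
  the sums merge. The common limit never has to be recognised as an integral.\<close>

theorem weighted_approx_diff:
  assumes w: "weighted_approx T A g a f" and w': "weighted_approx T A g a' f'" and T: "0 \<le> T"
    and rc: "\<forall>s\<ge>0. (A \<longlongrightarrow> A s) (at_right s)"
  shows "(\<lambda>n. (\<Sum>l\<in>idx n T. f n (pt n l) * a n l) - (\<Sum>l\<in>idx n T. f' n (pt n l) * a' n l)) \<longlonglongrightarrow> 0"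
proof -
  have a: "0 \<le> a n l" for n l using w by (simp add: weighted_approx_def)
  have a': "0 \<le> a' n l" for n l using w' by (simp add: weighted_approx_def)
  obtain C where C: "\<forall>\<^sub>F n in sequentially. \<forall>u. \<bar>quantile_fun a f T n u\<bar> \<le> C * indicator {0..A T + 1} u"
    using quantile_fun_bound[OF w T] by metis
  obtain C' where C': "\<forall>\<^sub>F n in sequentially. \<forall>u. \<bar>quantile_fun a' f' T n u\<bar> \<le> C' * indicator {0..A T + 1} u"
    using quantile_fun_bound[OF w' T] by metis
  have "\<forall>\<^sub>F n in sequentially. \<forall>u. \<bar>quantile_fun a f T n u - quantile_fun a' f' T n u\<bar> \<le> (C + C') * indicator {0..A T + 1} u"
    using C C'
  proof eventually_elim
    case (elim n)
    show ?case
    proof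
      fix u show "\<bar>quantile_fun a f T n u - quantile_fun a' f' T n u\<bar> \<le> (C + C') * indicator {0..A T + 1} u"
        using elim(1)[rule_format, of u] elim(2)[rule_format, of u] by (simp add: distrib_right)
    qed
  qed
  \<comment> \<open>The domination starts at N, which is why the sequences are shifted below. The
    differences converge to the constant 0, so measurability of the limit is immediate.\<close>
  then obtain N where N: "\<And>n u. N \<le> n \<Longrightarrow> \<bar>quantile_fun a f T n u - quantile_fun a' f' T n u\<bar> \<le> (C + C') * indicator {0..A T + 1} u"
    by (auto simp: eventually_sequentially)
  have int: "integrable lborel (quantile_fun a f T n)" "integrable lborel (quantile_fun a' f' T n)" for n
    using quantile_fun_integral(1) a a' by blast+
  have "(\<lambda>n. LINT u|lborel. quantile_fun a f T (n + N) u - quantile_fun a' f' T (n + N) u) \<longlonglongrightarrow> integral\<^sup>L lborel (\<lambda>u::real. 0::real)"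
  proof (rule integral_dominated_convergence[where M = lborel and f = "\<lambda>_. 0" and s = "\<lambda>n u. quantile_fun a f T (n + N) u - quantile_fun a' f' T (n + N) u" and w = "\<lambda>u. (C + C') * indicator {0..A T + 1} u"])
    show "(\<lambda>u. quantile_fun a f T (n + N) u - quantile_fun a' f' T (n + N) u) \<in> borel_measurable lborel" for n
      using int by (intro borel_measurable_diff borel_measurable_integrable)
    show "integrable lborel (\<lambda>u. (C + C') * indicator {0..A T + 1} u)"
      by (intro integrable_mult_right integrable_real_indicator) (auto simp: emeasure_lborel_Icc_eq)
    show "AE u in lborel. (\<lambda>n. quantile_fun a f T (n + N) u - quantile_fun a' f' T (n + N) u) \<longlonglongrightarrow> 0"
      using quantile_fun_tendsto[OF w T, OF rc] quantile_fun_tendsto[OF w' T, OF rc]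
    proof eventually_elim
      case (elim u)
      from tendsto_diff[OF elim] have "(\<lambda>n. quantile_fun a f T n u - quantile_fun a' f' T n u) \<longlonglongrightarrow> 0" by simp
      then show ?case by (rule LIMSEQ_ignore_initial_segment)
    qed
    show "AE u in lborel. norm (quantile_fun a f T (n + N) u - quantile_fun a' f' T (n + N) u) \<le> (C + C') * indicator {0..A T + 1} u" for n
      using N[of "n + N"] by simp
  qed simp
  moreover have "(LINT u|lborel. quantile_fun a f T n u - quantile_fun a' f' T n u) =
     (\<Sum>l\<in>idx n T. f n (pt n l) * a n l) - (\<Sum>l\<in>idx n T. f' n (pt n l) * a' n l)" for n
    using quantile_fun_integral(2)[of a n f T, OF a] quantile_fun_integral(2)[of a' n f' T, OF a']
    by (simp add: Bochner_Integration.integral_diff int)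
  ultimately have "(\<lambda>n. (\<Sum>l\<in>idx (n + N) T. f (n + N) (pt (n + N) l) * a (n + N) l) -
      (\<Sum>l\<in>idx (n + N) T. f' (n + N) (pt (n + N) l) * a' (n + N) l)) \<longlonglongrightarrow> 0" by simp
  then show ?thesis by (rule LIMSEQ_offset)
qed

end

subsection \<open>Stieltjes sums and quadratic variation\<close>


context partitions
begin

lemma cell_sum_eq:
  fixes c :: "nat \<Rightarrow> real"
  assumes s: "0 < s" "s \<le> last (\<pi> n)" and j: "Suc j < length (\<pi> n)" "pt n j < s" "s \<le> pt n (Suc j)"
  shows "(\<Sum>l\<in>idx n T. c l * indicator {pt n l<..pt n (Suc l)} s) = (if pt n j \<le> T then c j else 0)"
proof -
  have "(\<Sum>l\<in>idx n T. c l * indicator {pt n l<..pt n (Suc l)} s) = (\<Sum>l\<in>idx n T. if l = j then c j else 0)"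
  proof (rule sum.cong[OF refl])
    fix l assume l: "l \<in> idx n T"
    have "s \<notin> {pt n l<..pt n (Suc l)}" if "l \<noteq> j"
    proof
      assume "s \<in> {pt n l<..pt n (Suc l)}"
      then have "pt n l = pt n j"
        using last_before_cell[of l n s] last_before_cell[OF j] l by simp
      then show False using pt_less[of l j n] pt_less[of j l n] l j that by (cases l j rule: linorder_cases) auto
    qed
    then show "c l * indicator {pt n l<..pt n (Suc l)} s = (if l = j then c j else 0)"
      using j by auto
  qed
  also have "\<dots> = (if pt n j \<le> T then c j else 0)" using j by (subst sum.delta) auto
  finally show ?thesis .
qed

text \<open>The sum is the integral of the step function F n that freezes f at left ends of
  left-open cells. For 0 < s \<le> T its value at s is eventually f at
  \<open>last_before \<pi> n s\<close>, which tends to f s by left continuity.\<close>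

theorem Stieltjes_sum_tendsto:
  assumes G: "mono G" "\<And>s. continuous (at_right s) G" and T: "0 \<le> T"
    and bd: "\<And>s. s \<in> {0..T} \<Longrightarrow> \<bar>f s\<bar> \<le> C"
    and left: "\<And>s. 0 < s \<Longrightarrow> s \<le> T \<Longrightarrow> (f \<longlongrightarrow> f s) (at_left s)"
  shows "set_integrable (interval_measure G) {0<..T} f"
    and "(\<lambda>n. \<Sum>l\<in>idx n T. f (pt n l) * (G (pt n (Suc l)) - G (pt n l))) \<longlonglongrightarrow> (LINT s:{0<..T}|interval_measure G. f s)"
proof -
  let ?M = "interval_measure G"
  have G_le: "G a \<le> G b" if "a \<le> b" for a b using G(1) that by (rule monoD)
  have em: "emeasure ?M {a<..b} = ennreal (G b - G a)" if "a \<le> b" for a b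
    by (rule emeasure_interval_measure_Ioc[OF that G_le G(2)])
  define F where "F n s = (\<Sum>l\<in>idx n T. f (pt n l) * indicator {pt n l<..pt n (Suc l)} s)" for n s
  have C0: "0 \<le> C" using bd[of 0] T by simp
  have int1: "integrable ?M (\<lambda>s. f (pt n l) * indicator {pt n l<..pt n (Suc l)} s)" if "l \<in> idx n T" for n l
  proof (intro integrable_mult_right integrable_real_indicator)
    have "pt n l \<le> pt n (Suc l)" using that by (intro pt_le) auto
    then show "emeasure ?M {pt n l<..pt n (Suc l)} < \<infinity>" by (simp add: em)
  qed simp
  have meas: "F n \<in> borel_measurable ?M" for n
    unfolding F_def by (intro borel_measurable_sum borel_measurable_integrable int1)
  have int_F: "integral\<^sup>L ?M (F n) = (\<Sum>l\<in>idx n T. f (pt n l) * (G (pt n (Suc l)) - G (pt n l)))" for n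
  proof -
    have "integral\<^sup>L ?M (F n) = (\<Sum>l\<in>idx n T. LINT s|?M. f (pt n l) * indicator {pt n l<..pt n (Suc l)} s)"
      unfolding F_def by (intro Bochner_Integration.integral_sum int1)
    also have "\<dots> = (\<Sum>l\<in>idx n T. f (pt n l) * (G (pt n (Suc l)) - G (pt n l)))"
    proof (rule sum.cong[OF refl])
      fix l assume "l \<in> idx n T"
      then have le: "pt n l \<le> pt n (Suc l)" by (intro pt_le) auto
      have "measure ?M {pt n l<..pt n (Suc l)} = G (pt n (Suc l)) - G (pt n l)"
        by (rule measure_interval_measure_Ioc[OF le G_le G(2)])
      then show "(LINT s|?M. f (pt n l) * indicator {pt n l<..pt n (Suc l)} s) = f (pt n l) * (G (pt n (Suc l)) - G (pt n l))"
        by simp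
    qed
    finally show ?thesis .
  qed
  have F_zero: "F n s = 0" if "s \<le> 0" for n s
    unfolding F_def
  proof (rule sum.neutral, rule ballI)
    fix l assume "l \<in> idx n T"
    then have "0 \<le> pt n l" by (intro pt_nonneg) auto
    then show "f (pt n l) * indicator {pt n l<..pt n (Suc l)} s = 0" using that by simp
  qed
  have "\<forall>\<^sub>F n in sequentially. \<forall>s. \<bar>F n s\<bar> \<le> C * indicator {0<..T + 1} s"
    using mesh_ev[OF zero_less_one, of T] last_ev[of "T + 1"]
  proof eventually_elim
    case (elim n)
    note mesh = elim(1) and last = elim(2)
    show "\<forall>s. \<bar>F n s\<bar> \<le> C * indicator {0<..T + 1} s"
    proof
      fix s
      show "\<bar>F n s\<bar> \<le> C * indicator {0<..T + 1} s"
      proof (cases "0 < s")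
        case False
        then show ?thesis by (simp add: F_zero)
      next
        case s0: True
        show ?thesis
        proof (cases "s \<le> T + 1")
          case True
          then have sl: "s \<le> last (\<pi> n)" using last by simp
          obtain j where j: "Suc j < length (\<pi> n)" "pt n j = last_before \<pi> n s" "pt n j < s" "s \<le> pt n (Suc j)"
            using last_before_obtain[OF s0 sl] by metis
          have "\<bar>F n s\<bar> \<le> C"
            using cell_sum_eq[OF s0 sl j(1,3,4), of "\<lambda>l. f (pt n l)" T] bd[of "pt n j"] pt_nonneg[of j n] j C0
            by (simp add: F_def split: if_splits)
          then show ?thesis using True s0 by simp
        next
          \<comment> \<open>The cells counted start at or before T and are shorter than 1, so none
            of them reaches beyond T + 1.\<close>
          case False
          have "F n s = 0"
            unfolding F_def
          proof (rule sum.neutral, rule ballI)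
            fix l assume "l \<in> idx n T"
            then have "pt n (Suc l) < s" using mesh[rule_format, of l] False by auto
            then show "f (pt n l) * indicator {pt n l<..pt n (Suc l)} s = 0" by simp
          qed
          then show ?thesis using C0 by simp
        qed
      qed
    qed
  qed
  then obtain N where N: "\<And>n s. N \<le> n \<Longrightarrow> \<bar>F n s\<bar> \<le> C * indicator {0<..T + 1} s"
    by (auto simp: eventually_sequentially)
  have lim: "(\<lambda>n. F n s) \<longlonglongrightarrow> indicator {0<..T} s *\<^sub>R f s" for s
  proof (cases "0 < s")
    case False
    then show ?thesis by (simp add: F_zero)
  next
    case s0: True
    have ev: "\<forall>\<^sub>F n in sequentially. F n s = (if last_before \<pi> n s \<le> T then f (last_before \<pi> n s) else 0)"
      using last_ev[of s]
    proof eventually_elim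
      case (elim n)
      then have sl: "s \<le> last (\<pi> n)" by simp
      obtain j where j: "Suc j < length (\<pi> n)" "pt n j = last_before \<pi> n s" "pt n j < s" "s \<le> pt n (Suc j)"
        using last_before_obtain[OF s0 sl] by metis
      show ?case using cell_sum_eq[OF s0 sl j(1,3,4), of "\<lambda>l. f (pt n l)" T] j by (simp add: F_def)
    qed
    have lb: "(\<lambda>n. last_before \<pi> n s) \<longlonglongrightarrow> s" using s0 by (intro last_before_tendsto) simp
    show ?thesis
    proof (cases "s \<le> T")
      case True
      have "filterlim (\<lambda>n. last_before \<pi> n s) (at_left s) sequentially"
      proof (intro filterlim_at[THEN iffD2] conjI lb always_eventually allI)
        fix n show "last_before \<pi> n s \<in> {..<s}" "last_before \<pi> n s \<noteq> s"
          using last_before_in(2)[OF s0, of n] by auto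
      qed
      from filterlim_compose[OF left[OF s0 True] this]
      have "(\<lambda>n. f (last_before \<pi> n s)) \<longlonglongrightarrow> f s" .
      moreover have "\<forall>\<^sub>F n in sequentially. f (last_before \<pi> n s) = F n s"
        using ev
      proof eventually_elim
        case (elim n)
        then show ?case using last_before_in(2)[OF s0, of n] True by simp
      qed
      ultimately have "(\<lambda>n. F n s) \<longlonglongrightarrow> f s" by (rule Lim_transform_eventually)
      then show ?thesis using True s0 by simp
    next
      case False
      then have "\<forall>\<^sub>F n in sequentially. T < last_before \<pi> n s" using order_tendstoD(1)[OF lb, of T] by simp
      then have "\<forall>\<^sub>F n in sequentially. F n s = 0" using ev by eventually_elim simp
      then show ?thesis using False by (simp add: tendsto_eventually)
    qed
  qed
  \<comment> \<open>Measurability of f is not assumed; it is inherited from the step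
    functions.\<close>
  have fm: "(\<lambda>s. indicator {0<..T} s *\<^sub>R f s) \<in> borel_measurable ?M"
    by (rule borel_measurable_LIMSEQ_real[OF lim meas])
  have intw: "integrable ?M (\<lambda>s. C * indicator {0<..T + 1} s)"
    using T by (intro integrable_mult_right integrable_real_indicator) (auto simp: em)
  have lim': "AE s in ?M. (\<lambda>n. F (n + N) s) \<longlonglongrightarrow> indicator {0<..T} s *\<^sub>R f s"
    using lim by (intro AE_I2 LIMSEQ_ignore_initial_segment)
  have bound: "AE s in ?M. norm (F (n + N) s) \<le> C * indicator {0<..T + 1} s" for n
    using N[of "n + N"] by simp
  show "set_integrable ?M {0<..T} f"
    unfolding set_integrable_def
    by (rule integrable_dominated_convergence[OF fm meas intw lim' bound])
  have "(\<lambda>n. integral\<^sup>L ?M (F (n + N))) \<longlonglongrightarrow> (LINT s:{0<..T}|?M. f s)"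
    unfolding set_lebesgue_integral_def
    by (rule integral_dominated_convergence[OF fm meas intw lim' bound])
  then have "(\<lambda>n. integral\<^sup>L ?M (F n)) \<longlonglongrightarrow> (LINT s:{0<..T}|?M. f s)" by (rule LIMSEQ_offset)
  then show "(\<lambda>n. \<Sum>l\<in>idx n T. f (pt n l) * (G (pt n (Suc l)) - G (pt n l))) \<longlonglongrightarrow> (LINT s:{0<..T}|interval_measure G. f s)"
    by (simp only: int_F)
qed

lemma has_LS_integral_tendsto:
  assumes "has_LS_integral f A T I" and T: "0 \<le> T"
    and bd: "\<And>s. s \<in> {0..T} \<Longrightarrow> \<bar>f s\<bar> \<le> C"
    and left: "\<And>s. 0 < s \<Longrightarrow> s \<le> T \<Longrightarrow> (f \<longlongrightarrow> f s) (at_left s)"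
  shows "(\<lambda>n. \<Sum>l\<in>idx n T. f (pt n l) * (A (pt n (Suc l)) - A (pt n l))) \<longlonglongrightarrow> I"
proof -
  obtain g h where g: "mono g" "\<And>s. continuous (at_right s) g" and h: "mono h" "\<And>s. continuous (at_right s) h"
    and A: "\<And>s. 0 \<le> s \<Longrightarrow> A s = g s - h s"
    and I: "I = (LINT s:{0<..T}|interval_measure g. f s) - (LINT s:{0<..T}|interval_measure h. f s)"
    using assms(1) unfolding has_LS_integral_def by blast
  have "(\<lambda>n. (\<Sum>l\<in>idx n T. f (pt n l) * (g (pt n (Suc l)) - g (pt n l))) -
      (\<Sum>l\<in>idx n T. f (pt n l) * (h (pt n (Suc l)) - h (pt n l)))) \<longlonglongrightarrow> I"
    unfolding I by (intro tendsto_diff Stieltjes_sum_tendsto(2)[OF g T bd left] Stieltjes_sum_tendsto(2)[OF h T bd left])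
  moreover have "(\<Sum>l\<in>idx n T. f (pt n l) * (g (pt n (Suc l)) - g (pt n l))) -
      (\<Sum>l\<in>idx n T. f (pt n l) * (h (pt n (Suc l)) - h (pt n l))) =
      (\<Sum>l\<in>idx n T. f (pt n l) * (A (pt n (Suc l)) - A (pt n l)))" for n
    unfolding sum_subtractf[symmetric]
    by (intro sum.cong refl) (simp add: A pt_nonneg algebra_simps)
  ultimately show ?thesis by simp
qed

text \<open>The sums involve A only, so every decomposition of A yields the same value; this makes
  the definite description in \<open>LS_integral\<close> well defined.\<close>

theorem LS_integral_tendsto:
  assumes g: "mono g" "\<And>s. continuous (at_right s) g" and h: "mono h" "\<And>s. continuous (at_right s) h"
    and A: "\<And>s. 0 \<le> s \<Longrightarrow> A s = g s - h s" and T: "0 \<le> T"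
    and bd: "\<And>s. s \<in> {0..T} \<Longrightarrow> \<bar>f s\<bar> \<le> C"
    and left: "\<And>s. 0 < s \<Longrightarrow> s \<le> T \<Longrightarrow> (f \<longlongrightarrow> f s) (at_left s)"
  shows "(\<lambda>n. \<Sum>l\<in>idx n T. f (pt n l) * (A (pt n (Suc l)) - A (pt n l))) \<longlonglongrightarrow> LS_integral f A T"
proof -
  define I where "I = (LINT s:{0<..T}|interval_measure g. f s) - (LINT s:{0<..T}|interval_measure h. f s)"
  have hs: "has_LS_integral f A T I"
    unfolding has_LS_integral_def I_def
    using g h A Stieltjes_sum_tendsto(1)[OF g T bd left] Stieltjes_sum_tendsto(1)[OF h T bd left] by blast
  have "LS_integral f A T = I"
    unfolding LS_integral_def
  proof (rule the_equality, rule hs)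
    fix I' assume "has_LS_integral f A T I'"
    then show "I' = I"
      using LIMSEQ_unique[OF has_LS_integral_tendsto[OF _ T bd left] has_LS_integral_tendsto[OF hs T bd left]] by blast
  qed
  then show ?thesis using has_LS_integral_tendsto[OF hs T bd left] by simp
qed

text \<open>Near t the path is close to x(t-) on the left and to x(t) on the right. Only the cell
  with t in its left-open interval mixes the two sides, and it starts at
  \<open>last_before \<pi> n t\<close>.\<close>

lemma small_increments:
  fixes x :: "real \<Rightarrow> 'a::real_normed_vector"
  assumes x: "cadlag x" and t: "0 \<le> t" and e: "0 < e"
  shows "\<exists>d>0. \<forall>\<^sub>F n in sequentially. \<forall>l. Suc l < length (\<pi> n) \<longrightarrow> \<bar>pt n l - t\<bar> < d \<longrightarrow>
      pt n l \<noteq> last_before \<pi> n t \<or> jump x t = 0 \<longrightarrow> norm (x (pt n (Suc l)) - x (pt n l)) < e"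
proof -
  have "\<forall>\<^sub>F s in at_left t. dist (x s) (left_lim x t) < e / 2"
    using e by (intro tendstoD[OF cadlag_left[OF x t]]) simp
  then obtain a where a: "a < t" "\<And>s. a < s \<Longrightarrow> s < t \<Longrightarrow> dist (x s) (left_lim x t) < e / 2"
    unfolding eventually_at_left_field by blast
  have "\<forall>\<^sub>F s in at_right t. dist (x s) (x t) < e / 2"
    using e by (intro tendstoD[OF cadlag_right[OF x t]]) simp
  then obtain b where b: "t < b" "\<And>s. t < s \<Longrightarrow> s < b \<Longrightarrow> dist (x s) (x t) < e / 2"
    unfolding eventually_at_right_field by blast
  have b': "dist (x s) (x t) < e / 2" if "t \<le> s" "s < b" for s
    using b(2)[of s] that e by (cases "s = t") auto
  \<comment> \<open>A right end exceeds t by less than 2 d: d for the left end and d for the mesh.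
    Hence the factor 1/2 on the right-hand side.\<close>
  define d where "d = min (t - a) ((b - t) / 2)"
  have d: "0 < d" using a b by (simp add: d_def)
  have near: "dist u v < e" if "dist u w < e / 2" "dist v w < e / 2" for u v w :: 'a
    using dist_triangle_half_l[OF that] .
  have "\<forall>\<^sub>F n in sequentially. \<forall>l. Suc l < length (\<pi> n) \<longrightarrow> \<bar>pt n l - t\<bar> < d \<longrightarrow>
      pt n l \<noteq> last_before \<pi> n t \<or> jump x t = 0 \<longrightarrow> norm (x (pt n (Suc l)) - x (pt n l)) < e"
    using mesh_ev[OF d, of "t + d"]
  proof eventually_elim
    case (elim n)
    show ?case
    proof (intro allI impI)
      fix l assume l: "Suc l < length (\<pi> n)" and ld: "\<bar>pt n l - t\<bar> < d"
        and nj: "pt n l \<noteq> last_before \<pi> n t \<or> jump x t = 0"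
      have d_le: "d \<le> t - a" "d \<le> (b - t) / 2" unfolding d_def by (rule min.cobounded1, rule min.cobounded2)
      have ld': "pt n l < t + d" "t - d < pt n l" using ld by linarith+
      have "pt n (Suc l) - pt n l < d" using elim l ld' by auto
      then have p': "pt n (Suc l) < b" using ld' d_le(2) by (simp add: field_simps)
      have p: "a < pt n l" using ld' d_le(1) by linarith
      have pp: "pt n l < pt n (Suc l)" using l by (intro pt_less) auto
      have "dist (x (pt n (Suc l))) (x (pt n l)) < e"
      proof (cases "t \<le> pt n l")
        case True
        then show ?thesis using pp p' by (intro near[of _ "x t"] b') auto
      next
        case False
        show ?thesis
        proof (cases "pt n (Suc l) < t")
          case True
          then show ?thesis using pp p by (intro near[of _ "left_lim x t"] a) auto
        next
          case False': False
          then have "pt n l = last_before \<pi> n t"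
            using last_before_cell[OF l, of t] False by simp
          then have "left_lim x t = x t" using nj by (simp add: jump_def)
          then have "dist (x (pt n l)) (x t) < e / 2" using a(2)[of "pt n l"] p False by simp
          moreover have "dist (x (pt n (Suc l))) (x t) < e / 2" using False' p' by (intro b') auto
          ultimately show ?thesis by (rule near[rotated])
        qed
      qed
      then show "norm (x (pt n (Suc l)) - x (pt n l)) < e" by (simp add: dist_norm)
    qed
  qed
  with d show ?thesis by blast
qed

section \<open>Quadratic sums under J1 convergence\<close>

definition outer :: "real ^ 'm \<Rightarrow> real ^ 'm ^ 'm" where
  "outer v = (\<chi> j k. v $ j * v $ k)"

lemma outer_0 [simp]: "outer 0 = 0"
  by (simp add: outer_def vec_eq_iff)

lemma outer_small:
  assumes "0 < e"
  shows "\<exists>d>0. \<forall>v :: real ^ 'm::finite. norm v < d \<longrightarrow> norm (outer v) < e"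
proof -
  have "((outer :: real ^ 'm \<Rightarrow> _) \<longlongrightarrow> outer 0) (nhds 0)"
    unfolding outer_def by (intro tendsto_intros filterlim_ident)
  then have "\<forall>\<^sub>F v in nhds (0 :: real ^ 'm). dist (outer v) (outer 0) < e"
    using assms by (rule tendstoD)
  then show ?thesis by (auto simp: eventually_nhds_metric)
qed

lemma qv_sum_eq:
  "qv_sum \<pi> x n t = (\<Sum>i\<in>idx n (max 0 t). outer (x (pt n (Suc i)) - x (pt n i)))"
  by (simp add: qv_sum_def outer_def)

lemma qv_sum_cell:
  assumes "0 \<le> s" "Suc j < length (\<pi> n)" "pt n j \<le> s" "s < pt n (Suc j)"
  shows "qv_sum \<pi> x n s = (\<Sum>i\<le>j. outer (x (pt n (Suc i)) - x (pt n i)))"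
  unfolding qv_sum_eq using assms idx_eq[OF assms(2-4)] by simp

text \<open>After the time change the sums converge uniformly, so a jump of q at t forces a jump of
  fixed size of the sums at \<theta> n t. Such a jump occurs at a partition point with a large
  increment of x over the next cell, and near t the only candidate is
  \<open>last_before \<pi> n t\<close>, and only if x jumps at t.\<close>

lemma J1_jump_time:
  fixes x :: "real \<Rightarrow> real ^ 'm::finite"
  assumes x: "cadlag x" and q: "cadlag q"
    and \<theta>: "\<And>n. strict_mono_on {0..} (\<theta> n)" "\<And>n. \<theta> n ` {0..} = {0..}"
    and \<theta>_lim: "uniform_limit {0..} \<theta> (\<lambda>s. s) sequentially"
    and lim: "\<And>T. uniform_limit {0..T} (\<lambda>n s. qv_sum \<pi> x n (\<theta> n s)) q sequentially"
    and t: "0 \<le> t" and jq: "left_lim q t \<noteq> q t"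
  shows "jump x t \<noteq> 0" "\<forall>\<^sub>F n in sequentially. \<theta> n t = last_before \<pi> n t"
proof -
  have t0: "0 < t" using jq t left_lim_0[OF q] by (cases "t = 0") auto
  define \<eta> where "\<eta> = dist (q t) (left_lim q t)"
  have \<eta>: "0 < \<eta>" using jq by (simp add: \<eta>_def)
  have "\<forall>\<^sub>F r in at_left t. dist (q r) (left_lim q t) < \<eta> / 4"
    using \<eta> by (intro tendstoD[OF cadlag_left[OF q t]]) simp
  then obtain a' where a': "a' < t" "\<And>r. a' < r \<Longrightarrow> r < t \<Longrightarrow> dist (q r) (left_lim q t) < \<eta> / 4"
    unfolding eventually_at_left_field by blast
  define a where "a = max a' 0"
  have a: "0 \<le> a" "a < t" "\<And>r. a < r \<Longrightarrow> r < t \<Longrightarrow> dist (q r) (left_lim q t) < \<eta> / 4"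
    using a' t0 by (auto simp: a_def)
  have ev1: "\<forall>\<^sub>F n in sequentially. \<forall>s\<in>{0..t}. dist (qv_sum \<pi> x n (\<theta> n s)) (q s) < \<eta> / 4"
    using \<eta> by (intro uniform_limitD[OF lim]) simp
  have \<theta>t: "(\<lambda>n. \<theta> n t) \<longlonglongrightarrow> t" using t by (intro tendsto_uniform_limitI[OF \<theta>_lim]) simp
  have \<theta>t1: "\<forall>\<^sub>F n in sequentially. \<theta> n t < t + 1" using \<theta>t by (rule order_tendstoD) simp
  have ev: "\<forall>\<^sub>F n in sequentially. \<exists>j. Suc j < length (\<pi> n) \<and> pt n j = \<theta> n t \<and>
      \<eta> / 4 \<le> norm (outer (x (pt n (Suc j)) - x (pt n j)))"
    using ev1 \<theta>t1 last_ev[of "t + 1"]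
  proof eventually_elim
    case (elim n)
    define w where "w = \<theta> n t"
    have mono: "\<theta> n r < \<theta> n s" if "0 \<le> r" "r < s" for r s
      using strict_mono_onD[OF \<theta>(1)] that by simp
    have w0: "\<theta> n a < w" unfolding w_def using a by (intro mono) auto
    have "\<theta> n a \<in> {0..}" using \<theta>(2)[of n] a by blast
    then have wa: "0 \<le> \<theta> n a" by simp
    have wp: "0 \<le> w" using w0 wa by simp
    have wl: "w < last (\<pi> n)" using elim by (simp add: w_def)
    \<comment> \<open>Of the jump size \<eta>, three errors below \<eta>/4 are lost: two from the
      uniform convergence and one from the left limit of q.\<close>
    have gap: "\<eta> / 4 \<le> norm (qv_sum \<pi> x n w - qv_sum \<pi> x n v)" if v: "\<theta> n a < v" "v < w" for v
    proof -
      have "v \<in> \<theta> n ` {0..}" using \<theta>(2)[of n] v wa by simp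
      then obtain r where r: "0 \<le> r" "v = \<theta> n r" by auto
      have "a < r"
      proof (rule ccontr)
        assume "\<not> a < r"
        then have "\<theta> n r \<le> \<theta> n a" using mono[of r a] r by (cases "r = a") auto
        then show False using v r by simp
      qed
      moreover have "r < t"
      proof (rule ccontr)
        assume "\<not> r < t"
        then have "\<theta> n t \<le> \<theta> n r" using mono[of t r] t by (cases "r = t") auto
        then show False using v r by (simp add: w_def)
      qed
      ultimately have 1: "dist (q r) (left_lim q t) < \<eta> / 4" and "r \<in> {0..t}" using a r by auto
      then have 2: "dist (qv_sum \<pi> x n v) (q r) < \<eta> / 4" using elim(1) r by blast
      have 3: "dist (qv_sum \<pi> x n w) (q t) < \<eta> / 4" using elim(1) t unfolding w_def by simp
      have "\<eta> \<le> dist (q t) (qv_sum \<pi> x n w) + (dist (qv_sum \<pi> x n w) (qv_sum \<pi> x n v) +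
          (dist (qv_sum \<pi> x n v) (q r) + dist (q r) (left_lim q t)))"
        unfolding \<eta>_def
        using dist_triangle[of "q t" "left_lim q t" "qv_sum \<pi> x n w"]
          dist_triangle[of "qv_sum \<pi> x n w" "left_lim q t" "qv_sum \<pi> x n v"]
          dist_triangle[of "qv_sum \<pi> x n v" "left_lim q t" "q r"] by linarith
      then show ?thesis using 1 2 3 by (simp add: dist_norm dist_commute norm_minus_commute)
    qed
    obtain j where j: "Suc j < length (\<pi> n)" "pt n j \<le> w" "w < pt n (Suc j)" using ex_cell[OF wp wl] by metis
    \<comment> \<open>Otherwise some v just before w would lie in the same cell, where the sum takes
      the same value.\<close>
    have pj: "pt n j = w"
    proof (rule ccontr)
      assume "pt n j \<noteq> w"
      define v where "v = (max (pt n j) (\<theta> n a) + w) / 2"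
      have v: "\<theta> n a < v" "v < w" "pt n j \<le> v" using j w0 \<open>pt n j \<noteq> w\<close> by (auto simp: v_def max_def)
      have "qv_sum \<pi> x n w = qv_sum \<pi> x n v"
        using j v wp wa by (simp add: qv_sum_cell[of _ j])
      then show False using gap[OF v(1,2)] \<eta> by simp
    qed
    have "j \<noteq> 0"
    proof
      assume "j = 0"
      then show False using pj w0 wa by simp
    qed
    then obtain i where i: "j = Suc i" by (cases j) auto
    \<comment> \<open>A time of the preceding cell, late enough for \<open>gap\<close>; the sums at
      v and w then differ by the single term of index j.\<close>
    define v where "v = (max (pt n i) (\<theta> n a) + w) / 2"
    have pi: "pt n i < w" using pt_less[of i j n] j i pj by simp
    have v: "\<theta> n a < v" "v < w" "pt n i \<le> v" using w0 pi by (auto simp: v_def max_def)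
    have "qv_sum \<pi> x n w - qv_sum \<pi> x n v = outer (x (pt n (Suc j)) - x (pt n j))"
      using qv_sum_cell[OF wp j, of x] qv_sum_cell[of v i n x] v wa j i pj by simp
    with gap[OF v(1,2)] show ?case using j(1) pj by (auto simp: w_def)
  qed
  obtain \<epsilon> where \<epsilon>: "0 < \<epsilon>" "\<And>v :: real ^ 'm. norm v < \<epsilon> \<Longrightarrow> norm (outer v) < \<eta> / 4"
    using outer_small[of "\<eta> / 4"] \<eta> by auto
  from small_increments[OF x t \<epsilon>(1)] obtain d where d: "0 < d" and
    dn: "\<forall>\<^sub>F n in sequentially. \<forall>l. Suc l < length (\<pi> n) \<longrightarrow> \<bar>pt n l - t\<bar> < d \<longrightarrow>
      pt n l \<noteq> last_before \<pi> n t \<or> jump x t = 0 \<longrightarrow> norm (x (pt n (Suc l)) - x (pt n l)) < \<epsilon>"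
    by blast
  have both: "\<forall>\<^sub>F n in sequentially. \<theta> n t = last_before \<pi> n t \<and> jump x t \<noteq> 0"
    using ev dn tendstoD[OF \<theta>t d]
  proof eventually_elim
    case (elim n)
    then obtain j where j: "Suc j < length (\<pi> n)" "pt n j = \<theta> n t"
      "\<eta> / 4 \<le> norm (outer (x (pt n (Suc j)) - x (pt n j)))" by blast
    have "\<not> norm (x (pt n (Suc j)) - x (pt n j)) < \<epsilon>" using \<epsilon>(2) j(3) by (meson not_le)
    then show ?case using elim(2,3) j(1,2) by (auto simp: dist_real_def)
  qed
  then show "\<forall>\<^sub>F n in sequentially. \<theta> n t = last_before \<pi> n t" by eventually_elim simp
  from both show "jump x t \<noteq> 0" by (auto simp: eventually_sequentially)
qed

text \<open>The times \<tau> n are pulled back to s n by the time changes, so the claim reduces to q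
  (s n) tending to q t. If q jumps at t, it is needed that s n \<ge> t eventually; as \<theta> n t
  is then \<open>last_before \<pi> n t\<close>, this is the condition on \<tau> n.\<close>

lemma J1_qv_tendsto:
  fixes x :: "real \<Rightarrow> real ^ 'm::finite"
  assumes x: "cadlag x" and q: "cadlag q" and J1: "J1_tendsto (qv_sum \<pi> x) q"
    and t: "0 \<le> t" and \<tau>: "\<tau> \<longlonglongrightarrow> t" "\<forall>\<^sub>F n in sequentially. 0 \<le> \<tau> n"
    and or: "(\<forall>\<^sub>F n in sequentially. last_before \<pi> n t \<le> \<tau> n) \<or> jump x t = 0"
  shows "(\<lambda>n. qv_sum \<pi> x n (\<tau> n)) \<longlonglongrightarrow> q t"
    and "jump x t = 0 \<Longrightarrow> left_lim q t = q t"
proof -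
  obtain \<theta> where \<theta>: "\<And>n. strict_mono_on {0..} (\<theta> n)" "\<And>n. \<theta> n ` {0..} = {0..}"
    and \<theta>_lim: "uniform_limit {0..} \<theta> (\<lambda>s. s) sequentially"
    and lim: "\<And>T. uniform_limit {0..T} (\<lambda>n s. qv_sum \<pi> x n (\<theta> n s)) q sequentially"
    using J1 unfolding J1_tendsto_def by blast
  note jt = J1_jump_time[OF x q \<theta> \<theta>_lim lim t]
  show "jump x t = 0 \<Longrightarrow> left_lim q t = q t" using jt(1) by blast
  define s where "s n = (if 0 \<le> \<tau> n then (SOME r. 0 \<le> r \<and> \<theta> n r = \<tau> n) else 0)" for n
  have s: "0 \<le> s n \<and> \<theta> n (s n) = \<tau> n" if "0 \<le> \<tau> n" for n
  proof -
    have "\<tau> n \<in> \<theta> n ` {0..}" using \<theta>(2)[of n] that by simp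
    then have "\<exists>r. 0 \<le> r \<and> \<theta> n r = \<tau> n" by auto
    from someI_ex[OF this] show ?thesis using that by (simp add: s_def)
  qed
  have s_lim: "s \<longlonglongrightarrow> t"
  proof (rule tendstoI)
    fix e :: real assume "0 < e"
    then have e2: "0 < e / 2" by simp
    show "\<forall>\<^sub>F n in sequentially. dist (s n) t < e"
      using uniform_limitD[OF \<theta>_lim e2] tendstoD[OF \<tau>(1) e2] \<tau>(2)
    proof eventually_elim
      case (elim n)
      have "s n \<in> {0..}" using s[OF elim(3)] by simp
      then have "dist (\<theta> n (s n)) (s n) < e / 2" using elim(1) by blast
      then show ?case using elim(2) s[OF elim(3)] unfolding dist_real_def by linarith
    qed
  qed
  have q_lim: "(\<lambda>n. q (s n)) \<longlonglongrightarrow> q t"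
  proof (rule tendstoI)
    fix e :: real assume e: "0 < e"
    have "\<forall>\<^sub>F s in at_right t. dist (q s) (q t) < e"
      using e by (intro tendstoD[OF cadlag_right[OF q t]])
    then obtain b where b: "t < b" "\<And>s. t < s \<Longrightarrow> s < b \<Longrightarrow> dist (q s) (q t) < e"
      unfolding eventually_at_right_field by blast
    have sb: "\<forall>\<^sub>F n in sequentially. s n < b" using s_lim b(1) by (rule order_tendstoD)
    show "\<forall>\<^sub>F n in sequentially. dist (q (s n)) (q t) < e"
    proof (cases "left_lim q t = q t")
      case True
      have "\<forall>\<^sub>F s in at_left t. dist (q s) (q t) < e"
        using e tendstoD[OF cadlag_left[OF q t]] True by simp
      then obtain a where a: "a < t" "\<And>s. a < s \<Longrightarrow> s < t \<Longrightarrow> dist (q s) (q t) < e"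
        unfolding eventually_at_left_field by blast
      have "\<forall>\<^sub>F n in sequentially. a < s n" using s_lim a(1) by (rule order_tendstoD)
      then show ?thesis using sb
      proof eventually_elim
        case (elim n)
        then show ?case using a(2)[of "s n"] b(2)[of "s n"] e by (cases "s n" t rule: linorder_cases) auto
      qed
    next
      case False
      have "\<forall>\<^sub>F n in sequentially. last_before \<pi> n t \<le> \<tau> n" using or jt(1)[OF False] by blast
      then show ?thesis using sb jt(2)[OF False] \<tau>(2)
      proof eventually_elim
        case (elim n)
        have "t \<le> s n"
        proof (rule ccontr)
          assume "\<not> t \<le> s n"
          then have "\<theta> n (s n) < \<theta> n t" using strict_mono_onD[OF \<theta>(1), of "s n" t n] s[OF elim(4)] t by simp
          then show False using elim(1,3) s[OF elim(4)] by simp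
        qed
        then show ?case using b(2)[of "s n"] elim(2) e by (cases "s n = t") auto
      qed
    qed
  qed
  have "(\<lambda>n. qv_sum \<pi> x n (\<tau> n) - q (s n)) \<longlonglongrightarrow> 0"
  proof (rule tendstoI)
    fix e :: real assume "0 < e"
    have "\<forall>\<^sub>F n in sequentially. s n < t + 1" using s_lim by (rule order_tendstoD) simp
    then show "\<forall>\<^sub>F n in sequentially. dist (qv_sum \<pi> x n (\<tau> n) - q (s n)) 0 < e"
      using uniform_limitD[OF lim[of "t + 1"] \<open>0 < e\<close>] \<tau>(2)
    proof eventually_elim
      case (elim n)
      have "s n \<in> {0..t + 1}" using elim(1) s[OF elim(3)] by simp
      then have "dist (qv_sum \<pi> x n (\<theta> n (s n))) (q (s n)) < e" using elim(2) by blast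
      then show ?case using s[OF elim(3)] by (simp add: dist_norm)
    qed
  qed
  from tendsto_add[OF this q_lim] show "(\<lambda>n. qv_sum \<pi> x n (\<tau> n)) \<longlonglongrightarrow> q t" by simp
qed

text \<open>A fixed time t is never before \<open>last_before \<pi> n t\<close>, so the sums
  converge pointwise at every t. This makes the J1 limit unique and the definite description
  meaningful.\<close>

lemma quad_var_J1:
  fixes x :: "real \<Rightarrow> real ^ 'm::finite"
  assumes "x \<in> Q_paths \<pi>"
  shows "cadlag (quad_var \<pi> x) \<and> J1_tendsto (qv_sum \<pi> x) (quad_var \<pi> x)"
proof -
  obtain q where x: "cadlag x" and q: "cadlag q" "J1_tendsto (qv_sum \<pi> x) q"
    using assms by (auto simp: Q_paths_def)
  have lim: "(\<lambda>n. qv_sum \<pi> x n t) \<longlonglongrightarrow> r t" if "cadlag r" "J1_tendsto (qv_sum \<pi> x) r" "0 \<le> t" for r t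
    using that last_before_le by (intro J1_qv_tendsto[OF x that]) auto
  have "quad_var \<pi> x = q"
    unfolding quad_var_def
  proof (rule the_equality)
    show "cadlag q \<and> J1_tendsto (qv_sum \<pi> x) q" using q by simp
    fix r assume r: "cadlag r \<and> J1_tendsto (qv_sum \<pi> x) r"
    have eq: "r t = q t" if "0 \<le> t" for t
      using LIMSEQ_unique[OF lim lim] r q that by blast
    show "r = q"
    proof
      fix t show "r t = q t"
        using eq[of t] eq[of 0] cadlag_neg[of r t] cadlag_neg[of q t] r q by (cases "0 \<le> t") auto
    qed
  qed
  then show ?thesis using q by simp
qed

end

subsection \<open>Limits of covariation sums\<close>


lemma cadlag_right_seq:
  fixes x :: "real \<Rightarrow> 'a::topological_space"
  assumes "cadlag x" "0 \<le> t" "\<sigma> \<longlonglongrightarrow> t" "\<forall>\<^sub>F n in sequentially. t \<le> \<sigma> n"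
  shows "(\<lambda>n. x (\<sigma> n)) \<longlonglongrightarrow> x t"
proof (rule topological_tendstoI)
  fix S assume S: "open S" "x t \<in> S"
  have "\<forall>\<^sub>F s in at_right t. x s \<in> S" using cadlag_right[OF assms(1,2)] S by (rule topological_tendstoD)
  then obtain b where b: "t < b" "\<And>s. t < s \<Longrightarrow> s < b \<Longrightarrow> x s \<in> S"
    unfolding eventually_at_right_field by blast
  have "\<forall>\<^sub>F n in sequentially. \<sigma> n < b" using assms(3) b(1) by (rule order_tendstoD)
  then show "\<forall>\<^sub>F n in sequentially. x (\<sigma> n) \<in> S"
    using assms(4)
  proof eventually_elim
    case (elim n)
    then show ?case using b(2)[of "\<sigma> n"] S(2) by (cases "\<sigma> n = t") auto
  qed
qed

lemma cadlag_left_seq: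
  fixes x :: "real \<Rightarrow> 'a::t2_space"
  assumes "cadlag x" "0 \<le> t" "\<sigma> \<longlonglongrightarrow> t" "\<forall>\<^sub>F n in sequentially. \<sigma> n < t"
  shows "(\<lambda>n. x (\<sigma> n)) \<longlonglongrightarrow> left_lim x t"
proof (rule filterlim_compose[OF cadlag_left[OF assms(1,2)]])
  show "filterlim \<sigma> (at_left t) sequentially"
    using assms(3,4) by (auto simp: filterlim_at elim: eventually_mono)
qed

lemma left_lim_in_cball:
  fixes x :: "real \<Rightarrow> 'a::real_normed_vector"
  assumes "cadlag x" "0 \<le> s" "a < s" "\<And>r. a < r \<Longrightarrow> r < s \<Longrightarrow> dist (x r) c \<le> e"
  shows "dist (left_lim x s) c \<le> e"
proof (rule tendsto_upperbound)
  show "((\<lambda>r. dist (x r) c) \<longlongrightarrow> dist (left_lim x s) c) (at_left s)"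
    by (intro tendsto_intros cadlag_left assms)
  show "\<forall>\<^sub>F r in at_left s. dist (x r) c \<le> e"
    unfolding eventually_at_left_field using assms by (intro exI[of _ a]) auto
qed simp

text \<open>For s just after t both x(s) and x(s-) are close to x(t), whatever the jump at t
  itself.\<close>

lemma jump_tendsto_0_right:
  fixes x :: "real \<Rightarrow> 'a::real_normed_vector"
  assumes x: "cadlag x" and t: "0 \<le> t"
  shows "(jump x \<longlongrightarrow> 0) (at_right t)"
proof (rule tendstoI)
  fix e :: real assume "0 < e"
  then have "\<forall>\<^sub>F s in at_right t. dist (x s) (x t) < e / 2"
    by (intro tendstoD[OF cadlag_right[OF x t]]) simp
  then obtain b where b: "t < b" "\<And>s. t < s \<Longrightarrow> s < b \<Longrightarrow> dist (x s) (x t) < e / 2"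
    unfolding eventually_at_right_field by blast
  have "dist (jump x s) 0 < e" if "t < s" "s < b" for s
  proof -
    have "dist (left_lim x s) (x t) \<le> e / 2"
      using that t by (intro left_lim_in_cball[OF x _ that(1)] less_imp_le b) auto
    moreover have "dist (x s) (x t) < e / 2" using b(2) that by blast
    moreover have "dist (x s) (left_lim x s) \<le> dist (x s) (x t) + dist (left_lim x s) (x t)"
      by (rule dist_triangle2)
    ultimately show ?thesis by (simp add: jump_def dist_norm)
  qed
  then show "\<forall>\<^sub>F s in at_right t. dist (jump x s) 0 < e"
    unfolding eventually_at_right_field using b(1) by blast
qed

lemma jump_tendsto_0_left:
  fixes x :: "real \<Rightarrow> 'a::real_normed_vector"
  assumes x: "cadlag x" and t: "0 < t"
  shows "(jump x \<longlongrightarrow> 0) (at_left t)"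
proof (rule tendstoI)
  fix e :: real assume "0 < e"
  then have "\<forall>\<^sub>F s in at_left t. dist (x s) (left_lim x t) < e / 2"
    using t by (intro tendstoD[OF cadlag_left[OF x]]) simp_all
  then obtain a where a: "a < t" "\<And>s. a < s \<Longrightarrow> s < t \<Longrightarrow> dist (x s) (left_lim x t) < e / 2"
    unfolding eventually_at_left_field by blast
  have "dist (jump x s) 0 < e" if "max a 0 < s" "s < t" for s
  proof -
    have "dist (left_lim x s) (left_lim x t) \<le> e / 2"
      using that t by (intro left_lim_in_cball[OF x, of _ a] less_imp_le a) auto
    moreover have "dist (x s) (left_lim x t) < e / 2" using a(2) that by simp
    moreover have "dist (x s) (left_lim x s) \<le> dist (x s) (left_lim x t) + dist (left_lim x s) (left_lim x t)"
      by (rule dist_triangle2)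
    ultimately show ?thesis by (simp add: jump_def dist_norm)
  qed
  then show "\<forall>\<^sub>F s in at_left t. dist (jump x s) 0 < e"
    unfolding eventually_at_left_field using a(1) t by (intro exI[of _ "max a 0"]) auto
qed

text \<open>Only a bound on p is asked for: beyond \<open>last_before\<close> the integrands need
  not converge.\<close>

lemma inner_tendsto_0:
  fixes e :: "'b \<Rightarrow> 'a::real_inner"
  assumes "(e \<longlongrightarrow> 0) F" "\<forall>\<^sub>F n in F. norm (p n) \<le> C"
  shows "((\<lambda>n. p n \<bullet> e n) \<longlongrightarrow> 0) F"
proof (rule Lim_null_comparison)
  show "\<forall>\<^sub>F n in F. norm (p n \<bullet> e n) \<le> C * norm (e n)"
    using assms(2)
  proof eventually_elim
    case (elim n)
    have "norm (p n \<bullet> e n) \<le> norm (p n) * norm (e n)" by (simp add: Cauchy_Schwarz_ineq2)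
    also have "\<dots> \<le> C * norm (e n)" using elim by (intro mult_right_mono) auto
    finally show ?case .
  qed
  show "((\<lambda>n. C * norm (e n)) \<longlongrightarrow> 0) F"
    using tendsto_mult_right_zero[OF tendsto_norm_zero[OF assms(1)], of C] by simp
qed

text \<open>\<open>interval_measure\<close> is used with integrators that are monotone and
  right-continuous on all of \<real>; the constant continuation to the negative half-line provides
  this.\<close>

lemma cadlag_mono_extend:
  fixes A :: "real \<Rightarrow> real"
  assumes A: "cadlag A" and mono: "\<And>r s. 0 \<le> r \<Longrightarrow> r \<le> s \<Longrightarrow> A r \<le> A s"
  shows "mono A" "continuous (at_right s) A"
proof -
  have eq: "A r = A (max 0 r)" for r using cadlag_neg[OF A, of r] by (cases "r < 0") auto
  show "mono A"
  proof (rule monoI)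
    fix r s :: real assume "r \<le> s"
    then have "A (max 0 r) \<le> A (max 0 s)" by (intro mono) auto
    then show "A r \<le> A s" using eq by metis
  qed
  show "continuous (at_right s) A"
  proof (cases "0 \<le> s")
    case True
    then show ?thesis using cadlag_right[OF A] by (simp add: continuous_within)
  next
    case False
    have "\<forall>\<^sub>F r in at_right s. A r = A s"
      unfolding eventually_at_right_field using False cadlag_neg[OF A] by (intro exI[of _ 0]) auto
    then show ?thesis by (simp add: continuous_within tendsto_eventually)
  qed
qed

section \<open>Integrands and quadratic variation on \<Omega>\<close>

locale generic_Q = generic_paths \<pi> \<Omega> for \<pi> and \<Omega> :: "(real \<Rightarrow> real ^ 'm::finite) set" +
  assumes QV: "\<Omega> \<subseteq> Q_paths \<pi>"
begin

text \<open>Local boundedness concerns stopped step paths. Strict causality moves the bound to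
  left-stopped step paths, and 1(c) along \<open>last_before\<close> moves it to x.\<close>

lemma integrand_bounded:
  assumes int: "integrand \<phi>" and x: "x \<in> \<Omega>" and T: "0 \<le> T"
  shows "\<exists>C\<ge>0. (\<forall>\<^sub>F n in sequentially. \<forall>r\<in>{0..T}. norm (\<phi> r (stop_left (step n x) r)) \<le> C) \<and>
    (\<forall>s\<in>{0..T}. norm (\<phi> s (stop_left x s)) \<le> C)"
proof -
  have lb: "locally_bounded \<pi> \<Omega> \<phi>" and sc: "strictly_causal \<Omega> \<phi>" and lc: "left_continuous \<pi> \<Omega> \<phi>"
    using int by (auto simp: integrand_def)
  obtain n0 C where n0: "\<And>n. n0 \<le> n \<Longrightarrow> stop (step n x) T \<in> \<Omega>"
    and C: "\<And>n t. n0 \<le> n \<Longrightarrow> t \<in> {0..T} \<Longrightarrow> norm (\<phi> t (stop (step n x) t)) \<le> C"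
    using lb[unfolded locally_bounded_def, rule_format, OF x T] by metis
  have bd: "norm (\<phi> r (stop_left (step n x) r)) \<le> C" if "n0 \<le> n" "r \<in> {0..T}" for n r
  proof -
    have "\<phi> r (stop (stop (step n x) T) r) = \<phi> r (stop_left (stop (step n x) T) r)"
      using sc[unfolded strictly_causal_def, rule_format, OF n0[OF that(1)], of r] that(2) by fastforce
    moreover have "stop (stop (step n x) T) r = stop (step n x) r" using that(2) by (simp add: min_absorb2)
    moreover have "stop_left (stop (step n x) T) r = stop_left (step n x) r" using that(2) by (simp add: stop_left_stop)
    ultimately have "\<phi> r (stop_left (step n x) r) = \<phi> r (stop (step n x) r)" by simp
    then show ?thesis using C[OF that] by simp
  qed
  have "0 \<le> C" using order_trans[OF norm_ge_zero bd[of n0 0]] T by simp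
  moreover have "\<forall>\<^sub>F n in sequentially. \<forall>r\<in>{0..T}. norm (\<phi> r (stop_left (step n x) r)) \<le> C"
    unfolding eventually_sequentially using bd by blast
  moreover have "norm (\<phi> s (stop_left x s)) \<le> C" if s: "s \<in> {0..T}" for s
  proof -
    have s0: "0 \<le> s" using s by simp
    have "\<forall>\<^sub>F n in sequentially. 0 \<le> last_before \<pi> n s \<and> last_before \<pi> n s \<le> last_before \<pi> n s"
      by (simp add: last_before_nonneg)
    then have "(\<lambda>n. \<phi> (last_before \<pi> n s) (stop_left (step n x) (last_before \<pi> n s))) \<longlonglongrightarrow> \<phi> s (stop_left x s)"
      using lc x s0 last_before_tendsto[OF s0] unfolding left_continuous_def by blast
    then have "(\<lambda>n. norm (\<phi> (last_before \<pi> n s) (stop_left (step n x) (last_before \<pi> n s)))) \<longlonglongrightarrow> norm (\<phi> s (stop_left x s))"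
      by (rule tendsto_norm)
    moreover have "\<forall>\<^sub>F n in sequentially. norm (\<phi> (last_before \<pi> n s) (stop_left (step n x) (last_before \<pi> n s))) \<le> C"
      using eventually_ge_at_top[of n0]
    proof eventually_elim
      case (elim n)
      have "last_before \<pi> n s \<in> {0..T}" using last_before_nonneg last_before_le[OF s0, of n] s by auto
      then show ?case by (rule bd[OF elim])
    qed
    ultimately show ?thesis by (rule tendsto_upperbound) simp
  qed
  ultimately show ?thesis by blast
qed

lemma integrand_left_seq:
  assumes "integrand \<phi>" "x \<in> \<Omega>" "0 \<le> t" "\<tau> \<longlonglongrightarrow> t" "\<forall>\<^sub>F n in sequentially. 0 \<le> \<tau> n \<and> \<tau> n \<le> last_before \<pi> n t"
  shows "(\<lambda>n. \<phi> (\<tau> n) (stop_left (step n x) (\<tau> n))) \<longlonglongrightarrow> \<phi> t (stop_left x t)"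
  using assms unfolding integrand_def left_continuous_def by blast

lemma integrand_left:
  assumes "integrand \<phi>" "x \<in> \<Omega>" "0 < t"
  shows "((\<lambda>s. \<phi> s (stop_left x s)) \<longlongrightarrow> \<phi> t (stop_left x t)) (at_left t)"
proof -
  have "((\<lambda>s. \<phi> s (stop_left x s)) \<longlongrightarrow> \<phi> t (stop_left x t)) (at t within {0..t})"
    using assms unfolding integrand_def left_continuous_def by (meson less_imp_le)
  then show ?thesis using at_within_Icc_at_left[OF assms(3)] by simp
qed

lemma mem_Q: "x \<in> \<Omega> \<Longrightarrow> x \<in> Q_paths \<pi>"
  using QV by blast

lemma cadlag_quad_var: "x \<in> \<Omega> \<Longrightarrow> cadlag (quad_var \<pi> x)"
  using quad_var_J1[OF mem_Q] by blast

lemma qv_tendsto: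
  assumes "x \<in> \<Omega>" "0 \<le> t" "\<tau> \<longlonglongrightarrow> t" "\<forall>\<^sub>F n in sequentially. 0 \<le> \<tau> n"
    "(\<forall>\<^sub>F n in sequentially. last_before \<pi> n t \<le> \<tau> n) \<or> jump x t = 0"
  shows "(\<lambda>n. qv_sum \<pi> x n (\<tau> n)) \<longlonglongrightarrow> quad_var \<pi> x t"
  using J1_qv_tendsto(1)[OF cadlag_mem[OF assms(1)]] quad_var_J1[OF mem_Q[OF assms(1)]] assms(2-) by blast

lemma qv_left_lim:
  assumes x: "x \<in> \<Omega>" and t: "0 \<le> t" and j: "jump x t = 0"
  shows "left_lim (quad_var \<pi> x) t = quad_var \<pi> x t"
proof -
  have nn: "\<forall>\<^sub>F n in sequentially. 0 \<le> last_before \<pi> n t" by (simp add: last_before_nonneg)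
  have J1: "cadlag (quad_var \<pi> x)" "J1_tendsto (qv_sum \<pi> x) (quad_var \<pi> x)"
    using quad_var_J1[OF mem_Q[OF x]] by blast+
  show ?thesis
    by (rule J1_qv_tendsto(2)[OF cadlag_mem[OF x] J1 t last_before_tendsto[OF t] nn disjI2[OF j] j])
qed

text \<open>The quadratic variation of x_i + x_j, expanded; for i = j it is 4 [x_i, x_i]. Unlike
  [x_i, x_j] it is a limit of sums of nonnegative terms.\<close>

definition polar :: "(real \<Rightarrow> real ^ 'm) \<Rightarrow> 'm \<Rightarrow> 'm \<Rightarrow> real \<Rightarrow> real" where
  "polar x i j s = quad_var \<pi> x s $ i $ i + 2 * quad_var \<pi> x s $ i $ j + quad_var \<pi> x s $ j $ j"

abbreviation polar_term :: "(real \<Rightarrow> real ^ 'm) \<Rightarrow> 'm \<Rightarrow> 'm \<Rightarrow> nat \<Rightarrow> nat \<Rightarrow> real" where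
  "polar_term x i j n l \<equiv> ((x (pt n (Suc l)) - x (pt n l)) $ i + (x (pt n (Suc l)) - x (pt n l)) $ j)\<^sup>2"

lemma polar_sum:
  "0 \<le> r \<Longrightarrow> (\<Sum>l\<in>idx n r. polar_term x i j n l) =
    qv_sum \<pi> x n r $ i $ i + 2 * qv_sum \<pi> x n r $ i $ j + qv_sum \<pi> x n r $ j $ j"
  by (simp add: qv_sum_eq outer_def sum_distrib_left sum.distrib[symmetric] power2_eq_square algebra_simps)

text \<open>Both \<tau> n = t and \<tau> n = \<open>last_before \<pi> n t\<close> are admissible;
  these choices give the two mass conditions of \<open>weighted_approx\<close>.\<close>

lemma polar_tendsto:
  assumes "x \<in> \<Omega>" "0 \<le> t" "\<tau> \<longlonglongrightarrow> t" "\<And>n. 0 \<le> \<tau> n" "\<And>n. last_before \<pi> n t \<le> \<tau> n"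
  shows "(\<lambda>n. \<Sum>l\<in>idx n (\<tau> n). polar_term x i j n l) \<longlonglongrightarrow> polar x i j t"
proof -
  have "(\<lambda>n. qv_sum \<pi> x n (\<tau> n)) \<longlonglongrightarrow> quad_var \<pi> x t"
    using assms by (intro qv_tendsto) auto
  then show ?thesis unfolding polar_def polar_sum[OF assms(4)] by (intro tendsto_intros)
qed

text \<open>Monotonicity passes to the limit from the sums of squares. At time 0 only the first cell
  contributes, and its increment vanishes in the limit, so there is no atom at 0.\<close>

lemma polar_props:
  assumes x: "x \<in> \<Omega>"
  shows "mono (polar x i j)" "continuous (at_right s) (polar x i j)" "polar x i j 0 = 0"
proof -
  have lim: "(\<lambda>n. \<Sum>l\<in>idx n t. polar_term x i j n l) \<longlonglongrightarrow> polar x i j t"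
    if "0 \<le> t" for t
    by (rule polar_tendsto[OF x that]) (simp_all add: that last_before_le)
  have c: "cadlag (polar x i j)"
    unfolding cadlag_def
  proof (intro conjI allI impI)
    fix s :: real assume "s < 0"
    then show "polar x i j s = polar x i j 0"
      using cadlag_neg[OF cadlag_quad_var[OF x]] by (simp add: polar_def)
  next
    fix t :: real assume t: "0 \<le> t"
    show "(polar x i j \<longlongrightarrow> polar x i j t) (at_right t)"
      unfolding polar_def by (intro tendsto_intros cadlag_right cadlag_quad_var x t)
    have "(polar x i j \<longlongrightarrow> left_lim (quad_var \<pi> x) t $ i $ i + 2 * left_lim (quad_var \<pi> x) t $ i $ j + left_lim (quad_var \<pi> x) t $ j $ j) (at_left t)"
      unfolding polar_def by (intro tendsto_intros cadlag_left cadlag_quad_var x t)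
    then show "\<exists>l. (polar x i j \<longlongrightarrow> l) (at_left t)" by blast
  qed
  have m: "polar x i j r \<le> polar x i j s" if "0 \<le> r" "r \<le> s" for r s
  proof (rule tendsto_le[OF _ lim lim])
    show "\<forall>\<^sub>F n in sequentially. (\<Sum>l\<in>idx n r. polar_term x i j n l)
        \<le> (\<Sum>l\<in>idx n s. polar_term x i j n l)"
      using that by (intro always_eventually allI sum_mono2) auto
  qed (use that in auto)
  show "mono (polar x i j)" "continuous (at_right s) (polar x i j)"
    using cadlag_mono_extend[OF c m] by blast+
  have "(\<lambda>n. ((x (pt n (Suc 0)) - x 0) $ i + (x (pt n (Suc 0)) - x 0) $ j)\<^sup>2) \<longlonglongrightarrow> (0 $ i + 0 $ j)\<^sup>2"
    by (intro tendsto_intros first_increment_tendsto cadlag_mem x)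
  moreover have "\<forall>\<^sub>F n in sequentially. ((x (pt n (Suc 0)) - x 0) $ i + (x (pt n (Suc 0)) - x 0) $ j)\<^sup>2 =
      (\<Sum>l\<in>idx n 0. polar_term x i j n l)"
    using pt_1_tendsto(2)
  proof eventually_elim
    case (elim n)
    have "idx n 0 = {..0}" using elim pt_less[of 0 "Suc 0" n] by (intro idx_eq) auto
    then show ?case by simp
  qed
  ultimately have "(\<lambda>n. \<Sum>l\<in>idx n 0. polar_term x i j n l) \<longlonglongrightarrow> (0 $ i + 0 $ j)\<^sup>2"
    by (rule Lim_transform_eventually)
  from LIMSEQ_unique[OF lim[OF order_refl] this] show "polar x i j 0 = 0" by simp
qed

text \<open>The comparison system for the limit: \<open>A\<close> itself sampled along the partitions.\<close>

lemma sampled_approx: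
  assumes A: "mono A" "\<And>s. continuous (at_right s) A" "A 0 = 0"
    and bd: "\<And>s. s \<in> {0..T} \<Longrightarrow> \<bar>g s\<bar> \<le> C"
    and left: "\<And>s. 0 < s \<Longrightarrow> (g \<longlongrightarrow> g s) (at_left s)"
  shows "weighted_approx T A g (\<lambda>n l. if Suc l < length (\<pi> n) then A (pt n (Suc l)) - A (pt n l) else 0) (\<lambda>n. g)"
proof -
  \<comment> \<open>The default 0 keeps the weights nonnegative at all indices, also beyond the end
    of the list.\<close>
  let ?a = "\<lambda>n l. if Suc l < length (\<pi> n) then A (pt n (Suc l)) - A (pt n l) else 0"
  have sum: "(\<Sum>l\<in>idx n r. ?a n l) = A (pt n (Suc j))"
    if "Suc j < length (\<pi> n)" "pt n j \<le> r" "r < pt n (Suc j)" for n j r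
  proof -
    have "(\<Sum>l\<in>idx n r. ?a n l) = (\<Sum>l\<in>idx n r. A (pt n (Suc l)) - A (pt n l))" by (rule sum.cong) auto
    also have "\<dots> = (\<Sum>l<Suc j. A (pt n (Suc l)) - A (pt n l))"
      unfolding idx_eq[OF that] lessThan_Suc_atMost ..
    also have "\<dots> = A (pt n (Suc j)) - A (pt n 0)" by (rule sum_lessThan_telescope)
    finally show ?thesis by (simp add: A(3))
  qed
  \<comment> \<open>The weights telescope to A at the right end of the cell of \<rho> n. Since
    \<rho> n \<ge> t'_n, this right end is not before s, and right continuity of A applies; both
    \<rho> n = s and \<rho> n = t'_n are covered.\<close>
  have lim: "(\<lambda>n. \<Sum>l\<in>idx n (\<rho> n). ?a n l) \<longlonglongrightarrow> A s"
    if s: "0 \<le> s" and \<rho>: "\<And>n. 0 \<le> \<rho> n" "\<And>n. last_before \<pi> n s \<le> \<rho> n" "\<And>n. \<rho> n \<le> s" for \<rho> s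
  proof (rule tendstoI)
    fix e :: real assume "0 < e"
    have "(A \<longlongrightarrow> A s) (at_right s)" using A(2) by (simp add: continuous_within)
    then have "\<forall>\<^sub>F r in at_right s. dist (A r) (A s) < e" using \<open>0 < e\<close> by (rule tendstoD)
    then obtain b where b: "s < b" "\<And>r. s < r \<Longrightarrow> r < b \<Longrightarrow> dist (A r) (A s) < e"
      unfolding eventually_at_right_field by blast
    have "0 < b - s" using b by simp
    from mesh_ev[OF this, of s] last_ev[of s]
    show "\<forall>\<^sub>F n in sequentially. dist (\<Sum>l\<in>idx n (\<rho> n). ?a n l) (A s) < e"
    proof eventually_elim
      case (elim n)
      have "\<rho> n < last (\<pi> n)" using \<rho>(3)[of n] elim(2) by simp
      then obtain j where j: "Suc j < length (\<pi> n)" "pt n j \<le> \<rho> n" "\<rho> n < pt n (Suc j)"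
        using ex_cell[OF \<rho>(1)] by metis
      have "s \<le> pt n (Suc j)"
      proof (rule ccontr)
        assume "\<not> s \<le> pt n (Suc j)"
        then have "pt n (Suc j) \<le> last_before \<pi> n s" using j by (intro le_last_before) auto
        then show False using j \<rho>(2)[of n] by simp
      qed
      moreover have "pt n (Suc j) < b" using elim(1)[rule_format, of j] j \<rho>(3)[of n] by auto
      ultimately have "dist (A (pt n (Suc j))) (A s) < e"
        using b(2)[of "pt n (Suc j)"] \<open>0 < e\<close> by (cases "pt n (Suc j) = s") auto
      then show ?case unfolding sum[OF j] .
    qed
  qed
  show ?thesis
    unfolding weighted_approx_def
  proof (intro conjI allI impI)
    show "0 \<le> ?a n l" for n l using pt_le[of l "Suc l" n] monoD[OF A(1)] by auto
    show "(\<lambda>n. \<Sum>l\<in>idx n r. ?a n l) \<longlonglongrightarrow> A r" if "0 \<le> r" for r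
      by (rule lim[OF that]) (simp_all add: that last_before_le)
    show "(\<lambda>n. \<Sum>l\<in>idx n (last_before \<pi> n s). ?a n l) \<longlonglongrightarrow> A s" if "0 \<le> s" for s
      by (rule lim[OF that]) (simp_all add: that last_before_le last_before_nonneg)
    show "\<exists>C. \<forall>\<^sub>F n in sequentially. \<forall>r\<in>{0..T}. \<bar>g r\<bar> \<le> C"
      using bd by (intro exI[of _ C] always_eventually) auto
  next
    fix t \<tau> assume t: "0 \<le> (t::real)" and \<tau>: "\<tau> \<longlonglongrightarrow> t"
      and ev: "\<forall>\<^sub>F n in sequentially. 0 \<le> \<tau> n \<and> \<tau> n \<le> last_before \<pi> n t"
    show "(\<lambda>n. g (\<tau> n)) \<longlonglongrightarrow> g t"
    proof (cases "t = 0")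
      case True
      have "\<forall>\<^sub>F n in sequentially. g (\<tau> n) = g t"
        using ev
      proof eventually_elim
        case (elim n)
        then have "\<tau> n = 0" using True by simp
        then show ?case using True by simp
      qed
      then show ?thesis by (rule tendsto_eventually)
    next
      case False
      then have t0: "0 < t" using t by simp
      have "\<forall>\<^sub>F n in sequentially. \<tau> n < t"
        using ev
      proof eventually_elim
        case (elim n)
        then show ?case using last_before_in(2)[OF t0, of n] by simp
      qed
      then have "filterlim \<tau> (at_left t) sequentially"
        using \<tau> by (auto simp: filterlim_at elim: eventually_mono)
      then show ?thesis by (rule filterlim_compose[OF left[OF t0]])
    qed
  qed
qed

section \<open>Covariation sums and their Stieltjes limit\<close>

definition cov_sum :: "('m, real ^ 'm) functional \<Rightarrow> ('m, real ^ 'm) functional \<Rightarrow> nat \<Rightarrow> real \<Rightarrow> (real \<Rightarrow> real ^ 'm) \<Rightarrow> real" where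
  "cov_sum \<phi> \<psi> n t x = (\<Sum>l\<in>idx n t.
     (\<phi> (pt n l) (stop_left (step n x) (pt n l)) \<bullet> (x (pt n (Suc l)) - x (pt n l))) *
     (\<psi> (pt n l) (stop_left (step n x) (pt n l)) \<bullet> (x (pt n (Suc l)) - x (pt n l))))"

text \<open>Entry by entry, polarization replaces the product of increments by squares; for these
  the sum with step path integrands merges with the sum against sampled \<open>polar\<close>, whose
  limit is a Stieltjes integral.\<close>

theorem cov_sum_tendsto_LS:
  assumes \<phi>: "integrand \<phi>" and \<psi>: "integrand \<psi>" and x: "x \<in> \<Omega>" and T: "0 \<le> T"
  shows "(\<lambda>n. cov_sum \<phi> \<psi> n T x) \<longlonglongrightarrow> (\<Sum>i\<in>UNIV. \<Sum>j\<in>UNIV.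
      LS_integral (\<lambda>s. \<phi> s (stop_left x s) $ i * \<psi> s (stop_left x s) $ j) (\<lambda>s. quad_var \<pi> x s $ i $ j) T)"
proof -
  obtain C1 where C1: "0 \<le> C1" "\<forall>\<^sub>F n in sequentially. \<forall>r\<in>{0..T}. norm (\<phi> r (stop_left (step n x) r)) \<le> C1"
    "\<And>s. s \<in> {0..T} \<Longrightarrow> norm (\<phi> s (stop_left x s)) \<le> C1" using integrand_bounded[OF \<phi> x T] by blast
  obtain C2 where C2: "0 \<le> C2" "\<forall>\<^sub>F n in sequentially. \<forall>r\<in>{0..T}. norm (\<psi> r (stop_left (step n x) r)) \<le> C2"
    "\<And>s. s \<in> {0..T} \<Longrightarrow> norm (\<psi> s (stop_left x s)) \<le> C2" using integrand_bounded[OF \<psi> x T] by blast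
  have prod_bd: "\<bar>v $ i * w $ j\<bar> \<le> C1 * C2" if "norm v \<le> C1" "norm w \<le> C2" for v w :: "real ^ 'm" and i j
  proof -
    have "\<bar>v $ i\<bar> \<le> C1" using component_le_norm_cart[of v i] that by linarith
    moreover have "\<bar>w $ j\<bar> \<le> C2" using component_le_norm_cart[of w j] that by linarith
    ultimately show ?thesis unfolding abs_mult using C1(1) by (intro mult_mono) auto
  qed
  define \<delta> where "\<delta> n l = x (pt n (Suc l)) - x (pt n l)" for n l
  define f where "f i j n r = \<phi> r (stop_left (step n x) r) $ i * \<psi> r (stop_left (step n x) r) $ j" for i j n r
  define g where "g i j s = \<phi> s (stop_left x s) $ i * \<psi> s (stop_left x s) $ j" for i j s
  have gbd: "\<bar>g i j s\<bar> \<le> C1 * C2" if "s \<in> {0..T}" for i j s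
    unfolding g_def by (intro prod_bd C1 C2 that)
  have gleft: "(g i j \<longlongrightarrow> g i j s) (at_left s)" if "0 < s" for i j s
    unfolding g_def by (intro tendsto_intros integrand_left \<phi> \<psi> x that)
  have w: "weighted_approx T (polar x k k') (g i j) (\<lambda>n l. (\<delta> n l $ k + \<delta> n l $ k')\<^sup>2) (f i j)" for i j k k'
    unfolding weighted_approx_def
  proof (intro conjI allI impI)
    show "0 \<le> (\<delta> n l $ k + \<delta> n l $ k')\<^sup>2" for n l by simp
    show "(\<lambda>n. \<Sum>l\<in>idx n r. (\<delta> n l $ k + \<delta> n l $ k')\<^sup>2) \<longlonglongrightarrow> polar x k k' r" if "0 \<le> r" for r
      unfolding \<delta>_def by (rule polar_tendsto[OF x that]) (simp_all add: that last_before_le)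
    show "(\<lambda>n. \<Sum>l\<in>idx n (last_before \<pi> n s). (\<delta> n l $ k + \<delta> n l $ k')\<^sup>2) \<longlonglongrightarrow> polar x k k' s" if "0 \<le> s" for s
      unfolding \<delta>_def by (rule polar_tendsto[OF x that last_before_tendsto[OF that]]) (simp_all add: last_before_nonneg)
    have "\<forall>\<^sub>F n in sequentially. \<forall>r\<in>{0..T}. \<bar>f i j n r\<bar> \<le> C1 * C2"
      using C1(2) C2(2)
    proof eventually_elim
      case (elim n)
      show ?case unfolding f_def using elim by (intro ballI prod_bd) auto
    qed
    then show "\<exists>C. \<forall>\<^sub>F n in sequentially. \<forall>r\<in>{0..T}. \<bar>f i j n r\<bar> \<le> C" by blast
  next
    fix t \<tau> assume t: "0 \<le> (t::real)" and \<tau>: "\<tau> \<longlonglongrightarrow> t"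
      and ev: "\<forall>\<^sub>F n in sequentially. 0 \<le> \<tau> n \<and> \<tau> n \<le> last_before \<pi> n t"
    show "(\<lambda>n. f i j n (\<tau> n)) \<longlonglongrightarrow> g i j t"
      unfolding f_def g_def by (intro tendsto_intros integrand_left_seq \<phi> \<psi> x t \<tau> ev)
  qed
  have diff: "(\<lambda>n. (\<Sum>l\<in>idx n T. f i j n (pt n l) * (\<delta> n l $ k + \<delta> n l $ k')\<^sup>2) -
      (\<Sum>l\<in>idx n T. g i j (pt n l) * (polar x k k' (pt n (Suc l)) - polar x k k' (pt n l)))) \<longlonglongrightarrow> 0" for i j k k'
  proof -
    have rc: "\<forall>s\<ge>0. (polar x k k' \<longlongrightarrow> polar x k k' s) (at_right s)"
      using polar_props(2)[OF x] by (simp add: continuous_within)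
    have s: "weighted_approx T (polar x k k') (g i j)
        (\<lambda>n l. if Suc l < length (\<pi> n) then polar x k k' (pt n (Suc l)) - polar x k k' (pt n l) else 0) (\<lambda>n. g i j)"
      by (rule sampled_approx[OF polar_props[OF x] gbd gleft])
    have "(\<Sum>l\<in>idx n T. g i j (pt n l) * (if Suc l < length (\<pi> n) then polar x k k' (pt n (Suc l)) - polar x k k' (pt n l) else 0)) =
        (\<Sum>l\<in>idx n T. g i j (pt n l) * (polar x k k' (pt n (Suc l)) - polar x k k' (pt n l)))" for n
      by (intro sum.cong refl) simp
    then show ?thesis using weighted_approx_diff[OF w s T rc] by simp
  qed
  have lim: "(\<lambda>n. \<Sum>l\<in>idx n T. f i j n (pt n l) * (\<delta> n l $ i * \<delta> n l $ j)) \<longlonglongrightarrow>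
      LS_integral (g i j) (\<lambda>s. quad_var \<pi> x s $ i $ j) T" for i j
  proof -
    let ?S = "\<lambda>n k k'. \<Sum>l\<in>idx n T. f i j n (pt n l) * (\<delta> n l $ k + \<delta> n l $ k')\<^sup>2"
    let ?P = "\<lambda>n k k'. \<Sum>l\<in>idx n T. g i j (pt n l) * (polar x k k' (pt n (Suc l)) - polar x k k' (pt n l))"
    \<comment> \<open>Since \<open>polar x i i\<close> is 4 [x_i, x_i], the factor 1/8 removes half
      of each diagonal entry. The identity holds for i = j as well, and it is a decomposition into
      two increasing parts.\<close>
    have q: "quad_var \<pi> x s $ i $ j = (1/2) * polar x i j s - (1/8) * (polar x i i s + polar x j j s)" for s
      by (simp add: polar_def field_simps)
    have LS: "(\<lambda>n. \<Sum>l\<in>idx n T. g i j (pt n l) * (quad_var \<pi> x (pt n (Suc l)) $ i $ j - quad_var \<pi> x (pt n l) $ i $ j)) \<longlonglongrightarrow>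
        LS_integral (g i j) (\<lambda>s. quad_var \<pi> x s $ i $ j) T"
    proof (rule LS_integral_tendsto[where g = "\<lambda>s. (1/2) * polar x i j s" and h = "\<lambda>s. (1/8) * (polar x i i s + polar x j j s)"])
      show "mono (\<lambda>s. (1/2) * polar x i j s)"
        using polar_props(1)[OF x] by (auto simp: mono_def)
      show "mono (\<lambda>s. (1/8) * (polar x i i s + polar x j j s))"
        using polar_props(1)[OF x, of i i] polar_props(1)[OF x, of j j] by (auto simp: mono_def intro!: add_mono)
      show "continuous (at_right s) (\<lambda>s. (1/2) * polar x i j s)"
        "continuous (at_right s) (\<lambda>s. (1/8) * (polar x i i s + polar x j j s))" for s
        by (intro continuous_intros polar_props(2) x)+
    qed (use q T gbd gleft in auto)
    have "(\<lambda>n. ((1/2) * (?S n i j - ?P n i j) - (1/8) * ((?S n i i - ?P n i i) + (?S n j j - ?P n j j))) +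
        (\<Sum>l\<in>idx n T. g i j (pt n l) * (quad_var \<pi> x (pt n (Suc l)) $ i $ j - quad_var \<pi> x (pt n l) $ i $ j))) \<longlonglongrightarrow>
      ((1/2) * 0 - (1/8) * (0 + 0)) + LS_integral (g i j) (\<lambda>s. quad_var \<pi> x s $ i $ j) T"
      by (intro tendsto_add tendsto_diff tendsto_mult tendsto_const diff LS)
    moreover have "((1/2) * (?S n i j - ?P n i j) - (1/8) * ((?S n i i - ?P n i i) + (?S n j j - ?P n j j))) +
        (\<Sum>l\<in>idx n T. g i j (pt n l) * (quad_var \<pi> x (pt n (Suc l)) $ i $ j - quad_var \<pi> x (pt n l) $ i $ j)) =
        (\<Sum>l\<in>idx n T. f i j n (pt n l) * (\<delta> n l $ i * \<delta> n l $ j))" for n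
      unfolding q sum_distrib_left sum_subtractf[symmetric] sum.distrib[symmetric]
      by (intro sum.cong refl) (simp add: field_simps power2_eq_square)
    ultimately show ?thesis by simp
  qed
  have "(\<lambda>n. \<Sum>i\<in>UNIV. \<Sum>j\<in>UNIV. \<Sum>l\<in>idx n T. f i j n (pt n l) * (\<delta> n l $ i * \<delta> n l $ j)) \<longlonglongrightarrow>
      (\<Sum>i\<in>UNIV. \<Sum>j\<in>UNIV. LS_integral (g i j) (\<lambda>s. quad_var \<pi> x s $ i $ j) T)"
    by (intro tendsto_sum lim)
  moreover have "(\<Sum>i\<in>UNIV. \<Sum>j\<in>UNIV. \<Sum>l\<in>idx n T. f i j n (pt n l) * (\<delta> n l $ i * \<delta> n l $ j)) = cov_sum \<phi> \<psi> n T x" for n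
  proof -
    have "(\<Sum>i\<in>UNIV. \<Sum>j\<in>UNIV. \<Sum>l\<in>idx n T. f i j n (pt n l) * (\<delta> n l $ i * \<delta> n l $ j)) =
        (\<Sum>i\<in>UNIV. \<Sum>l\<in>idx n T. \<Sum>j\<in>UNIV. f i j n (pt n l) * (\<delta> n l $ i * \<delta> n l $ j))"
      by (intro sum.cong refl sum.swap)
    also have "\<dots> = (\<Sum>l\<in>idx n T. \<Sum>i\<in>UNIV. \<Sum>j\<in>UNIV. f i j n (pt n l) * (\<delta> n l $ i * \<delta> n l $ j))"
      by (rule sum.swap)
    also have "\<dots> = cov_sum \<phi> \<psi> n T x"
      unfolding cov_sum_def inner_vec_def sum_product f_def \<delta>_def
      by (intro sum.cong refl) (simp add: mult_ac)
    finally show ?thesis .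
  qed
  ultimately show ?thesis by (simp add: g_def[abs_def])
qed

end

subsection \<open>The covariation functional\<close>


locale integrand_pair = generic_Q \<pi> \<Omega> for \<pi> and \<Omega> :: "(real \<Rightarrow> real ^ 'm::finite) set" +
  fixes \<phi> \<psi> :: "('m, real ^ 'm) functional"
  assumes int\<phi>: "integrand \<phi>" and int\<psi>: "integrand \<psi>"
begin

abbreviation incr :: "nat \<Rightarrow> (real \<Rightarrow> real ^ 'm) \<Rightarrow> nat \<Rightarrow> real ^ 'm" where
  "incr n x l \<equiv> x (pt n (Suc l)) - x (pt n l)"

text \<open>The response of the covariation to a jump e at time t; it is quadratic in e.\<close>

definition J :: "real \<Rightarrow> (real \<Rightarrow> real ^ 'm) \<Rightarrow> real ^ 'm \<Rightarrow> real" where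
  "J t y e = (\<phi> t y \<bullet> e) * (\<psi> t y \<bullet> e)"

text \<open>Taken as a limit of sums instead of a Stieltjes integral: the sums show directly what
  happens to stopped paths and how the value is bounded.\<close>

definition covariation :: "('m, real) functional" where
  "covariation t x = lim (\<lambda>n. cov_sum \<phi> \<psi> n t x)"

text \<open>The trace of \<open>qv_sum\<close>, a scalar that dominates all increments of the
  covariation sums.\<close>

definition trace_sum :: "nat \<Rightarrow> real \<Rightarrow> (real \<Rightarrow> real ^ 'm) \<Rightarrow> real" where
  "trace_sum n t x = (\<Sum>l\<in>idx n t. (norm (incr n x l))\<^sup>2)"

definition trace_qv :: "real \<Rightarrow> (real \<Rightarrow> real ^ 'm) \<Rightarrow> real" where
  "trace_qv t x = (\<Sum>i\<in>UNIV. quad_var \<pi> x t $ i $ i)"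

lemma cov_sum_J: "cov_sum \<phi> \<psi> n t x = (\<Sum>l\<in>idx n t. J (pt n l) (stop_left (step n x) (pt n l)) (incr n x l))"
  by (simp add: cov_sum_def J_def)

lemma covariation_eq_LS:
  assumes "x \<in> \<Omega>" "0 \<le> T"
  shows "covariation T x = (\<Sum>i\<in>UNIV. \<Sum>j\<in>UNIV.
      LS_integral (\<lambda>s. \<phi> s (stop_left x s) $ i * \<psi> s (stop_left x s) $ j) (\<lambda>s. quad_var \<pi> x s $ i $ j) T)"
  unfolding covariation_def by (rule limI[OF cov_sum_tendsto_LS[OF int\<phi> int\<psi> assms]])

lemma cov_sum_tendsto:
  assumes "x \<in> \<Omega>" "0 \<le> T"
  shows "(\<lambda>n. cov_sum \<phi> \<psi> n T x) \<longlonglongrightarrow> covariation T x"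
  using cov_sum_tendsto_LS[OF int\<phi> int\<psi> assms] covariation_eq_LS[OF assms] by simp

lemma trace_sum_tendsto:
  assumes "x \<in> \<Omega>" "0 \<le> t" "\<tau> \<longlonglongrightarrow> t" "\<forall>\<^sub>F n in sequentially. 0 \<le> \<tau> n"
    "(\<forall>\<^sub>F n in sequentially. last_before \<pi> n t \<le> \<tau> n) \<or> jump x t = 0"
  shows "(\<lambda>n. trace_sum n (\<tau> n) x) \<longlonglongrightarrow> trace_qv t x"
proof -
  have "(\<lambda>n. \<Sum>i\<in>UNIV. qv_sum \<pi> x n (\<tau> n) $ i $ i) \<longlonglongrightarrow> trace_qv t x"
    unfolding trace_qv_def by (intro tendsto_sum tendsto_vec_nth qv_tendsto assms)
  moreover have "\<forall>\<^sub>F n in sequentially. (\<Sum>i\<in>UNIV. qv_sum \<pi> x n (\<tau> n) $ i $ i) = trace_sum n (\<tau> n) x"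
    using assms(4)
  proof eventually_elim
    case (elim n)
    have "(\<Sum>i\<in>UNIV. qv_sum \<pi> x n (\<tau> n) $ i $ i) = (\<Sum>i\<in>UNIV. \<Sum>l\<in>idx n (\<tau> n). incr n x l $ i * incr n x l $ i)"
      using elim by (simp add: qv_sum_eq outer_def)
    also have "\<dots> = (\<Sum>l\<in>idx n (\<tau> n). \<Sum>i\<in>UNIV. incr n x l $ i * incr n x l $ i)"
      by (rule sum.swap)
    also have "\<dots> = trace_sum n (\<tau> n) x"
      unfolding trace_sum_def power2_norm_eq_inner inner_vec_def by simp
    finally show ?case .
  qed
  ultimately show ?thesis by (rule Lim_transform_eventually)
qed

section \<open>Domination by the trace of the quadratic variation\<close>

lemma trace_sum_mono: "s \<le> t \<Longrightarrow> trace_sum n s x \<le> trace_sum n t x"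
  unfolding trace_sum_def by (intro sum_mono2) auto

lemma trace_sum_tendsto_fixed: "x \<in> \<Omega> \<Longrightarrow> 0 \<le> t \<Longrightarrow> (\<lambda>n. trace_sum n t x) \<longlonglongrightarrow> trace_qv t x"
  by (rule trace_sum_tendsto) (simp_all add: last_before_le)

lemma J_bound: "norm (\<phi> t y) \<le> C1 \<Longrightarrow> norm (\<psi> t y) \<le> C2 \<Longrightarrow> \<bar>J t y e\<bar> \<le> C1 * C2 * (norm e)\<^sup>2"
proof -
  assume C: "norm (\<phi> t y) \<le> C1" "norm (\<psi> t y) \<le> C2"
  have "\<bar>\<phi> t y \<bullet> e\<bar> \<le> C1 * norm e"
    using Cauchy_Schwarz_ineq2[of "\<phi> t y" e] mult_right_mono[OF C(1) norm_ge_zero[of e]] by linarith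
  moreover have "\<bar>\<psi> t y \<bullet> e\<bar> \<le> C2 * norm e"
    using Cauchy_Schwarz_ineq2[of "\<psi> t y" e] mult_right_mono[OF C(2) norm_ge_zero[of e]] by linarith
  ultimately have "\<bar>J t y e\<bar> \<le> (C1 * norm e) * (C2 * norm e)"
    unfolding J_def abs_mult using order_trans[OF abs_ge_zero] by (intro mult_mono) auto
  then show ?thesis by (simp add: power2_eq_square mult_ac)
qed

lemma J_tendsto_0:
  assumes e: "(e \<longlongrightarrow> 0) F"
    and "\<forall>\<^sub>F n in F. norm (\<phi> (\<tau> n) (y n)) \<le> C1" "\<forall>\<^sub>F n in F. norm (\<psi> (\<tau> n) (y n)) \<le> C2"
  shows "((\<lambda>n. J (\<tau> n) (y n) (e n)) \<longlongrightarrow> 0) F"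
  unfolding J_def by (rule tendsto_mult_zero[OF inner_tendsto_0[OF e assms(2)] inner_tendsto_0[OF e assms(3)]])

lemma bounded_pair:
  assumes x: "x \<in> \<Omega>" and T: "0 \<le> T"
  shows "\<exists>C1\<ge>0. \<exists>C2\<ge>0. (\<forall>\<^sub>F n in sequentially. \<forall>r\<in>{0..T}.
      norm (\<phi> r (stop_left (step n x) r)) \<le> C1 \<and> norm (\<psi> r (stop_left (step n x) r)) \<le> C2) \<and>
    (\<forall>s\<in>{0..T}. norm (\<phi> s (stop_left x s)) \<le> C1 \<and> norm (\<psi> s (stop_left x s)) \<le> C2)"
proof -
  obtain C1 where C1: "0 \<le> C1" "\<forall>\<^sub>F n in sequentially. \<forall>r\<in>{0..T}. norm (\<phi> r (stop_left (step n x) r)) \<le> C1"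
    "\<forall>s\<in>{0..T}. norm (\<phi> s (stop_left x s)) \<le> C1" using integrand_bounded[OF int\<phi> x T] by blast
  obtain C2 where C2: "0 \<le> C2" "\<forall>\<^sub>F n in sequentially. \<forall>r\<in>{0..T}. norm (\<psi> r (stop_left (step n x) r)) \<le> C2"
    "\<forall>s\<in>{0..T}. norm (\<psi> s (stop_left x s)) \<le> C2" using integrand_bounded[OF int\<psi> x T] by blast
  have "\<forall>\<^sub>F n in sequentially. \<forall>r\<in>{0..T}.
      norm (\<phi> r (stop_left (step n x) r)) \<le> C1 \<and> norm (\<psi> r (stop_left (step n x) r)) \<le> C2"
    using C1(2) C2(2) by eventually_elim blast
  then show ?thesis using C1 C2 by blast
qed

text \<open>With bounded integrands each term is at most a constant times the squared increment.
  Through this estimate the covariation inherits its regularity in time from [x], with no modulus of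
  continuity for the integrands.\<close>

lemma cov_sum_bound:
  assumes x: "x \<in> \<Omega>" and T: "0 \<le> T"
  shows "\<exists>C\<ge>0. \<forall>\<^sub>F n in sequentially. \<forall>s\<in>{0..T}. \<forall>t\<in>{0..T}.
     \<bar>cov_sum \<phi> \<psi> n t x - cov_sum \<phi> \<psi> n s x\<bar> \<le> C * \<bar>trace_sum n t x - trace_sum n s x\<bar>"
proof -
  obtain C1 C2 where C: "0 \<le> C1" "0 \<le> C2" and
    ev: "\<forall>\<^sub>F n in sequentially. \<forall>r\<in>{0..T}.
      norm (\<phi> r (stop_left (step n x) r)) \<le> C1 \<and> norm (\<psi> r (stop_left (step n x) r)) \<le> C2"
    using bounded_pair[OF x T] by blast
  have "\<forall>\<^sub>F n in sequentially. \<forall>s\<in>{0..T}. \<forall>t\<in>{0..T}.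
     \<bar>cov_sum \<phi> \<psi> n t x - cov_sum \<phi> \<psi> n s x\<bar> \<le> C1 * C2 * \<bar>trace_sum n t x - trace_sum n s x\<bar>"
    using ev
  proof eventually_elim
    case (elim n)
    have less: "\<bar>cov_sum \<phi> \<psi> n t x - cov_sum \<phi> \<psi> n s x\<bar> \<le> C1 * C2 * (trace_sum n t x - trace_sum n s x)"
      if st: "0 \<le> s" "s \<le> t" "t \<le> T" for s t
    proof -
      have sub: "idx n s \<subseteq> idx n t" using st by auto
      have "\<bar>cov_sum \<phi> \<psi> n t x - cov_sum \<phi> \<psi> n s x\<bar> =
          \<bar>\<Sum>l\<in>idx n t - idx n s. J (pt n l) (stop_left (step n x) (pt n l)) (incr n x l)\<bar>"
        unfolding cov_sum_J sum_diff[OF finite_idx sub] ..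
      also have "\<dots> \<le> (\<Sum>l\<in>idx n t - idx n s. C1 * C2 * (norm (incr n x l))\<^sup>2)"
      proof (rule order_trans[OF sum_abs sum_mono])
        fix l assume "l \<in> idx n t - idx n s"
        then have "pt n l \<in> {0..T}" using st by auto
        then show "\<bar>J (pt n l) (stop_left (step n x) (pt n l)) (incr n x l)\<bar> \<le> C1 * C2 * (norm (incr n x l))\<^sup>2"
          using elim by (intro J_bound) auto
      qed
      also have "\<dots> = C1 * C2 * (trace_sum n t x - trace_sum n s x)"
        unfolding trace_sum_def sum_distrib_left[symmetric] sum_diff[OF finite_idx sub] ..
      finally show ?thesis .
    qed
    show ?case
    proof (intro ballI)
      fix s t assume s: "s \<in> {0..T}" and t: "t \<in> {0..T}"
      show "\<bar>cov_sum \<phi> \<psi> n t x - cov_sum \<phi> \<psi> n s x\<bar> \<le> C1 * C2 * \<bar>trace_sum n t x - trace_sum n s x\<bar>"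
      proof (cases "s \<le> t")
        case True
        then show ?thesis using less[of s t] s t trace_sum_mono[OF True, of n x] by simp
      next
        case False
        then have "t \<le> s" by simp
        then show ?thesis using less[of t s] s t trace_sum_mono[OF \<open>t \<le> s\<close>, of n x]
          by (simp add: abs_minus_commute)
      qed
    qed
  qed
  with C show ?thesis by (intro exI[of _ "C1 * C2"]) simp
qed

lemma cov_bound:
  assumes x: "x \<in> \<Omega>" and T: "0 \<le> T"
  shows "\<exists>C\<ge>0. \<forall>s\<in>{0..T}. \<forall>t\<in>{0..T}. \<bar>covariation t x - covariation s x\<bar> \<le> C * \<bar>trace_qv t x - trace_qv s x\<bar>"
proof -
  obtain C where C: "0 \<le> C" and ev: "\<forall>\<^sub>F n in sequentially. \<forall>s\<in>{0..T}. \<forall>t\<in>{0..T}.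
     \<bar>cov_sum \<phi> \<psi> n t x - cov_sum \<phi> \<psi> n s x\<bar> \<le> C * \<bar>trace_sum n t x - trace_sum n s x\<bar>"
    using cov_sum_bound[OF x T] by blast
  have "\<bar>covariation t x - covariation s x\<bar> \<le> C * \<bar>trace_qv t x - trace_qv s x\<bar>"
    if s: "s \<in> {0..T}" and t: "t \<in> {0..T}" for s t
  proof (rule tendsto_le)
    show "(\<lambda>n. C * \<bar>trace_sum n t x - trace_sum n s x\<bar>) \<longlonglongrightarrow> C * \<bar>trace_qv t x - trace_qv s x\<bar>"
      using s t by (intro tendsto_intros trace_sum_tendsto_fixed x) auto
    show "(\<lambda>n. \<bar>cov_sum \<phi> \<psi> n t x - cov_sum \<phi> \<psi> n s x\<bar>) \<longlonglongrightarrow> \<bar>covariation t x - covariation s x\<bar>"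
      using s t by (intro tendsto_intros cov_sum_tendsto x) auto
    show "\<forall>\<^sub>F n in sequentially. \<bar>cov_sum \<phi> \<psi> n t x - cov_sum \<phi> \<psi> n s x\<bar> \<le> C * \<bar>trace_sum n t x - trace_sum n s x\<bar>"
      using ev by eventually_elim (use s t in blast)
  qed simp
  with C show ?thesis by blast
qed

text \<open>The sum is compared with the one at the fixed time t. Their difference is dominated by
  that of the traces, which have the same limit under the stated condition on \<tau>.\<close>

lemma cov_sum_tendsto_moving:
  assumes x: "x \<in> \<Omega>" and t: "0 \<le> t" and \<tau>: "\<tau> \<longlonglongrightarrow> t" "\<forall>\<^sub>F n in sequentially. 0 \<le> \<tau> n"
    and or: "(\<forall>\<^sub>F n in sequentially. last_before \<pi> n t \<le> \<tau> n) \<or> jump x t = 0"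
  shows "(\<lambda>n. cov_sum \<phi> \<psi> n (\<tau> n) x) \<longlonglongrightarrow> covariation t x"
proof -
  have T: "0 \<le> t + 1" using t by simp
  obtain C where C: "0 \<le> C" and ev: "\<forall>\<^sub>F n in sequentially. \<forall>s\<in>{0..t + 1}. \<forall>r\<in>{0..t + 1}.
     \<bar>cov_sum \<phi> \<psi> n r x - cov_sum \<phi> \<psi> n s x\<bar> \<le> C * \<bar>trace_sum n r x - trace_sum n s x\<bar>"
    using cov_sum_bound[OF x T] by blast
  have "\<forall>\<^sub>F n in sequentially. \<tau> n < t + 1" using \<tau>(1) by (rule order_tendstoD) simp
  then have "\<forall>\<^sub>F n in sequentially. norm (cov_sum \<phi> \<psi> n (\<tau> n) x - cov_sum \<phi> \<psi> n t x) \<le> C * \<bar>trace_sum n (\<tau> n) x - trace_sum n t x\<bar>"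
    using ev \<tau>(2)
  proof eventually_elim
    case (elim n)
    then have "\<tau> n \<in> {0..t + 1}" "t \<in> {0..t + 1}" using t by auto
    then show ?case using elim(2) by simp
  qed
  moreover have "(\<lambda>n. C * \<bar>trace_sum n (\<tau> n) x - trace_sum n t x\<bar>) \<longlonglongrightarrow> C * \<bar>trace_qv t x - trace_qv t x\<bar>"
    by (intro tendsto_intros trace_sum_tendsto[OF x t \<tau> or] trace_sum_tendsto_fixed[OF x t])
  then have "(\<lambda>n. C * \<bar>trace_sum n (\<tau> n) x - trace_sum n t x\<bar>) \<longlonglongrightarrow> 0" by simp
  ultimately have "(\<lambda>n. cov_sum \<phi> \<psi> n (\<tau> n) x - cov_sum \<phi> \<psi> n t x) \<longlonglongrightarrow> 0"
    by (rule Lim_null_comparison)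
  from tendsto_add[OF this cov_sum_tendsto[OF x t]] show ?thesis by simp
qed

lemma first_term_tendsto:
  assumes x: "x \<in> \<Omega>"
  shows "(\<lambda>n. J 0 (stop_left (step n x) 0) (x (pt n (Suc 0)) - x 0)) \<longlonglongrightarrow> 0"
proof -
  obtain C1 C2 where ev: "\<forall>\<^sub>F n in sequentially. \<forall>r\<in>{0..0}.
      norm (\<phi> r (stop_left (step n x) r)) \<le> C1 \<and> norm (\<psi> r (stop_left (step n x) r)) \<le> C2"
    using bounded_pair[OF x order_refl] by blast
  show ?thesis
    by (rule J_tendsto_0[where \<tau> = "\<lambda>_. 0" and ?C1.0 = C1 and ?C2.0 = C2, OF first_increment_tendsto[OF cadlag_mem[OF x]]])
      (use ev in \<open>auto elim: eventually_mono\<close>)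
qed

lemma covariation_0:
  assumes x: "x \<in> \<Omega>"
  shows "covariation 0 x = 0"
proof -
  have "\<forall>\<^sub>F n in sequentially. J 0 (stop_left (step n x) 0) (x (pt n (Suc 0)) - x 0) = cov_sum \<phi> \<psi> n 0 x"
    using pt_1_tendsto(2)
  proof eventually_elim
    case (elim n)
    have "idx n 0 = {..0}" using elim pt_less[of 0 "Suc 0" n] by (intro idx_eq) auto
    then show ?case by (simp add: cov_sum_J)
  qed
  with first_term_tendsto[OF x] have "(\<lambda>n. cov_sum \<phi> \<psi> n 0 x) \<longlonglongrightarrow> 0" by (rule Lim_transform_eventually)
  from LIMSEQ_unique[OF this cov_sum_tendsto[OF x order_refl]] show ?thesis by simp
qed

section \<open>Dependence on the past and the jump of the covariation\<close>

abbreviation straddles :: "(nat \<Rightarrow> nat) \<Rightarrow> real \<Rightarrow> bool" where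
  "straddles j t \<equiv> \<forall>\<^sub>F n in sequentially. Suc (j n) < length (\<pi> n) \<and> pt n (j n) = last_before \<pi> n t \<and>
      pt n (j n) < t \<and> t \<le> pt n (Suc (j n)) \<and> 0 < j n"

text \<open>The index is positive for large n because t'_n tends to t > 0; this is what the
  comparison of step paths before t_j asks for.\<close>

lemma straddling_cell:
  assumes t: "0 < t"
  shows "\<exists>j. (straddles j t) \<and> (\<lambda>n. pt n (Suc (j n))) \<longlonglongrightarrow> t"
proof -
  have t0: "0 \<le> t" using t by simp
  have "\<forall>\<^sub>F n in sequentially. 0 < last_before \<pi> n t"
    using last_before_tendsto[OF t0] t by (rule order_tendstoD)
  then have "\<forall>\<^sub>F n in sequentially. \<exists>j. Suc j < length (\<pi> n) \<and> pt n j = last_before \<pi> n t \<and>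
      pt n j < t \<and> t \<le> pt n (Suc j) \<and> 0 < j"
    using last_ev[of t]
  proof eventually_elim
    case (elim n)
    have sl: "t \<le> last (\<pi> n)" using elim(2) by simp
    obtain j where j: "Suc j < length (\<pi> n)" "pt n j = last_before \<pi> n t" "pt n j < t" "t \<le> pt n (Suc j)"
      using last_before_obtain[OF t sl] by metis
    have "j \<noteq> 0"
    proof
      assume "j = 0"
      then show False using elim(1) j(2) by simp
    qed
    with j show ?case by blast
  qed
  then have "\<exists>j. straddles j t"
    by (rule eventually_ex[THEN iffD1])
  then obtain j where j: "straddles j t" by blast
  have "(\<lambda>n. pt n (Suc (j n))) \<longlonglongrightarrow> t"
  proof (rule tendstoI)
    fix e :: real assume "0 < e"
    from j mesh_ev[OF this, of t] show "\<forall>\<^sub>F n in sequentially. dist (pt n (Suc (j n))) t < e"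
    proof eventually_elim
      case (elim n)
      then have "pt n (Suc (j n)) - pt n (j n) < e" by auto
      then show ?case using elim(1) by (simp add: dist_real_def)
    qed
  qed
  with j show ?thesis by blast
qed

text \<open>What remains of the sums after removing the cell straddling \<open>t\<close> depends on the path before \<open>t\<close> only.\<close>

lemma covariation_before:
  assumes x: "x \<in> \<Omega>" and t: "0 < t"
    and j: "straddles j t" and lim: "(\<lambda>n. pt n (Suc (j n))) \<longlonglongrightarrow> t"
  shows "(\<lambda>n. \<Sum>l<j n. J (pt n l) (stop_left (step n x) (pt n l)) (incr n x l)) \<longlonglongrightarrow>
    covariation t x - J t (stop_left x t) (jump x t)"
proof -
  have t0: "0 \<le> t" using t by simp
  have lb: "(\<lambda>n. last_before \<pi> n t) \<longlonglongrightarrow> t" by (rule last_before_tendsto[OF t0])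
  have nn: "\<forall>\<^sub>F n in sequentially. 0 \<le> last_before \<pi> n t" by (simp add: last_before_nonneg)
  have 1: "(\<lambda>n. cov_sum \<phi> \<psi> n (last_before \<pi> n t) x) \<longlonglongrightarrow> covariation t x"
    by (rule cov_sum_tendsto_moving[OF x t0 lb nn]) simp
  have r: "(\<lambda>n. x (pt n (Suc (j n)))) \<longlonglongrightarrow> x t"
    by (rule cadlag_right_seq[OF cadlag_mem[OF x] t0 lim]) (use j in \<open>auto elim: eventually_mono\<close>)
  have l: "(\<lambda>n. x (last_before \<pi> n t)) \<longlonglongrightarrow> left_lim x t"
    by (rule cadlag_left_seq[OF cadlag_mem[OF x] t0 lb]) (simp add: last_before_in t)
  have lb_ev: "\<forall>\<^sub>F n in sequentially. 0 \<le> last_before \<pi> n t \<and> last_before \<pi> n t \<le> last_before \<pi> n t"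
    by (simp add: last_before_nonneg)
  \<comment> \<open>Since t_j < t \<le> t_{j+1}, with both ends tending to t, the increment over
    this cell tends to the jump of x at t; the integrands converge by 1(c) along t'_n.\<close>
  have 2: "(\<lambda>n. J (last_before \<pi> n t) (stop_left (step n x) (last_before \<pi> n t)) (x (pt n (Suc (j n))) - x (last_before \<pi> n t)))
      \<longlonglongrightarrow> J t (stop_left x t) (jump x t)"
    unfolding J_def jump_def
    by (intro tendsto_intros r l integrand_left_seq[OF int\<phi> x t0 lb lb_ev] integrand_left_seq[OF int\<psi> x t0 lb lb_ev])
  from tendsto_diff[OF 1 2] show ?thesis
  proof (rule Lim_transform_eventually)
    show "\<forall>\<^sub>F n in sequentially. cov_sum \<phi> \<psi> n (last_before \<pi> n t) x -
        J (last_before \<pi> n t) (stop_left (step n x) (last_before \<pi> n t)) (x (pt n (Suc (j n))) - x (last_before \<pi> n t)) =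
        (\<Sum>l<j n. J (pt n l) (stop_left (step n x) (pt n l)) (incr n x l))"
      using j
    proof eventually_elim
      case (elim n)
      then have c: "Suc (j n) < length (\<pi> n)" "pt n (j n) \<le> pt n (j n)" "pt n (j n) < pt n (Suc (j n))" by auto
      have lbj: "last_before \<pi> n t = pt n (j n)" using elim by simp
      show ?case
        unfolding lbj cov_sum_J idx_eq[OF c] lessThan_Suc_atMost[symmetric] by simp
    qed
  qed
qed

text \<open>The sums left of the straddling cell coincide exactly for two paths with the same past.
  It is applied to x against its stopped and its left-stopped version.\<close>

lemma covariation_cong_before:
  assumes x: "x \<in> \<Omega>" and y: "y \<in> \<Omega>" and t: "0 < t" and eq: "\<And>s. 0 \<le> s \<Longrightarrow> s < t \<Longrightarrow> x s = y s"
  shows "covariation t x - J t (stop_left x t) (jump x t) = covariation t y - J t (stop_left y t) (jump y t)"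
proof -
  obtain j where j: "straddles j t" and lim: "(\<lambda>n. pt n (Suc (j n))) \<longlonglongrightarrow> t"
    using straddling_cell[OF t] by blast
  have "\<forall>\<^sub>F n in sequentially. (\<Sum>l<j n. J (pt n l) (stop_left (step n x) (pt n l)) (incr n x l)) =
      (\<Sum>l<j n. J (pt n l) (stop_left (step n y) (pt n l)) (incr n y l))"
    using j
  proof eventually_elim
    case (elim n)
    show ?case
    proof (rule sum.cong[OF refl])
      fix l assume l: "l \<in> {..<j n}"
      have le: "pt n (Suc l) \<le> pt n (j n)" "pt n l \<le> pt n (j n)"
        using l elim by (intro pt_le; simp)+
      have nn: "0 \<le> pt n (Suc l)" "0 \<le> pt n l" using l elim by (auto intro!: pt_nonneg)
      have "stop_left (step n x) (pt n l) = stop_left (step n y) (pt n l)"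
        by (rule stop_left_step_path_cong[of "j n"]) (use elim eq le in auto)
      moreover have "incr n x l = incr n y l" using eq nn le elim by auto
      ultimately show "J (pt n l) (stop_left (step n x) (pt n l)) (incr n x l) = J (pt n l) (stop_left (step n y) (pt n l)) (incr n y l)"
        by simp
    qed
  qed
  with covariation_before[OF x t j lim] have "(\<lambda>n. \<Sum>l<j n. J (pt n l) (stop_left (step n y) (pt n l)) (incr n y l)) \<longlonglongrightarrow>
    covariation t x - J t (stop_left x t) (jump x t)" by (rule Lim_transform_eventually)
  from LIMSEQ_unique[OF this covariation_before[OF y t j lim]] show ?thesis .
qed

lemma J_0 [simp]: "J t y 0 = 0"
  by (simp add: J_def)

text \<open>The sums at t do look beyond t, as t_{i+1} may exceed it; only in the limit does this
  dependence disappear. It is what makes the covariation a functional on \<Lambda>.\<close>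

lemma covariation_stop:
  assumes x: "x \<in> \<Omega>" and t: "0 \<le> t"
  shows "covariation t (stop x t) = covariation t x"
proof (cases "t = 0")
  case True
  then show ?thesis using covariation_0[OF x] covariation_0[OF stop_mem[OF x t]] by simp
next
  case False
  then have "covariation t x - J t (stop_left x t) (jump x t) =
      covariation t (stop x t) - J t (stop_left (stop x t) t) (jump (stop x t) t)"
    using t by (intro covariation_cong_before x stop_mem) (auto simp: stop_def)
  then show ?thesis by (simp add: stop_left_stop jump_stop)
qed

text \<open>The left-stopped path has the same past and no jump at t, so its J-term is 0. This is
  the counterpart of \<open>M_b_jump\<close> with a quadratic response.\<close>

lemma covariation_jump:
  assumes x: "x \<in> \<Omega>" and t: "0 < t"
  shows "covariation t (stop x t) = covariation t (stop_left x t) + J t (stop_left x t) (jump x t)"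
proof -
  have "covariation t x - J t (stop_left x t) (jump x t) =
      covariation t (stop_left x t) - J t (stop_left (stop_left x t) t) (jump (stop_left x t) t)"
    using t x by (intro covariation_cong_before stop_left_mem) (auto simp: stop_left_def)
  then show ?thesis using covariation_stop[OF x, of t] t by (simp add: jump_stop_left)
qed

text \<open>After a the stopped path has no increments, so the sums agree already for every
  n.\<close>

lemma covariation_flat: "flat covariation"
  unfolding flat_def
proof (intro ballI allI impI)
  fix x a b assume x: "x \<in> \<Omega>" and a: "0 \<le> (a::real)" and ab: "a \<le> b"
  have "cov_sum \<phi> \<psi> n b (stop x a) = cov_sum \<phi> \<psi> n a (stop x a)" for n
    unfolding cov_sum_J
  proof (rule sum.mono_neutral_right)
    show "\<forall>l\<in>idx n b - idx n a. J (pt n l) (stop_left (step n (stop x a)) (pt n l)) (incr n (stop x a) l) = 0"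
    proof
      fix l assume l: "l \<in> idx n b - idx n a"
      then have "a < pt n l" "pt n l < pt n (Suc l)" using pt_less[of l "Suc l" n] by auto
      then have "incr n (stop x a) l = 0" by (simp add: stop_def)
      then show "J (pt n l) (stop_left (step n (stop x a)) (pt n l)) (incr n (stop x a) l) = 0" by simp
    qed
  qed (use ab in auto)
  then show "covariation b (stop x a) = covariation a (stop x a)" by (simp add: covariation_def)
qed

text \<open>The covariation of a step path is itself a limit over all partitions. Telescoping avoids
  computing that limit: flatness and the jump formula reduce it to the finite sum over the jumps,
  which lacks the term l = 0.\<close>

lemma covariation_step:
  assumes mem: "stop (step n x) T \<in> \<Omega>" and \<tau>: "0 \<le> \<tau>" "\<tau> \<le> T" "T < last (\<pi> n)"
  shows "covariation \<tau> (stop (step n x) \<tau>) = cov_sum \<phi> \<psi> n \<tau> x - J 0 (stop_left (step n x) 0) (x (pt n (Suc 0)) - x 0)"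
proof -
  have "\<tau> < last (\<pi> n)" using \<tau> by simp
  then obtain j where j: "Suc j < length (\<pi> n)" "pt n j \<le> \<tau>" "\<tau> < pt n (Suc j)"
    using ex_cell[OF \<tau>(1)] by metis
  have m0: "stop (step n x) 0 \<in> \<Omega>" using stop_step_mem[OF mem, of 0] \<tau> by simp
  have "covariation \<tau> (stop (step n x) \<tau>) = covariation 0 (stop (step n x) 0) +
      (\<Sum>l=1..j. J (pt n l) (stop_left (step n x) (pt n l)) (incr n x l))"
    by (rule step_path_telescope[OF covariation_flat covariation_jump mem j \<tau>(2)])
  moreover have "{..j} = insert 0 {1..j}" by auto
  ultimately show ?thesis
    unfolding cov_sum_J idx_eq[OF j] using covariation_0[OF m0] by simp
qed

lemma covariation_step_tendsto:
  assumes x: "x \<in> \<Omega>" and t: "0 \<le> t" and \<tau>: "\<tau> \<longlonglongrightarrow> t" "\<forall>\<^sub>F n in sequentially. 0 \<le> \<tau> n"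
    and or: "(\<forall>\<^sub>F n in sequentially. last_before \<pi> n t \<le> \<tau> n) \<or> jump x t = 0"
  shows "(\<lambda>n. covariation (\<tau> n) (stop (step n x) (\<tau> n))) \<longlonglongrightarrow> covariation t x"
proof -
  have t1: "\<forall>\<^sub>F n in sequentially. \<tau> n < t + 1" using \<tau>(1) by (rule order_tendstoD) simp
  have "(\<lambda>n. cov_sum \<phi> \<psi> n (\<tau> n) x - J 0 (stop_left (step n x) 0) (x (pt n (Suc 0)) - x 0)) \<longlonglongrightarrow> covariation t x - 0"
    by (intro tendsto_diff cov_sum_tendsto_moving[OF x t \<tau> or] first_term_tendsto[OF x])
  moreover have "\<forall>\<^sub>F n in sequentially. cov_sum \<phi> \<psi> n (\<tau> n) x - J 0 (stop_left (step n x) 0) (x (pt n (Suc 0)) - x 0) =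
      covariation (\<tau> n) (stop (step n x) (\<tau> n))"
    using t1 \<tau>(2) ev_step_mem[OF x, of "t + 1"] last_ev[of "t + 1"]
  proof eventually_elim
    case (elim n)
    show ?case using covariation_step[OF elim(3) elim(2) _ elim(4)] elim(1) by simp
  qed
  ultimately show ?thesis by (simp add: Lim_transform_eventually)
qed

text \<open>The step path jumps only at partition points, by the increment of x over the following
  cell; near t this is small unless the point is t'_n and x jumps at t.\<close>

lemma jump_step_tendsto:
  assumes x: "x \<in> \<Omega>" and t: "0 \<le> t" and \<tau>: "\<tau> \<longlonglongrightarrow> t" "\<forall>\<^sub>F n in sequentially. 0 \<le> \<tau> n"
    and or: "(\<forall>\<^sub>F n in sequentially. \<tau> n \<noteq> last_before \<pi> n t) \<or> jump x t = 0"
  shows "(\<lambda>n. jump (step n x) (\<tau> n)) \<longlonglongrightarrow> 0"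
proof (rule tendstoI)
  fix e :: real assume e: "0 < e"
  from small_increments[OF cadlag_mem[OF x] t e] obtain d where d: "0 < d" and
    dn: "\<forall>\<^sub>F n in sequentially. \<forall>l. Suc l < length (\<pi> n) \<longrightarrow> \<bar>pt n l - t\<bar> < d \<longrightarrow>
      pt n l \<noteq> last_before \<pi> n t \<or> jump x t = 0 \<longrightarrow> norm (incr n x l) < e" by blast
  have or': "\<forall>\<^sub>F n in sequentially. \<tau> n \<noteq> last_before \<pi> n t \<or> jump x t = 0"
  proof (cases "jump x t = 0")
    case False
    then show ?thesis using or by simp
  qed simp
  have t1: "\<forall>\<^sub>F n in sequentially. \<tau> n < t + 1" using \<tau>(1) by (rule order_tendstoD) simp
  show "\<forall>\<^sub>F n in sequentially. dist (jump (step n x) (\<tau> n)) 0 < e"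
    using dn or' t1 \<tau>(2) tendstoD[OF \<tau>(1) d] ev_step_mem[OF x, of "t + 1"] last_ev[of "t + 1"]
  proof eventually_elim
    case (elim n)
    have "\<tau> n < last (\<pi> n)" using elim(3,7) by simp
    then obtain j where j: "Suc j < length (\<pi> n)" "pt n j \<le> \<tau> n" "\<tau> n < pt n (Suc j)"
      using ex_cell[OF elim(4)] by metis
    show ?case
    proof (cases "pt n j = \<tau> n")
      case False
      then show ?thesis using jump_step_path_between[OF j(1) _ j(3), of x] j(2) e by simp
    next
      case eq: True
      show ?thesis
      proof (cases j)
        case 0
        then have "\<tau> n = 0" using eq by simp
        \<comment> \<open>At time 0 there is no jump by the convention x(0-) = x(0), although the
          following increment of x need not vanish.\<close>
        have "jump (stop (step n x) (t + 1)) 0 = 0" by (rule jump_0[OF cadlag_mem[OF elim(6)]])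
        then have "jump (step n x) 0 = 0" using t by (simp add: jump_stop)
        then show ?thesis using \<open>\<tau> n = 0\<close> e by simp
      next
        case (Suc i)
        have "jump (step n x) (\<tau> n) = incr n x j"
          using jump_step_path[of i n x] j(1) Suc eq by simp
        moreover have "norm (incr n x j) < e"
          using elim(1)[rule_format, of j] j(1) eq elim(2,5) by (simp add: dist_real_def)
        ultimately show ?thesis by simp
      qed
    qed
  qed
qed

text \<open>The inequality must be strict where x jumps: at t'_n itself the step path makes the
  jump, and stopping just before would lose its contribution. Elsewhere the lost J-term
  vanishes.\<close>

lemma covariation_step_left_tendsto:
  assumes x: "x \<in> \<Omega>" and t: "0 \<le> t" and \<tau>: "\<tau> \<longlonglongrightarrow> t" "\<forall>\<^sub>F n in sequentially. 0 \<le> \<tau> n"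
    and or: "(\<forall>\<^sub>F n in sequentially. last_before \<pi> n t < \<tau> n) \<or> jump x t = 0"
  shows "(\<lambda>n. covariation (\<tau> n) (stop_left (step n x) (\<tau> n))) \<longlonglongrightarrow> covariation t x"
proof -
  have or1: "(\<forall>\<^sub>F n in sequentially. last_before \<pi> n t \<le> \<tau> n) \<or> jump x t = 0"
    using or by (auto elim: eventually_mono)
  have or2: "(\<forall>\<^sub>F n in sequentially. \<tau> n \<noteq> last_before \<pi> n t) \<or> jump x t = 0"
    using or by (auto elim: eventually_mono)
  have T: "0 \<le> t + 1" using t by simp
  have t1: "\<forall>\<^sub>F n in sequentially. \<tau> n < t + 1" using \<tau>(1) by (rule order_tendstoD) simp
  obtain C1 C2 where ev: "\<forall>\<^sub>F n in sequentially. \<forall>r\<in>{0..t + 1}.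
      norm (\<phi> r (stop_left (step n x) r)) \<le> C1 \<and> norm (\<psi> r (stop_left (step n x) r)) \<le> C2"
    using bounded_pair[OF x T] by blast
  have bd: "\<forall>\<^sub>F n in sequentially. norm (\<phi> (\<tau> n) (stop_left (step n x) (\<tau> n))) \<le> C1"
    "\<forall>\<^sub>F n in sequentially. norm (\<psi> (\<tau> n) (stop_left (step n x) (\<tau> n))) \<le> C2"
    using ev t1 \<tau>(2) by (eventually_elim, auto)+
  have J0: "(\<lambda>n. J (\<tau> n) (stop_left (step n x) (\<tau> n)) (jump (step n x) (\<tau> n))) \<longlonglongrightarrow> 0"
    by (rule J_tendsto_0[OF jump_step_tendsto[OF x t \<tau> or2] bd])
  have "(\<lambda>n. covariation (\<tau> n) (stop (step n x) (\<tau> n)) - J (\<tau> n) (stop_left (step n x) (\<tau> n)) (jump (step n x) (\<tau> n)))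
      \<longlonglongrightarrow> covariation t x - 0"
    by (intro tendsto_diff covariation_step_tendsto[OF x t \<tau> or1] J0)
  moreover have "\<forall>\<^sub>F n in sequentially. covariation (\<tau> n) (stop (step n x) (\<tau> n)) -
      J (\<tau> n) (stop_left (step n x) (\<tau> n)) (jump (step n x) (\<tau> n)) = covariation (\<tau> n) (stop_left (step n x) (\<tau> n))"
    using t1 \<tau>(2) ev_step_mem[OF x, of "t + 1"]
  proof eventually_elim
    case (elim n)
    have m: "stop (step n x) (\<tau> n) \<in> \<Omega>" using stop_step_mem[OF elim(3) elim(2)] elim(1) by simp
    show ?case
    proof (cases "\<tau> n = 0")
      case True
      have c: "cadlag (stop (step n x) (\<tau> n))" by (rule cadlag_mem[OF m])
      have "jump (step n x) (\<tau> n) = 0"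
        using jump_0[OF c] jump_stop[of 0 "\<tau> n" "step n x"] True by simp
      moreover have "stop_left (step n x) (\<tau> n) = stop (step n x) (\<tau> n)"
        using stop_left_0[OF c] stop_left_stop[of 0 "\<tau> n" "step n x"] True by simp
      ultimately show ?thesis by simp
    next
      case False
      then have "0 < \<tau> n" using elim(2) by simp
      from covariation_jump[OF m this] show ?thesis by (simp add: stop_left_stop jump_stop)
    qed
  qed
  ultimately show ?thesis by (simp add: Lim_transform_eventually)
qed

section \<open>Continuity of the covariation functional\<close>

lemma covariation_right_tendsto:
  assumes x: "x \<in> \<Omega>" and t: "0 \<le> t"
  shows "((\<lambda>s. covariation s x) \<longlongrightarrow> covariation t x) (at_right t)"
proof -
  have T: "0 \<le> t + 1" using t by simp
  obtain C where C: "0 \<le> C" and bd: "\<forall>s\<in>{0..t + 1}. \<forall>r\<in>{0..t + 1}. \<bar>covariation r x - covariation s x\<bar> \<le> C * \<bar>trace_qv r x - trace_qv s x\<bar>"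
    using cov_bound[OF x T] by blast
  have "((\<lambda>s. C * \<bar>trace_qv s x - trace_qv t x\<bar>) \<longlongrightarrow> C * \<bar>trace_qv t x - trace_qv t x\<bar>) (at_right t)"
    unfolding trace_qv_def by (intro tendsto_intros cadlag_right[OF cadlag_quad_var[OF x] t])
  then have "((\<lambda>s. C * \<bar>trace_qv s x - trace_qv t x\<bar>) \<longlongrightarrow> 0) (at_right t)" by simp
  moreover have "\<forall>\<^sub>F s in at_right t. norm (covariation s x - covariation t x) \<le> C * \<bar>trace_qv s x - trace_qv t x\<bar>"
    unfolding eventually_at_right_field using bd t by (intro exI[of _ "t + 1"]) auto
  ultimately have "((\<lambda>s. covariation s x - covariation t x) \<longlongrightarrow> 0) (at_right t)"
    by (rule Lim_null_comparison[rotated])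
  then show ?thesis by (rule LIM_zero_cancel)
qed

lemma covariation_left_tendsto:
  assumes x: "x \<in> \<Omega>" and t: "0 < t" and j: "jump x t = 0"
  shows "((\<lambda>s. covariation s x) \<longlongrightarrow> covariation t x) (at_left t)"
proof -
  have t0: "0 \<le> t" using t by simp
  obtain C where C: "0 \<le> C" and bd: "\<forall>s\<in>{0..t}. \<forall>r\<in>{0..t}. \<bar>covariation r x - covariation s x\<bar> \<le> C * \<bar>trace_qv r x - trace_qv s x\<bar>"
    using cov_bound[OF x t0] by blast
  have "(quad_var \<pi> x \<longlongrightarrow> quad_var \<pi> x t) (at_left t)"
    using cadlag_left[OF cadlag_quad_var[OF x] t0] qv_left_lim[OF x t0 j] by simp
  then have "((\<lambda>s. C * \<bar>trace_qv s x - trace_qv t x\<bar>) \<longlongrightarrow> C * \<bar>trace_qv t x - trace_qv t x\<bar>) (at_left t)"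
    unfolding trace_qv_def by (intro tendsto_intros)
  then have "((\<lambda>s. C * \<bar>trace_qv s x - trace_qv t x\<bar>) \<longlongrightarrow> 0) (at_left t)" by simp
  moreover have "\<forall>\<^sub>F s in at_left t. norm (covariation s x - covariation t x) \<le> C * \<bar>trace_qv s x - trace_qv t x\<bar>"
    unfolding eventually_at_left_field using bd t by (intro exI[of _ 0]) auto
  ultimately have "((\<lambda>s. covariation s x - covariation t x) \<longlongrightarrow> 0) (at_left t)"
    by (rule Lim_null_comparison[rotated])
  then show ?thesis by (rule LIM_zero_cancel)
qed

lemma covariation_stop_left:
  "x \<in> \<Omega> \<Longrightarrow> 0 < t \<Longrightarrow> covariation t (stop_left x t) = covariation t x - J t (stop_left x t) (jump x t)"
  using covariation_jump[of x t] covariation_stop[of x t] by simp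

lemma J_jump_tendsto_0:
  assumes x: "x \<in> \<Omega>" and lim: "(jump x \<longlongrightarrow> 0) F" and ev: "\<forall>\<^sub>F s in F. s \<in> {0..T}" and T: "0 \<le> T"
  shows "((\<lambda>s. J s (stop_left x s) (jump x s)) \<longlongrightarrow> 0) F"
proof -
  obtain C1 C2 where bd: "\<forall>s\<in>{0..T}. norm (\<phi> s (stop_left x s)) \<le> C1 \<and> norm (\<psi> s (stop_left x s)) \<le> C2"
    using bounded_pair[OF x T] by blast
  have "\<forall>\<^sub>F s in F. norm (\<phi> s (stop_left x s)) \<le> C1" "\<forall>\<^sub>F s in F. norm (\<psi> s (stop_left x s)) \<le> C2"
    using ev by (eventually_elim, use bd in blast)+
  then show ?thesis by (rule J_tendsto_0[OF lim])
qed

text \<open>Clause 2(b) differs from 2(a) by the J-term at s, which vanishes because the jumps of x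
  just after t do; 2(c) and 2(d) are the limits along step paths.\<close>

lemma covariation_right_continuous: "right_continuous \<pi> \<Omega> covariation"
  unfolding right_continuous_def
proof (intro ballI allI impI conjI)
  fix x t assume x: "x \<in> \<Omega>" and t: "0 \<le> (t::real)"
  have at: "at t within {t..} = at_right t" by (simp add: at_within_Ici_at_right)
  have ct: "covariation t (stop x t) = covariation t x" by (rule covariation_stop[OF x t])
  have "\<forall>\<^sub>F s in at_right t. covariation s x = covariation s (stop x s)"
    unfolding eventually_at_right_field using covariation_stop[OF x] t by (intro exI[of _ "t + 1"]) auto
  with covariation_right_tendsto[OF x t]
  show "((\<lambda>s. covariation s (stop x s)) \<longlongrightarrow> covariation t (stop x t)) (at t within {t..})"
    unfolding at ct by (rule Lim_transform_eventually)
  have "((\<lambda>s. J s (stop_left x s) (jump x s)) \<longlongrightarrow> 0) (at_right t)"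
  proof (rule J_jump_tendsto_0[OF x jump_tendsto_0_right[OF cadlag_mem[OF x] t], of "t + 1"])
    show "\<forall>\<^sub>F s in at_right t. s \<in> {0..t + 1}"
      unfolding eventually_at_right_field using t by (intro exI[of _ "t + 1"]) auto
  qed (use t in simp)
  from tendsto_diff[OF covariation_right_tendsto[OF x t] this]
  have "((\<lambda>s. covariation s x - J s (stop_left x s) (jump x s)) \<longlongrightarrow> covariation t x) (at_right t)" by simp
  moreover have "\<forall>\<^sub>F s in at_right t. covariation s x - J s (stop_left x s) (jump x s) = covariation s (stop_left x s)"
    unfolding eventually_at_right_field using covariation_stop_left[OF x] t by (intro exI[of _ "t + 1"]) auto
  ultimately show "((\<lambda>s. covariation s (stop_left x s)) \<longlongrightarrow> covariation t (stop x t)) (at t within {t<..})"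
    unfolding ct by (rule Lim_transform_eventually)
next
  fix x t \<tau> assume x: "x \<in> \<Omega>" and t: "0 \<le> (t::real)"
    and \<tau>: "\<tau> \<longlonglongrightarrow> t \<and> (\<forall>\<^sub>F n in sequentially. 0 \<le> \<tau> n \<and> \<tau> n \<ge> last_before \<pi> n t)"
  have ev: "\<forall>\<^sub>F n in sequentially. 0 \<le> \<tau> n" "\<forall>\<^sub>F n in sequentially. last_before \<pi> n t \<le> \<tau> n"
    using \<tau> by (auto elim: eventually_mono)
  show "(\<lambda>n. covariation (\<tau> n) (stop (step n x) (\<tau> n))) \<longlonglongrightarrow> covariation t (stop x t)"
    unfolding covariation_stop[OF x t]
    by (rule covariation_step_tendsto[OF x t conjunct1[OF \<tau>] ev(1) disjI1[OF ev(2)]])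
next
  fix x t \<tau> assume x: "x \<in> \<Omega>" and t: "0 \<le> (t::real)"
    and \<tau>: "\<tau> \<longlonglongrightarrow> t \<and> (\<forall>\<^sub>F n in sequentially. 0 \<le> \<tau> n \<and> \<tau> n > last_before \<pi> n t)"
  have ev: "\<forall>\<^sub>F n in sequentially. 0 \<le> \<tau> n" "\<forall>\<^sub>F n in sequentially. last_before \<pi> n t < \<tau> n"
    using \<tau> by (auto elim: eventually_mono)
  show "(\<lambda>n. covariation (\<tau> n) (stop_left (step n x) (\<tau> n))) \<longlonglongrightarrow> covariation t (stop x t)"
    unfolding covariation_stop[OF x t]
    by (rule covariation_step_left_tendsto[OF x t conjunct1[OF \<tau>] ev(1) disjI1[OF ev(2)]])
qed

text \<open>All left limits at \<open>t > 0\<close> are computed on the path stopped just before \<open>t\<close>, which does not jump at \<open>t\<close>.\<close>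

lemma covariation_left_continuous: "left_continuous \<pi> \<Omega> covariation"
  unfolding left_continuous_def
proof (intro ballI allI impI conjI)
  fix x t assume x: "x \<in> \<Omega>" and t: "0 \<le> (t::real)"
  define y where "y = stop_left x t"
  have y: "y \<in> \<Omega>" unfolding y_def by (rule stop_left_mem[OF x t])
  have jy: "jump y t = 0" unfolding y_def by (rule jump_stop_left)
  have sl: "stop_left x s = stop_left y s" if "s \<le> t" for s unfolding y_def using stop_left_stop_left[OF that] by metis
  have st: "stop x s = stop y s" if "s < t" for s unfolding y_def using stop_stop_left_less[OF that] by metis
  show "((\<lambda>s. covariation s (stop_left x s)) \<longlongrightarrow> covariation t (stop_left x t)) (at t within {0..t})"
  proof (cases "t = 0")
    case True
    then show ?thesis by (simp add: tendsto_def eventually_at_filter)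
  next
    case False
    then have t0: "0 < t" using t by simp
    have "((\<lambda>s. J s (stop_left y s) (jump y s)) \<longlongrightarrow> 0) (at_left t)"
    proof (rule J_jump_tendsto_0[OF y jump_tendsto_0_left[OF cadlag_mem[OF y] t0] _ t])
      show "\<forall>\<^sub>F s in at_left t. s \<in> {0..t}"
        unfolding eventually_at_left_field using t0 by (intro exI[of _ 0]) auto
    qed
    from tendsto_diff[OF covariation_left_tendsto[OF y t0 jy] this]
    have "((\<lambda>s. covariation s y - J s (stop_left y s) (jump y s)) \<longlongrightarrow> covariation t y) (at_left t)" by simp
    moreover have "\<forall>\<^sub>F s in at_left t. covariation s y - J s (stop_left y s) (jump y s) = covariation s (stop_left x s)"
      unfolding eventually_at_left_field using covariation_stop_left[OF y] sl t0 by (intro exI[of _ 0]) auto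
    ultimately have "((\<lambda>s. covariation s (stop_left x s)) \<longlongrightarrow> covariation t y) (at_left t)"
      by (rule Lim_transform_eventually)
    then show ?thesis unfolding at_within_Icc_at_left[OF t0] y_def .
  qed
  show "((\<lambda>s. covariation s (stop x s)) \<longlongrightarrow> covariation t (stop_left x t)) (at t within {0..<t})"
  proof (cases "t = 0")
    case False
    then have t0: "0 < t" using t by simp
    have at: "at t within {0..<t} = at_left t" using t0 by (intro at_within_nhd[of t "{0<..}"]) auto
    have "\<forall>\<^sub>F s in at_left t. covariation s y = covariation s (stop x s)"
      unfolding eventually_at_left_field using covariation_stop[OF y] st t0 by (intro exI[of _ 0]) auto
    with covariation_left_tendsto[OF y t0 jy] show ?thesis
      unfolding at y_def[symmetric] by (rule Lim_transform_eventually)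
  qed simp
next
  fix x t \<tau> assume x: "x \<in> \<Omega>" and t: "0 \<le> (t::real)"
    and \<tau>: "\<tau> \<longlonglongrightarrow> t \<and> (\<forall>\<^sub>F n in sequentially. 0 \<le> \<tau> n \<and> \<tau> n \<le> last_before \<pi> n t)"
  have ev: "\<forall>\<^sub>F n in sequentially. 0 \<le> \<tau> n" using \<tau> by (auto elim: eventually_mono)
  define y where "y = stop_left x t"
  have y: "y \<in> \<Omega>" unfolding y_def by (rule stop_left_mem[OF x t])
  have jy: "jump y t = 0" unfolding y_def by (rule jump_stop_left)
  have lim: "(\<lambda>n. covariation (\<tau> n) (stop_left (step n y) (\<tau> n))) \<longlonglongrightarrow> covariation t y"
    by (rule covariation_step_left_tendsto[OF y t conjunct1[OF \<tau>] ev disjI2[OF jy]])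
  show "(\<lambda>n. covariation (\<tau> n) (stop_left (step n x) (\<tau> n))) \<longlonglongrightarrow> covariation t (stop_left x t)"
  proof (cases "t = 0")
    case True
    have "\<forall>\<^sub>F n in sequentially. covariation (\<tau> n) (stop_left (step n x) (\<tau> n)) = 0"
      using conjunct2[OF \<tau>] ev_step_mem[OF x, of 0]
    proof eventually_elim
      case (elim n)
      have "\<tau> n = 0" using elim(1) True by simp
      moreover have "covariation 0 (stop_left (step n x) 0) = 0"
        by (rule covariation_0[OF stop_left_step_mem[OF elim(2)]]) simp_all
      ultimately show ?case by simp
    qed
    moreover have "covariation t (stop_left x t) = 0" using covariation_0[OF y] True by (simp add: y_def)
    ultimately show ?thesis by (simp add: tendsto_eventually)
  next
    case False
    then have t0: "0 < t" using t by simp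
    obtain j where j: "straddles j t" using straddling_cell[OF t0] by blast
    have "\<forall>\<^sub>F n in sequentially. covariation (\<tau> n) (stop_left (step n y) (\<tau> n)) = covariation (\<tau> n) (stop_left (step n x) (\<tau> n))"
      using conjunct2[OF \<tau>] j
    proof eventually_elim
      case (elim n)
      \<comment> \<open>Before t'_n both step paths use values at times up to t'_n < t only, where x
        and y agree.\<close>
      have "stop_left (step n y) (\<tau> n) = stop_left (step n x) (\<tau> n)"
        by (rule stop_left_step_path_cong[of "j n"]) (use elim in \<open>auto simp: y_def stop_left_def\<close>)
      then show ?case by simp
    qed
    with lim show ?thesis unfolding y_def[symmetric] by (rule Lim_transform_eventually)
  qed
next
  fix x t \<tau> assume x: "x \<in> \<Omega>" and t: "0 \<le> (t::real)"
    and \<tau>: "\<tau> \<longlonglongrightarrow> t \<and> (\<forall>\<^sub>F n in sequentially. 0 \<le> \<tau> n \<and> \<tau> n < last_before \<pi> n t)"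
  have ev: "\<forall>\<^sub>F n in sequentially. 0 \<le> \<tau> n" using \<tau> by (auto elim: eventually_mono)
  define y where "y = stop_left x t"
  have y: "y \<in> \<Omega>" unfolding y_def by (rule stop_left_mem[OF x t])
  have jy: "jump y t = 0" unfolding y_def by (rule jump_stop_left)
  \<comment> \<open>At t = 0 the hypothesis is contradictory, as it asks for 0 \<le> \<tau> n <
    0.\<close>
  have t0: "0 < t"
  proof (rule ccontr)
    assume "\<not> 0 < t"
    then have "t = 0" using t by simp
    have "\<forall>\<^sub>F n in sequentially. False"
      using conjunct2[OF \<tau>]
    proof eventually_elim
      case (elim n)
      then have "0 \<le> \<tau> n" "\<tau> n < 0" using \<open>t = 0\<close> by auto
      then show ?case by linarith
    qed
    then show False by simp
  qed
  have lim: "(\<lambda>n. covariation (\<tau> n) (stop (step n y) (\<tau> n))) \<longlonglongrightarrow> covariation t y"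
    by (rule covariation_step_tendsto[OF y t conjunct1[OF \<tau>] ev disjI2[OF jy]])
  obtain j where j: "straddles j t" using straddling_cell[OF t0] by blast
  have "\<forall>\<^sub>F n in sequentially. covariation (\<tau> n) (stop (step n y) (\<tau> n)) = covariation (\<tau> n) (stop (step n x) (\<tau> n))"
    using conjunct2[OF \<tau>] j
  proof eventually_elim
    case (elim n)
    have "step n y s = step n x s" if "s \<le> \<tau> n" for s
      by (rule step_path_cong[of "j n"]) (use elim that in \<open>auto simp: y_def stop_left_def\<close>)
    then have "stop (step n y) (\<tau> n) = stop (step n x) (\<tau> n)" by (simp add: stop_def fun_eq_iff)
    then show ?case by simp
  qed
  with lim show "(\<lambda>n. covariation (\<tau> n) (stop (step n x) (\<tau> n))) \<longlonglongrightarrow> covariation t (stop_left x t)"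
    unfolding y_def[symmetric] by (rule Lim_transform_eventually)
qed

end

subsection \<open>The product formula\<close>


lemma binop_tendsto:
  assumes "isCont (\<lambda>p. f (fst p) (snd p)) (l, m)" "(u \<longlongrightarrow> l) F" "(v \<longlongrightarrow> m) F"
  shows "((\<lambda>x. f (u x) (v x)) \<longlongrightarrow> f l m) F"
  using isCont_tendsto_compose[OF assms(1) tendsto_Pair[OF assms(2,3)]] by simp

lemma left_continuous_binop:
  assumes c: "\<And>p. isCont (\<lambda>p. f (fst p) (snd p)) p"
    and F: "left_continuous \<pi> \<Omega> F" and G: "left_continuous \<pi> \<Omega> G"
  shows "left_continuous \<pi> \<Omega> (\<lambda>t y. f (F t y) (G t y))"
  unfolding left_continuous_def
  by (intro ballI allI impI conjI; rule binop_tendsto[OF c];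
      insert F G, unfold left_continuous_def, blast)

lemma right_continuous_binop:
  assumes c: "\<And>p. isCont (\<lambda>p. f (fst p) (snd p)) p"
    and F: "right_continuous \<pi> \<Omega> F" and G: "right_continuous \<pi> \<Omega> G"
  shows "right_continuous \<pi> \<Omega> (\<lambda>t y. f (F t y) (G t y))"
  unfolding right_continuous_def
  by (intro ballI allI impI conjI; rule binop_tendsto[OF c];
      insert F G, unfold right_continuous_def, blast)

context generic_paths
begin

lemma stop_0_stop_left_step:
  assumes "stop (step n x) T \<in> \<Omega>" "0 \<le> \<tau>" "\<tau> \<le> T"
  shows "stop (stop_left (step n x) \<tau>) 0 = stop (step n x) 0"
  using stop_0_stop_left[OF cadlag_mem[OF assms(1)] assms(2)] assms by (simp add: stop_left_stop)

text \<open>Stopping does not touch the initial value, so for a fixed path the functional is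
  constant in t. Along step paths the initial value is x(t_1), and 2(c) at time 0 is needed.\<close>

lemma initial_value_continuous:
  assumes rc: "right_continuous \<pi> \<Omega> F"
  shows "left_continuous \<pi> \<Omega> (\<lambda>t y. F 0 (stop y 0))" "right_continuous \<pi> \<Omega> (\<lambda>t y. F 0 (stop y 0))"
proof -
  have sl: "F 0 (stop (stop_left x s) 0) = F 0 (stop x 0)" if "x \<in> \<Omega>" "0 \<le> s" for x s
    using stop_0_stop_left[OF cadlag_mem[OF that(1)] that(2)] by simp
  have st: "F 0 (stop (stop x s) 0) = F 0 (stop x 0)" if "0 \<le> s" for x :: "real \<Rightarrow> real ^ 'm" and s
    using that by simp
  have ev1: "\<forall>\<^sub>F s in at t within S. F 0 (stop x 0) = F 0 (stop (stop_left x s) 0)"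
    if "x \<in> \<Omega>" "S \<subseteq> {0..}" for x t S
    using that sl[OF that(1)] by (auto simp: eventually_at_filter intro!: always_eventually)
  have ev2: "\<forall>\<^sub>F s in at t within S. F 0 (stop x 0) = F 0 (stop (stop x s) 0)"
    if "S \<subseteq> {0..}" for x :: "real \<Rightarrow> real ^ 'm" and t S
    using that by (auto simp: eventually_at_filter intro!: always_eventually)
  have lim1: "(\<lambda>n. F 0 (stop (stop_left (step n x) (\<tau> n)) 0)) \<longlonglongrightarrow> F 0 (stop x 0)"
    if x: "x \<in> \<Omega>" and \<tau>: "\<tau> \<longlonglongrightarrow> t" "\<forall>\<^sub>F n in sequentially. 0 \<le> \<tau> n" for x \<tau> t
  proof (rule Lim_transform_eventually[OF right_continuous_step_tendsto[OF rc x order_refl]])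
    have "\<forall>\<^sub>F n in sequentially. \<tau> n < t + 1" using \<tau>(1) by (rule order_tendstoD) simp
    then show "\<forall>\<^sub>F n in sequentially. F 0 (stop (step n x) 0) = F 0 (stop (stop_left (step n x) (\<tau> n)) 0)"
      using \<tau>(2) ev_step_mem[OF x, of "t + 1"]
    proof eventually_elim
      case (elim n)
      show ?case using stop_0_stop_left_step[OF elim(3,2)] elim(1) by simp
    qed
  qed
  have lim2: "(\<lambda>n. F 0 (stop (stop (step n x) (\<tau> n)) 0)) \<longlonglongrightarrow> F 0 (stop x 0)"
    if x: "x \<in> \<Omega>" and \<tau>: "\<forall>\<^sub>F n in sequentially. 0 \<le> \<tau> n" for x \<tau>
  proof (rule Lim_transform_eventually[OF right_continuous_step_tendsto[OF rc x order_refl]])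
    show "\<forall>\<^sub>F n in sequentially. F 0 (stop (step n x) 0) = F 0 (stop (stop (step n x) (\<tau> n)) 0)"
      using \<tau> by eventually_elim simp
  qed
  have nn: "\<forall>\<^sub>F n in sequentially. 0 \<le> \<tau> n" if "\<forall>\<^sub>F n in sequentially. 0 \<le> \<tau> n \<and> Q n" for \<tau> :: "nat \<Rightarrow> real" and Q
    using that by (rule eventually_mono) simp
  show "left_continuous \<pi> \<Omega> (\<lambda>t y. F 0 (stop y 0))"
    unfolding left_continuous_def
  proof (intro ballI allI impI conjI)
    fix x t assume x: "x \<in> \<Omega>" and t: "0 \<le> (t::real)"
    show "((\<lambda>s. F 0 (stop (stop_left x s) 0)) \<longlongrightarrow> F 0 (stop (stop_left x t) 0)) (at t within {0..t})"
      unfolding sl[OF x t] by (rule Lim_transform_eventually[OF tendsto_const ev1[OF x]]) auto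
    show "((\<lambda>s. F 0 (stop (stop x s) 0)) \<longlongrightarrow> F 0 (stop (stop_left x t) 0)) (at t within {0..<t})"
      unfolding sl[OF x t] by (rule Lim_transform_eventually[OF tendsto_const ev2]) auto
  next
    fix x t \<tau> assume x: "x \<in> \<Omega>" and t: "0 \<le> (t::real)"
      and \<tau>: "\<tau> \<longlonglongrightarrow> t \<and> (\<forall>\<^sub>F n in sequentially. 0 \<le> \<tau> n \<and> \<tau> n \<le> last_before \<pi> n t)"
    show "(\<lambda>n. F 0 (stop (stop_left (step n x) (\<tau> n)) 0)) \<longlonglongrightarrow> F 0 (stop (stop_left x t) 0)"
      unfolding sl[OF x t] by (rule lim1[OF x conjunct1[OF \<tau>] nn[OF conjunct2[OF \<tau>]]])
  next
    fix x t \<tau> assume x: "x \<in> \<Omega>" and t: "0 \<le> (t::real)"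
      and \<tau>: "\<tau> \<longlonglongrightarrow> t \<and> (\<forall>\<^sub>F n in sequentially. 0 \<le> \<tau> n \<and> \<tau> n < last_before \<pi> n t)"
    show "(\<lambda>n. F 0 (stop (stop (step n x) (\<tau> n)) 0)) \<longlonglongrightarrow> F 0 (stop (stop_left x t) 0)"
      unfolding sl[OF x t] by (rule lim2[OF x nn[OF conjunct2[OF \<tau>]]])
  qed
  show "right_continuous \<pi> \<Omega> (\<lambda>t y. F 0 (stop y 0))"
    unfolding right_continuous_def
  proof (intro ballI allI impI conjI)
    fix x t assume x: "x \<in> \<Omega>" and t: "0 \<le> (t::real)"
    show "((\<lambda>s. F 0 (stop (stop x s) 0)) \<longlongrightarrow> F 0 (stop (stop x t) 0)) (at t within {t..})"
      unfolding st[OF t] by (rule Lim_transform_eventually[OF tendsto_const ev2]) (use t in auto)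
    show "((\<lambda>s. F 0 (stop (stop_left x s) 0)) \<longlongrightarrow> F 0 (stop (stop x t) 0)) (at t within {t<..})"
      unfolding st[OF t] by (rule Lim_transform_eventually[OF tendsto_const ev1[OF x]]) (use t in auto)
  next
    fix x t \<tau> assume x: "x \<in> \<Omega>" and t: "0 \<le> (t::real)"
      and \<tau>: "\<tau> \<longlonglongrightarrow> t \<and> (\<forall>\<^sub>F n in sequentially. 0 \<le> \<tau> n \<and> \<tau> n \<ge> last_before \<pi> n t)"
    show "(\<lambda>n. F 0 (stop (stop (step n x) (\<tau> n)) 0)) \<longlonglongrightarrow> F 0 (stop (stop x t) 0)"
      unfolding st[OF t] by (rule lim2[OF x nn[OF conjunct2[OF \<tau>]]])
  next
    fix x t \<tau> assume x: "x \<in> \<Omega>" and t: "0 \<le> (t::real)"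
      and \<tau>: "\<tau> \<longlonglongrightarrow> t \<and> (\<forall>\<^sub>F n in sequentially. 0 \<le> \<tau> n \<and> \<tau> n > last_before \<pi> n t)"
    show "(\<lambda>n. F 0 (stop (stop_left (step n x) (\<tau> n)) 0)) \<longlonglongrightarrow> F 0 (stop (stop x t) 0)"
      unfolding st[OF t] by (rule lim1[OF x conjunct1[OF \<tau>] nn[OF conjunct2[OF \<tau>]]])
  qed
qed

text \<open>Local boundedness along the step paths is a compactness consequence of continuity.\<close>

lemma continuous_functional_bounded:
  fixes F :: "('m, real) functional"
  assumes lc: "left_continuous \<pi> \<Omega> F" and rc: "right_continuous \<pi> \<Omega> F" and x: "x \<in> \<Omega>" and T: "0 \<le> T"
  shows "\<exists>C. \<forall>\<^sub>F n in sequentially. \<forall>r\<in>{0..T}. \<bar>F r (stop_left (step n x) r)\<bar> \<le> C"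
proof -
  have loc: "\<exists>d>0. \<exists>C. \<forall>\<^sub>F n in sequentially. \<forall>r. 0 \<le> r \<longrightarrow> \<bar>r - t\<bar> < d \<longrightarrow> \<bar>F r (stop_left (step n x) r)\<bar> \<le> C"
    if t: "0 \<le> t" for t
  proof -
    let ?X = "\<lambda>n r. F r (stop_left (step n x) r)"
    have "\<exists>d>0. \<exists>N. \<forall>n\<ge>N. \<forall>r. 0 \<le> r \<and> r \<le> last_before \<pi> n t \<longrightarrow> \<bar>r - t\<bar> < d \<longrightarrow> dist (?X n r) (F t (stop_left x t)) < 1"
    proof (rule seq_limit_uniform[where P = "\<lambda>n r. 0 \<le> r \<and> r \<le> last_before \<pi> n t" and \<sigma> = "\<lambda>n. last_before \<pi> n t"])
      show "(\<lambda>n. ?X n (\<tau> n)) \<longlonglongrightarrow> F t (stop_left x t)"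
        if "\<tau> \<longlonglongrightarrow> t" "\<forall>\<^sub>F n in sequentially. 0 \<le> \<tau> n \<and> \<tau> n \<le> last_before \<pi> n t" for \<tau>
        using lc x t that unfolding left_continuous_def by blast
    qed (simp_all add: last_before_tendsto t last_before_nonneg)
    then obtain d1 N1 where d1: "0 < d1" and N1: "\<forall>n\<ge>N1. \<forall>r. 0 \<le> r \<and> r \<le> last_before \<pi> n t \<longrightarrow> \<bar>r - t\<bar> < d1 \<longrightarrow> dist (?X n r) (F t (stop_left x t)) < 1"
      by blast
    \<comment> \<open>A sequence strictly above \<open>last_before\<close> that still tends to t,
      the witness required for the right-hand half.\<close>
    have fill: "(\<lambda>n. last_before \<pi> n t + inverse (real (Suc n))) \<longlonglongrightarrow> t + 0"
      by (intro tendsto_add last_before_tendsto[OF t] LIMSEQ_inverse_real_of_nat)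
    have "\<exists>d>0. \<exists>N. \<forall>n\<ge>N. \<forall>r. 0 \<le> r \<and> last_before \<pi> n t < r \<longrightarrow> \<bar>r - t\<bar> < d \<longrightarrow> dist (?X n r) (F t (stop x t)) < 1"
    proof (rule seq_limit_uniform[where P = "\<lambda>n r. 0 \<le> r \<and> last_before \<pi> n t < r" and \<sigma> = "\<lambda>n. last_before \<pi> n t + inverse (real (Suc n))"])
      show "(\<lambda>n. ?X n (\<tau> n)) \<longlonglongrightarrow> F t (stop x t)"
        if "\<tau> \<longlonglongrightarrow> t" "\<forall>\<^sub>F n in sequentially. 0 \<le> \<tau> n \<and> last_before \<pi> n t < \<tau> n" for \<tau>
        using rc x t that unfolding right_continuous_def by blast
      show "(\<lambda>n. last_before \<pi> n t + inverse (real (Suc n))) \<longlonglongrightarrow> t" using fill by simp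
      show "\<forall>\<^sub>F n in sequentially. 0 \<le> last_before \<pi> n t + inverse (real (Suc n)) \<and> last_before \<pi> n t < last_before \<pi> n t + inverse (real (Suc n))"
        by (intro always_eventually allI conjI add_nonneg_nonneg last_before_nonneg) simp_all
    qed simp
    then obtain d2 N2 where d2: "0 < d2" and N2: "\<forall>n\<ge>N2. \<forall>r. 0 \<le> r \<and> last_before \<pi> n t < r \<longrightarrow> \<bar>r - t\<bar> < d2 \<longrightarrow> dist (?X n r) (F t (stop x t)) < 1"
      by blast
    \<comment> \<open>Times up to t'_n are governed by the value at x_{t-}, later ones by the value
      at x_t; the 1 is the tolerance in the two uniform estimates.\<close>
    define C where "C = max \<bar>F t (stop_left x t)\<bar> \<bar>F t (stop x t)\<bar> + 1"
    have "\<forall>\<^sub>F n in sequentially. \<forall>r. 0 \<le> r \<longrightarrow> \<bar>r - t\<bar> < min d1 d2 \<longrightarrow> \<bar>?X n r\<bar> \<le> C"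
      using eventually_ge_at_top[of "max N1 N2"]
    proof eventually_elim
      case (elim n)
      show ?case
      proof (intro allI impI)
        fix r assume r: "0 \<le> r" "\<bar>r - t\<bar> < min d1 d2"
        show "\<bar>?X n r\<bar> \<le> C"
        proof (cases "r \<le> last_before \<pi> n t")
          case True
          then have "dist (?X n r) (F t (stop_left x t)) < 1" using N1[rule_format, of n r] elim r by simp
          then show ?thesis unfolding C_def dist_real_def by linarith
        next
          case False
          then have "dist (?X n r) (F t (stop x t)) < 1" using N2[rule_format, of n r] elim r by simp
          then show ?thesis unfolding C_def dist_real_def by linarith
        qed
      qed
    qed
    then show ?thesis using d1 d2 by (intro exI[of _ "min d1 d2"] conjI exI[of _ C]) auto
  qed
  then have "\<forall>t\<in>{0..T}. \<exists>d. 0 < d \<and> (\<exists>C. \<forall>\<^sub>F n in sequentially. \<forall>r. 0 \<le> r \<longrightarrow> \<bar>r - t\<bar> < d \<longrightarrow> \<bar>F r (stop_left (step n x) r)\<bar> \<le> C)"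
    by auto
  then obtain d where d: "\<forall>t\<in>{0..T}. 0 < d t \<and> (\<exists>C. \<forall>\<^sub>F n in sequentially. \<forall>r. 0 \<le> r \<longrightarrow> \<bar>r - t\<bar> < d t \<longrightarrow> \<bar>F r (stop_left (step n x) r)\<bar> \<le> C)"
    by (rule bchoice[THEN exE])
  then have "\<forall>t\<in>{0..T}. \<exists>C. \<forall>\<^sub>F n in sequentially. \<forall>r. 0 \<le> r \<longrightarrow> \<bar>r - t\<bar> < d t \<longrightarrow> \<bar>F r (stop_left (step n x) r)\<bar> \<le> C"
    by blast
  then obtain C where C: "\<forall>t\<in>{0..T}. \<forall>\<^sub>F n in sequentially. \<forall>r. 0 \<le> r \<longrightarrow> \<bar>r - t\<bar> < d t \<longrightarrow> \<bar>F r (stop_left (step n x) r)\<bar> \<le> C t"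
    by (rule bchoice[THEN exE])
  have cover: "{0..T} \<subseteq> (\<Union>t\<in>{0..T}. ball t (d t))"
  proof
    fix t assume "t \<in> {0..T}"
    then show "t \<in> (\<Union>t\<in>{0..T}. ball t (d t))" using d by (intro UN_I[of t]) auto
  qed
  obtain S where S: "S \<subseteq> {0..T}" "finite S" "{0..T} \<subseteq> (\<Union>t\<in>S. ball t (d t))"
    using compactE_image[OF compact_Icc _ cover] by blast
  have "\<forall>\<^sub>F n in sequentially. \<forall>t\<in>S. \<forall>r. 0 \<le> r \<longrightarrow> \<bar>r - t\<bar> < d t \<longrightarrow> \<bar>F r (stop_left (step n x) r)\<bar> \<le> C t"
    using S(1) C by (intro eventually_ball_finite S(2)) blast
  then have "\<forall>\<^sub>F n in sequentially. \<forall>r\<in>{0..T}. \<bar>F r (stop_left (step n x) r)\<bar> \<le> (\<Sum>t\<in>S. \<bar>C t\<bar>)"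
  proof eventually_elim
    case (elim n)
    show ?case
    proof
      fix r assume r: "r \<in> {0..T}"
      then obtain t where t: "t \<in> S" "r \<in> ball t (d t)" using S(3) by blast
      then have "\<bar>F r (stop_left (step n x) r)\<bar> \<le> C t"
        using elim[rule_format, OF t(1), of r] r by (simp add: dist_real_def abs_minus_commute)
      also have "\<dots> \<le> \<bar>C t\<bar>" by simp
      also have "\<dots> \<le> (\<Sum>t\<in>S. \<bar>C t\<bar>)" by (rule member_le_sum[OF t(1) _ S(2)]) simp
      finally show "\<bar>F r (stop_left (step n x) r)\<bar> \<le> (\<Sum>t\<in>S. \<bar>C t\<bar>)" .
    qed
  qed
  then show ?thesis by blast
qed

text \<open>B reads the path strictly before t and there equals H. The bracket has this form,
  although H, which contains the integrals up to t, need not be strictly causal.\<close>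

definition left_version :: "('m, 'b) functional \<Rightarrow> ('m, 'b) functional \<Rightarrow> bool" where
  "left_version B H \<longleftrightarrow> (\<forall>x\<in>\<Omega>. \<forall>t\<ge>0. B t (stop x t) = H t (stop_left x t))"

lemma left_version_stop: "left_version B H \<Longrightarrow> x \<in> \<Omega> \<Longrightarrow> 0 \<le> t \<Longrightarrow> B t (stop x t) = H t (stop_left x t)"
  unfolding left_version_def by blast

lemma left_version_stop_left:
  assumes "left_version B H" "x \<in> \<Omega>" "0 \<le> t"
  shows "B t (stop_left x t) = H t (stop_left x t)"
  using left_version_stop[OF assms(1) stop_left_mem[OF assms(2,3)] assms(3)] by (simp add: stop_left_stop_left)

lemma left_version_step:
  assumes "left_version B H" "stop (step n x) T \<in> \<Omega>" "0 \<le> t" "t \<le> T"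
  shows "B t (stop (step n x) t) = H t (stop_left (step n x) t)"
    and "B t (stop_left (step n x) t) = H t (stop_left (step n x) t)"
proof -
  have m: "stop (step n x) t \<in> \<Omega>" by (rule stop_step_mem[OF assms(2-4)])
  show "B t (stop (step n x) t) = H t (stop_left (step n x) t)"
    using left_version_stop[OF assms(1) m assms(3)] by (simp add: stop_left_stop)
  show "B t (stop_left (step n x) t) = H t (stop_left (step n x) t)"
    using left_version_stop_left[OF assms(1) m assms(3)] by (simp add: stop_left_stop)
qed

lemma left_version_strictly_causal: "left_version B H \<Longrightarrow> strictly_causal \<Omega> B"
  unfolding strictly_causal_def using left_version_stop left_version_stop_left by (metis (no_types))

text \<open>Since B turns a stopped path into a left-stopped one, clauses 1(b) and 1(d) for B are
  instances of 1(a) and 1(c) for H.\<close>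

lemma left_version_left_continuous:
  assumes lv: "left_version B H" and H: "left_continuous \<pi> \<Omega> H"
  shows "left_continuous \<pi> \<Omega> B"
  unfolding left_continuous_def
proof (intro ballI allI impI conjI)
  fix x t assume x: "x \<in> \<Omega>" and t: "0 \<le> (t::real)"
  have lim: "((\<lambda>s. H s (stop_left x s)) \<longlongrightarrow> H t (stop_left x t)) (at t within {0..t})"
    using H x t unfolding left_continuous_def by blast
  have "\<forall>\<^sub>F s in at t within {0..t}. H s (stop_left x s) = B s (stop_left x s)"
    using left_version_stop_left[OF lv x] by (auto simp: eventually_at_filter)
  with lim show "((\<lambda>s. B s (stop_left x s)) \<longlongrightarrow> B t (stop_left x t)) (at t within {0..t})"
    unfolding left_version_stop_left[OF lv x t] by (rule Lim_transform_eventually)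
  have "((\<lambda>s. H s (stop_left x s)) \<longlongrightarrow> H t (stop_left x t)) (at t within {0..<t})"
    by (rule tendsto_within_subset[OF lim]) auto
  moreover have "\<forall>\<^sub>F s in at t within {0..<t}. H s (stop_left x s) = B s (stop x s)"
    using left_version_stop[OF lv x] by (auto simp: eventually_at_filter)
  ultimately show "((\<lambda>s. B s (stop x s)) \<longlongrightarrow> B t (stop_left x t)) (at t within {0..<t})"
    unfolding left_version_stop_left[OF lv x t] by (rule Lim_transform_eventually)
next
  fix x t \<tau> assume x: "x \<in> \<Omega>" and t: "0 \<le> (t::real)"
    and \<tau>: "\<tau> \<longlonglongrightarrow> t \<and> (\<forall>\<^sub>F n in sequentially. 0 \<le> \<tau> n \<and> \<tau> n \<le> last_before \<pi> n t)"
  have lim: "(\<lambda>n. H (\<tau> n) (stop_left (step n x) (\<tau> n))) \<longlonglongrightarrow> H t (stop_left x t)"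
    using H x t \<tau> unfolding left_continuous_def by blast
  have "\<forall>\<^sub>F n in sequentially. \<tau> n < t + 1" using conjunct1[OF \<tau>] by (rule order_tendstoD) simp
  then have "\<forall>\<^sub>F n in sequentially. H (\<tau> n) (stop_left (step n x) (\<tau> n)) = B (\<tau> n) (stop_left (step n x) (\<tau> n))"
    using conjunct2[OF \<tau>] ev_step_mem[OF x, of "t + 1"]
  proof eventually_elim
    case (elim n)
    then show ?case using left_version_step(2)[OF lv elim(3), of "\<tau> n"] by simp
  qed
  with lim show "(\<lambda>n. B (\<tau> n) (stop_left (step n x) (\<tau> n))) \<longlonglongrightarrow> B t (stop_left x t)"
    unfolding left_version_stop_left[OF lv x t] by (rule Lim_transform_eventually)
next
  fix x t \<tau> assume x: "x \<in> \<Omega>" and t: "0 \<le> (t::real)"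
    and \<tau>: "\<tau> \<longlonglongrightarrow> t \<and> (\<forall>\<^sub>F n in sequentially. 0 \<le> \<tau> n \<and> \<tau> n < last_before \<pi> n t)"
  have "\<forall>\<^sub>F n in sequentially. 0 \<le> \<tau> n \<and> \<tau> n \<le> last_before \<pi> n t"
    using conjunct2[OF \<tau>] by (rule eventually_mono) simp
  then have lim: "(\<lambda>n. H (\<tau> n) (stop_left (step n x) (\<tau> n))) \<longlonglongrightarrow> H t (stop_left x t)"
    using H x t conjunct1[OF \<tau>] unfolding left_continuous_def by blast
  have "\<forall>\<^sub>F n in sequentially. \<tau> n < t + 1" using conjunct1[OF \<tau>] by (rule order_tendstoD) simp
  then have "\<forall>\<^sub>F n in sequentially. H (\<tau> n) (stop_left (step n x) (\<tau> n)) = B (\<tau> n) (stop (step n x) (\<tau> n))"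
    using conjunct2[OF \<tau>] ev_step_mem[OF x, of "t + 1"]
  proof eventually_elim
    case (elim n)
    then show ?case using left_version_step(1)[OF lv elim(3), of "\<tau> n"] by simp
  qed
  with lim show "(\<lambda>n. B (\<tau> n) (stop (step n x) (\<tau> n))) \<longlonglongrightarrow> B t (stop_left x t)"
    unfolding left_version_stop_left[OF lv x t] by (rule Lim_transform_eventually)
qed

end

section \<open>The candidate primitive and its gradient\<close>

locale integral_pair = generic_Q \<pi> \<Omega> for \<pi> and \<Omega> :: "(real \<Rightarrow> real ^ 'm::finite) set" +
  fixes \<phi> \<psi> :: "('m, real ^ 'm) functional" and F G :: "('m, real) functional"
  assumes F: "F \<in> M_b \<pi> \<Omega>" and F\<phi>: "agree (space_grad F) \<phi>"
    and G: "G \<in> M_b \<pi> \<Omega>" and G\<psi>: "agree (space_grad G) \<psi>"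
begin

sublocale integrand_pair \<pi> \<Omega> \<phi> \<psi>
  by unfold_locales (rule integrand_space_grad[OF F F\<phi>], rule integrand_space_grad[OF G G\<psi>])

definition F0 :: "('m, real) functional" where "F0 t y = F t y - F 0 (stop y 0)"
definition G0 :: "('m, real) functional" where "G0 t y = G t y - G 0 (stop y 0)"
definition K :: "('m, real) functional" where "K t y = F0 t y * G0 t y - covariation t y"
definition H :: "('m, real ^ 'm) functional" where "H t y = F0 t y *\<^sub>R \<psi> t y + G0 t y *\<^sub>R \<phi> t y"

lemma cont_FG: "left_continuous \<pi> \<Omega> F" "right_continuous \<pi> \<Omega> F" "left_continuous \<pi> \<Omega> G" "right_continuous \<pi> \<Omega> G"
  using F G by (auto simp: M_b_def continuous_functional_def)

lemma cont_F0: "left_continuous \<pi> \<Omega> F0" "right_continuous \<pi> \<Omega> F0"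
  unfolding F0_def
  by (rule left_continuous_binop[where f = "(-)"] right_continuous_binop[where f = "(-)"];
      (intro continuous_intros cont_FG initial_value_continuous)?)+

lemma cont_G0: "left_continuous \<pi> \<Omega> G0" "right_continuous \<pi> \<Omega> G0"
  unfolding G0_def
  by (rule left_continuous_binop[where f = "(-)"] right_continuous_binop[where f = "(-)"];
      (intro continuous_intros cont_FG initial_value_continuous)?)+

lemma cont_K: "continuous_functional \<pi> \<Omega> K"
proof -
  have "left_continuous \<pi> \<Omega> (\<lambda>t y. F0 t y * G0 t y)" "right_continuous \<pi> \<Omega> (\<lambda>t y. F0 t y * G0 t y)"
    by (rule left_continuous_binop[OF _ cont_F0(1) cont_G0(1)] right_continuous_binop[OF _ cont_F0(2) cont_G0(2)],
        intro continuous_intros)+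
  note prod = this
  have "left_continuous \<pi> \<Omega> (\<lambda>t y. F0 t y * G0 t y - covariation t y)"
    by (rule left_continuous_binop[OF _ prod(1) covariation_left_continuous]) (intro continuous_intros)
  moreover have "right_continuous \<pi> \<Omega> (\<lambda>t y. F0 t y * G0 t y - covariation t y)"
    by (rule right_continuous_binop[OF _ prod(2) covariation_right_continuous]) (intro continuous_intros)
  ultimately show ?thesis unfolding continuous_functional_def K_def ..
qed

lemma left_continuous_H: "left_continuous \<pi> \<Omega> H"
proof -
  have lc: "left_continuous \<pi> \<Omega> \<phi>" "left_continuous \<pi> \<Omega> \<psi>" using int\<phi> int\<psi> by (auto simp: integrand_def)
  have "left_continuous \<pi> \<Omega> (\<lambda>t y. F0 t y *\<^sub>R \<psi> t y)"
    by (rule left_continuous_binop[OF _ cont_F0(1) lc(2)], intro continuous_intros)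
  moreover have "left_continuous \<pi> \<Omega> (\<lambda>t y. G0 t y *\<^sub>R \<phi> t y)"
    by (rule left_continuous_binop[OF _ cont_G0(1) lc(1)], intro continuous_intros)
  ultimately show ?thesis unfolding H_def
    by (rule left_continuous_binop[rotated 1, where f = "(+)"]) (intro continuous_intros)
qed

lemma integral_eq:
  assumes "x \<in> \<Omega>" "0 \<le> t"
  shows "pathwise_integral \<pi> \<phi> t x = F0 t (stop x t)" "pathwise_integral \<pi> \<psi> t x = G0 t (stop x t)"
  using pathwise_integral_eq[OF F F\<phi> assms] pathwise_integral_eq[OF G G\<psi> assms] assms(2)
  by (simp_all add: F0_def G0_def)

lemma bracket_left_version: "left_version (bracket \<pi> \<phi> \<psi>) H"
  unfolding left_version_def
proof (intro ballI allI impI)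
  fix x t assume x: "x \<in> \<Omega>" and t: "0 \<le> (t::real)"
  show "bracket \<pi> \<phi> \<psi> t (stop x t) = H t (stop_left x t)"
    using integral_eq[OF stop_left_mem[OF x t] t] by (simp add: bracket_def H_def stop_left_stop)
qed

text \<open>The integrands are locally bounded by hypothesis; for the integrals \<open>F0\<close>
  and \<open>G0\<close> the bound comes from their continuity.\<close>

lemma bracket_locally_bounded: "locally_bounded \<pi> \<Omega> (bracket \<pi> \<phi> \<psi>)"
  unfolding locally_bounded_def
proof (intro ballI allI impI)
  fix x T assume x: "x \<in> \<Omega>" and T: "0 \<le> (T::real)"
  obtain C1 C2 where C: "0 \<le> C1" "0 \<le> C2" and ev: "\<forall>\<^sub>F n in sequentially. \<forall>r\<in>{0..T}.
      norm (\<phi> r (stop_left (step n x) r)) \<le> C1 \<and> norm (\<psi> r (stop_left (step n x) r)) \<le> C2"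
    using bounded_pair[OF x T] by blast
  obtain C3 where C3: "\<forall>\<^sub>F n in sequentially. \<forall>r\<in>{0..T}. \<bar>F0 r (stop_left (step n x) r)\<bar> \<le> C3"
    using continuous_functional_bounded[OF cont_F0 x T] by blast
  obtain C4 where C4: "\<forall>\<^sub>F n in sequentially. \<forall>r\<in>{0..T}. \<bar>G0 r (stop_left (step n x) r)\<bar> \<le> C4"
    using continuous_functional_bounded[OF cont_G0 x T] by blast
  have "\<forall>\<^sub>F n in sequentially. stop (step n x) T \<in> \<Omega> \<and> (\<forall>t\<in>{0..T}. norm (bracket \<pi> \<phi> \<psi> t (stop (step n x) t)) \<le> C3 * C2 + C4 * C1)"
    using ev C3 C4 ev_step_mem[OF x, of T]
  proof eventually_elim
    case (elim n)
    have "norm (bracket \<pi> \<phi> \<psi> t (stop (step n x) t)) \<le> C3 * C2 + C4 * C1" if t: "t \<in> {0..T}" for t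
    proof -
      have "norm (bracket \<pi> \<phi> \<psi> t (stop (step n x) t)) = norm (H t (stop_left (step n x) t))"
        using left_version_step(1)[OF bracket_left_version elim(4), of t] t by simp
      moreover have "norm (H t (stop_left (step n x) t)) \<le>
          \<bar>F0 t (stop_left (step n x) t)\<bar> * norm (\<psi> t (stop_left (step n x) t)) +
          \<bar>G0 t (stop_left (step n x) t)\<bar> * norm (\<phi> t (stop_left (step n x) t))"
        unfolding H_def by (rule order_trans[OF norm_triangle_ineq]) simp
      moreover have "\<bar>F0 t (stop_left (step n x) t)\<bar> * norm (\<psi> t (stop_left (step n x) t)) \<le> C3 * C2"
      proof (rule mult_mono)
        show "\<bar>F0 t (stop_left (step n x) t)\<bar> \<le> C3" using elim(2) t by blast
        then show "0 \<le> C3" by linarith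
        show "norm (\<psi> t (stop_left (step n x) t)) \<le> C2" using elim(1) t by blast
      qed simp
      moreover have "\<bar>G0 t (stop_left (step n x) t)\<bar> * norm (\<phi> t (stop_left (step n x) t)) \<le> C4 * C1"
      proof (rule mult_mono)
        show "\<bar>G0 t (stop_left (step n x) t)\<bar> \<le> C4" using elim(3) t by blast
        then show "0 \<le> C4" by linarith
        show "norm (\<phi> t (stop_left (step n x) t)) \<le> C1" using elim(1) t by blast
      qed simp
      ultimately show ?thesis by linarith
    qed
    with elim(4) show ?case by blast
  qed
  then show "\<exists>n0. (\<forall>n\<ge>n0. stop (step n x) T \<in> \<Omega>) \<and>
        (\<exists>C. \<forall>n\<ge>n0. \<forall>t\<in>{0..T}. norm (bracket \<pi> \<phi> \<psi> t (stop (step n x) t)) \<le> C)"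
    unfolding eventually_sequentially by blast
qed

lemma flat_K: "flat K"
  unfolding flat_def
proof (intro ballI allI impI)
  fix x a b assume "x \<in> \<Omega>" "0 \<le> (a::real)" "a \<le> b"
  from flatD[OF M_b_flat[OF F] this] flatD[OF M_b_flat[OF G] this] flatD[OF covariation_flat this]
  show "K b (stop x a) = K a (stop x a)" by (simp add: K_def F0_def G0_def)
qed

lemma K_time_deriv:
  assumes x: "x \<in> \<Omega>" and t: "0 \<le> t"
  shows "has_time_deriv K t (stop x t) 0"
  unfolding has_time_deriv_def
proof (rule tendsto_eventually)
  show "\<forall>\<^sub>F h in at_right 0. (K (t + h) (stop x t) - K t (stop x t)) / h = 0"
    unfolding eventually_at_right_field
  proof (intro exI[of _ 1] conjI allI impI)
    fix h :: real assume "0 < h"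
    then have "K (t + h) (stop x t) = K t (stop x t)" by (intro flatD[OF flat_K x t]) simp
    then show "(K (t + h) (stop x t) - K t (stop x t)) / h = 0" by simp
  qed simp
qed

lemma K_0: "x \<in> \<Omega> \<Longrightarrow> stop x 0 = x \<Longrightarrow> K 0 x = 0"
  by (simp add: K_def F0_def covariation_0)

text \<open>The quadratic terms of the product cancel against the jump of the covariation, so \<open>K\<close> is again
  affine in the size of the bump. At time 0 a bump also moves the initial value, so \<open>K\<close> vanishes there;
  this agrees with the bracket, which is 0 at time 0.\<close>

lemma K_space_grad:
  assumes x: "x \<in> \<Omega>" and t: "0 \<le> t"
  shows "has_space_grad K t (stop x t) (bracket \<pi> \<phi> \<psi> t (stop x t))"
proof -
  obtain U where U: "convex U" "0 \<in> interior U" "- jump x t \<in> U" "\<And>e. e \<in> U \<Longrightarrow> bump (stop x t) t e \<in> \<Omega>"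
    using ex_bump_nbhd[OF x t] by metis
  define w where "w = stop_left x t"
  have w: "w \<in> \<Omega>" unfolding w_def by (rule stop_left_mem[OF x t])
  define D where "D = H t w"
  have B: "bracket \<pi> \<phi> \<psi> t (stop x t) = D"
    unfolding D_def w_def by (rule left_version_stop[OF bracket_left_version x t])
  have K: "\<exists>k. \<forall>e\<in>U. K t (bump (stop x t) t e) = k + e \<bullet> D"
  proof (cases "t = 0")
    case True
    have "stop w 0 = w" unfolding w_def True by simp
    then have "D = 0" by (simp add: D_def H_def F0_def G0_def True)
    moreover have "K t (bump (stop x t) t e) = 0" if "e \<in> U" for e
      using K_0[OF U(4)[OF that]] stop_bump[OF t, of x e] unfolding True by blast
    ultimately show ?thesis by (intro exI[of _ 0]) simp
  next
    case False
    then have t0: "0 < t" using t by simp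
    define a b c p q where "a = F0 t w" and "b = G0 t w" and "c = covariation t w" and "p = \<phi> t w" and "q = \<psi> t w"
    have "K t (bump (stop x t) t e) = a * b - c + jump x t \<bullet> D + e \<bullet> D" if e: "e \<in> U" for e
    proof -
      define z where "z = bump (stop x t) t e"
      have z: "z \<in> \<Omega>" unfolding z_def by (rule U(4)[OF e])
      have sz: "stop z t = z" unfolding z_def by (rule stop_bump[OF t])
      \<comment> \<open>The left-stopped path does not see the bump, so a, b, c, p, q are the same
        for all e and only the jump of z varies.\<close>
      have slz: "stop_left z t = w" unfolding z_def w_def by (rule stop_left_bump[OF t0])
      have "left_lim z t = left_lim x t"
        using fun_cong[OF slz, of t] by (simp add: stop_left_def w_def)
      moreover have "z t = x t + e" using t by (simp add: z_def bump_def stop_def)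
      ultimately have jz: "jump z t = jump x t + e" by (simp add: jump_def)
      have s0: "stop z 0 = stop w 0"
        using stop_0_stop_left[OF cadlag_mem[OF z] t] by (simp add: slz)
      have Fz: "F t z = F t w + p \<bullet> jump z t"
        using M_b_jump[OF F z t0] agree_stop_left[OF F\<phi> z t] unfolding sz slz p_def by simp
      have Gz: "G t z = G t w + q \<bullet> jump z t"
        using M_b_jump[OF G z t0] agree_stop_left[OF G\<psi> z t] unfolding sz slz q_def by simp
      have cz: "covariation t z = c + (p \<bullet> jump z t) * (q \<bullet> jump z t)"
        using covariation_jump[OF z t0] unfolding sz slz J_def c_def p_def q_def .
      have "K t z = (a + p \<bullet> jump z t) * (b + q \<bullet> jump z t) - (c + (p \<bullet> jump z t) * (q \<bullet> jump z t))"
        by (simp add: K_def F0_def G0_def Fz Gz cz s0 a_def b_def diff_add_eq)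
      also have "\<dots> = a * b - c + jump z t \<bullet> D"
        by (simp add: D_def H_def inner_add_right inner_scaleR_right algebra_simps inner_commute flip: a_def b_def p_def q_def)
      finally show ?thesis by (simp add: z_def[symmetric] jz inner_add_left)
    qed
    then show ?thesis by (intro exI[of _ "a * b - c + jump x t \<bullet> D"]) blast
  qed
  then obtain k where k: "\<And>e. e \<in> U \<Longrightarrow> K t (bump (stop x t) t e) = k + e \<bullet> D" by blast
  have "((\<lambda>e. k + e \<bullet> D) has_derivative (\<lambda>h. h \<bullet> D)) (at 0)"
    by (auto intro!: derivative_eq_intros)
  then have "((\<lambda>e. K t (bump (stop x t) t e)) has_derivative (\<lambda>h. h \<bullet> D)) (at 0)"
    by (rule has_derivative_transform_within_open[OF _ open_interior U(2)])
      (simp add: k subsetD[OF interior_subset])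
  then show ?thesis unfolding has_space_grad_def gderiv_def B .
qed

lemma K_agree: "agree (space_grad K) (bracket \<pi> \<phi> \<psi>)"
  unfolding agree_def using space_grad_eqI[OF K_space_grad] by blast

lemma K_M_b: "K \<in> M_b \<pi> \<Omega>"
  unfolding M_b_def
proof (intro CollectI conjI ballI allI impI)
  show "continuous_functional \<pi> \<Omega> K" by (rule cont_K)
  show "differentiable_functional \<Omega> K"
    unfolding differentiable_functional_def using K_time_deriv K_space_grad by blast
  show "time_deriv K t (stop x t) = 0" if "x \<in> \<Omega>" "0 \<le> t" for x t
    by (rule time_deriv_eqI[OF K_time_deriv[OF that]])
  show "left_continuous \<pi> \<Omega> (space_grad K)"
    by (rule left_continuous_cong[OF left_version_left_continuous[OF bracket_left_version left_continuous_H] agree_sym[OF K_agree]])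
  show "strictly_causal \<Omega> (space_grad K)"
    by (rule strictly_causal_cong[OF left_version_strictly_causal[OF bracket_left_version] agree_sym[OF K_agree]])
  show "locally_bounded \<pi> \<Omega> (space_grad K)"
    by (rule locally_bounded_cong[OF bracket_locally_bounded agree_sym[OF K_agree]])
qed

theorem product_formula:
  "bracket \<pi> \<phi> \<psi> \<in> L_b \<pi> \<Omega> \<and>
    (\<forall>x\<in>\<Omega>. \<forall>t\<ge>0.
       pathwise_integral \<pi> \<phi> t x * pathwise_integral \<pi> \<psi> t x =
         (\<Sum>i\<in>UNIV. \<Sum>j\<in>UNIV.
            LS_integral (\<lambda>s. \<phi> s (stop_left x s) $ i * \<psi> s (stop_left x s) $ j)
              (\<lambda>s. quad_var \<pi> x s $ i $ j) t)
         + pathwise_integral \<pi> (bracket \<pi> \<phi> \<psi>) t x)"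
proof (intro conjI ballI allI impI)
  show "bracket \<pi> \<phi> \<psi> \<in> L_b \<pi> \<Omega>" unfolding L_b_iff using K_M_b K_agree by blast
  fix x t assume x: "x \<in> \<Omega>" and t: "0 \<le> (t::real)"
  \<comment> \<open>This removes the initial value in the representation of the integral by its
    primitive.\<close>
  have "K 0 (stop x 0) = 0" by (rule K_0[OF stop_mem[OF x order_refl]]) simp
  then have "pathwise_integral \<pi> (bracket \<pi> \<phi> \<psi>) t x = K t (stop x t)"
    using pathwise_integral_eq[OF K_M_b K_agree x t] by simp
  then show "pathwise_integral \<pi> \<phi> t x * pathwise_integral \<pi> \<psi> t x =
         (\<Sum>i\<in>UNIV. \<Sum>j\<in>UNIV.
            LS_integral (\<lambda>s. \<phi> s (stop_left x s) $ i * \<psi> s (stop_left x s) $ j)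
              (\<lambda>s. quad_var \<pi> x s $ i $ j) t)
         + pathwise_integral \<pi> (bracket \<pi> \<phi> \<psi>) t x"
    unfolding covariation_eq_LS[OF x t, symmetric] integral_eq[OF x t]
    by (simp add: K_def covariation_stop[OF x t])
qed

end

theorem theorem6p4:
  fixes \<pi> :: "nat \<Rightarrow> real list"
    and \<Omega> :: "(real \<Rightarrow> real ^ 'm) set"
    and \<phi> \<psi> :: "('m, real ^ 'm) functional"
  assumes "partition_seq \<pi>"
    and "\<Omega> \<subseteq> Q_paths \<pi>"
    and "generic \<pi> \<Omega>"
    and "\<phi> \<in> L_b \<pi> \<Omega>"
    and "\<psi> \<in> L_b \<pi> \<Omega>"
  shows "bracket \<pi> \<phi> \<psi> \<in> L_b \<pi> \<Omega> \<and>
    (\<forall>x\<in>\<Omega>. \<forall>t\<ge>0.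
       pathwise_integral \<pi> \<phi> t x * pathwise_integral \<pi> \<psi> t x =
         (\<Sum>i\<in>UNIV. \<Sum>j\<in>UNIV.
            LS_integral (\<lambda>s. \<phi> s (stop_left x s) $ i * \<psi> s (stop_left x s) $ j)
              (\<lambda>s. quad_var \<pi> x s $ i $ j) t)
         + pathwise_integral \<pi> (bracket \<pi> \<phi> \<psi>) t x)"
proof -
  interpret generic_Q \<pi> \<Omega>
    by unfold_locales (fact assms(1), fact assms(3), fact assms(2))
  obtain F where F: "F \<in> M_b \<pi> \<Omega>" "agree (space_grad F) \<phi>" using assms(4) unfolding L_b_iff by blast
  obtain G where G: "G \<in> M_b \<pi> \<Omega>" "agree (space_grad G) \<psi>" using assms(5) unfolding L_b_iff by blast
  interpret integral_pair \<pi> \<Omega> \<phi> \<psi> F G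
    by unfold_locales (fact F G)+
  show ?thesis by (rule product_formula)
qed

end
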